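(* Let $p$ be a prime, $q$ a power of $p$, $W=W(\mathbb{F}_q)$ with $p$-power Frobenius $\sigma$, and for $\nu\ge1$ let $W_\nu=W(\mathbb{F}_{q^\nu})$, $W_{n,\nu}=W_\nu/p^n$, and $A_\nu=W_\nu\{F,V\}$ the noncommutative ring generated over $W_\nu$ by $F,V$ with $FV=VF=p$, $F\alpha=\sigma(\alpha)F$, $\alpha V=V\sigma(\alpha)$. Let $\langle p\rangle\subset\mathbb{Q}^\times$ be the cyclic group generated by $p$. Let $I$ be a finite set with an action of $\langle p\rangle$ written $i\mapsto pi$, written as a disjoint union $I=I_0\cup I_1$, and choose $c_i\in W$ with $\mathrm{ord}_p(c_i)=0$ for $i\in I_0$ and $\mathrm{ord}_p(c_i)=1$ for $i\in I_1$. Let $M=\bigoplus_{i\in I}We_i$ with $\sigma$-semilinear $F(e_i)=c_ie_{pi}$ and $\sigma^{-1}$-semilinear $V(e_i)=\frac{p}{\sigma^{-1}(c_{i/p})}e_{i/p}$. Similarly let $J=J_0\cup J_1$ be a finite set with $\langle p\rangle$-action, $d_j\in W$ with $\mathrm{ord}_p(d_j)=0$ on $J_0$ and $1$ on $J_1$, and $N=\bigoplus_{j\in J}Wf_j$ with $F(f_j)=d_jf_{pj}$, $V(f_j)=\frac{p}{\sigma^{-1}(d_{j/p})}f_{j/p}$. Put $M_\nu=M\otimes_WW_\nu$, $M_{n,\nu}=M\otimes_WW_{n,\nu}$, and likewise $N_\nu,N_{n,\nu}$; these are $A_\nu$-modules. Let $O$ be the set of orbits of $\langle p\rangle$ acting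 diagonally on $I\times J$, and for $o\in O$ let $d(o)=\min(|(I_0\times J_1)\cap o|,|(I_1\times J_0)\cap o|)$. Let $\varphi_{ij}\in\mathrm{Hom}_{W_\nu}(N_\nu,M_\nu)$ send $f_j\mapsto e_i$ and $f_{j'}\mapsto0$ for $j'\ne j$ (and use the same notation for the induced elements of $\mathrm{Hom}_{W_{\nu}}(N_{n,\nu},M_{n,\nu})$). Let $H_\nu=\mathrm{Hom}_{A_\nu}(N_\nu,M_\nu)$ and $H_{n,\nu}=\mathrm{Hom}_{A_\nu}(N_{n,\nu},M_{n,\nu})$ (homomorphisms commuting with $F$ and $V$), and for $o\in O$ let $H_\nu^o$, $H^o_{n,\nu}$ be the subgroups of elements $\sum\alpha_{i,j}\varphi_{i,j}$ with $\alpha_{i,j}=0$ whenever $(i,j)\notin o$. Then: (1) $H_\nu=\bigoplus_{o\in O}H_\nu^o$ and $H_{n,\nu}=\bigoplus_{o\in O}H_{n,\nu}^o$; (2) $|H_\nu^o/p^n|\le p^{n|o|}$, in particular it is bounded independently of $\nu$; (3) for all sufficiently large $n$, $\displaystyle\lim_{\nu\to\infty}\frac{\log|H_{n,\nu}^o|}{\log(q^\nu)}=d(o)$. *)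

theory Defs
  imports
    "HOL-Algebra.Algebra"
    "HOL-Library.Poly_Mapping"
    "HOL-Library.Extended_Nat"
    "HOL-Computational_Algebra.Computational_Algebra"
begin

section \<open>\<open>p\<close>-typical Witt vectors\<close>

text \<open>
  Integer polynomials in the variables \<open>X\<^sub>0, X\<^sub>1, \<dots>\<close> (indexed by \<open>Inl\<close>) and
  \<open>Y\<^sub>0, Y\<^sub>1, \<dots>\<close> (indexed by \<open>Inr\<close>): finitely supported maps from monomials to coefficients.
\<close>

type_synonym zpoly = "((nat + nat) \<Rightarrow>\<^sub>0 nat) \<Rightarrow>\<^sub>0 int"

definition zvar :: "nat + nat \<Rightarrow> zpoly" where
  "zvar v = Poly_Mapping.single (Poly_Mapping.single v 1) 1"

definition zeval :: "(nat + nat \<Rightarrow> 'a::comm_ring_1) \<Rightarrow> zpoly \<Rightarrow> 'a" where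
  "zeval a P = (\<Sum>m\<in>Poly_Mapping.keys P. of_int (Poly_Mapping.lookup P m) * (\<Prod>v\<in>Poly_Mapping.keys m. a v ^ Poly_Mapping.lookup m v))"

text \<open>The Witt polynomial \<open>w\<^sub>n\<close>: ghost component \<open>n\<close> of a sequence.\<close>

definition ghost :: "nat \<Rightarrow> nat \<Rightarrow> (nat \<Rightarrow> 'a::comm_semiring_1) \<Rightarrow> 'a" where
  "ghost p n x = (\<Sum>i\<le>n. of_nat (p ^ i) * x i ^ (p ^ (n - i)))"

text \<open>
  By Witt's theorem there are unique sequences of integer polynomials whose ghost components are
  the sums, respectively products, of those of \<open>X\<close> and \<open>Y\<close>.
\<close>

definition witt_sum_poly :: "nat \<Rightarrow> nat \<Rightarrow> zpoly" where
  "witt_sum_poly p = (THE S. \<forall>n. ghost p n S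
     = ghost p n (\<lambda>i. zvar (Inl i)) + ghost p n (\<lambda>i. zvar (Inr i)))"

definition witt_prod_poly :: "nat \<Rightarrow> nat \<Rightarrow> zpoly" where
  "witt_prod_poly p = (THE P. \<forall>n. ghost p n P
     = ghost p n (\<lambda>i. zvar (Inl i)) * ghost p n (\<lambda>i. zvar (Inr i)))"

type_synonym 'k wvec = "nat \<Rightarrow> 'k"

text \<open>The ring of Witt vectors over a subring \<open>S\<close> of the ambient ring \<open>'k\<close>.\<close>

definition witt_ring :: "nat \<Rightarrow> 'k::comm_ring_1 set \<Rightarrow> 'k wvec ring" where
  "witt_ring p S =
     \<lparr>carrier = {x. \<forall>n. x n \<in> S},
      monoid.mult = (\<lambda>a b n. zeval (case_sum a b) (witt_prod_poly p n)),
      one = (\<lambda>n. if n = 0 then 1 else 0),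
      ring.zero = (\<lambda>n. 0),
      ring.add = (\<lambda>a b n. zeval (case_sum a b) (witt_sum_poly p n))\<rparr>"

text \<open>
  \<open>W(\<bbbF>\<^sub>Q)\<close>, where \<open>\<bbbF>\<^sub>Q\<close> is the subfield of order \<open>Q\<close> of an algebraically closed field \<open>'k\<close> of
  characteristic \<open>p\<close> (\<open>Q\<close> a power of \<open>p\<close>). All the rings \<open>W(\<bbbF>\<^sub>Q)\<close> thus lie inside \<open>W('k)\<close>, with
  the same operations.
\<close>

definition WF :: "nat \<Rightarrow> nat \<Rightarrow> 'k::alg_closed_field wvec ring" where
  "WF p Q = witt_ring p {x. x ^ Q = x}"

text \<open>
  The lift of the \<open>p\<close>-power Frobenius, on all of \<open>W('k)\<close>. It is bijective there and restricts to a
  bijection of each \<open>W(\<bbbF>\<^sub>Q)\<close>, so its inverse is \<open>inv_into UNIV (wfrob p)\<close>.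
\<close>

definition wfrob :: "nat \<Rightarrow> 'k::alg_closed_field wvec \<Rightarrow> 'k wvec" where
  "wfrob p x = (\<lambda>n. x n ^ p)"

definition p_elt :: "nat \<Rightarrow> ('a, 'm) ring_scheme \<Rightarrow> 'a" where
  "p_elt p R = [p] \<cdot>\<^bsub>R\<^esub> \<one>\<^bsub>R\<^esub>"

definition ord_p :: "nat \<Rightarrow> ('a, 'm) ring_scheme \<Rightarrow> 'a \<Rightarrow> enat" where
  "ord_p p R x = Sup {enat n | n. (p_elt p R [^]\<^bsub>R\<^esub> n) divides\<^bsub>R\<^esub> x}"

text \<open>Exact division in a domain.\<close>

definition exact_quot :: "('a, 'm) ring_scheme \<Rightarrow> 'a \<Rightarrow> 'a \<Rightarrow> 'a" where
  "exact_quot R a b = (THE y. y \<in> carrier R \<and> y \<otimes>\<^bsub>R\<^esub> b = a)"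

definition pn_ideal :: "nat \<Rightarrow> nat \<Rightarrow> ('a, 'm) ring_scheme \<Rightarrow> 'a set" where
  "pn_ideal p n R = PIdl\<^bsub>R\<^esub> (p_elt p R [^]\<^bsub>R\<^esub> n)"


section \<open>The group generated by \<open>p\<close> in the multiplicative group of the rationals\<close>

definition rat_mult_group :: "rat monoid" where
  "rat_mult_group = \<lparr>carrier = UNIV - {0}, monoid.mult = (*), one = 1\<rparr>"

definition p_group :: "nat \<Rightarrow> rat monoid" where
  "p_group p = subgroup_generated rat_mult_group {of_nat p}"

definition diag_act :: "(rat \<Rightarrow> 'i \<Rightarrow> 'i) \<Rightarrow> (rat \<Rightarrow> 'j \<Rightarrow> 'j) \<Rightarrow> rat \<Rightarrow> 'i \<times> 'j \<Rightarrow> 'i \<times> 'j" where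
  "diag_act a b g = (\<lambda>(i, j). (a g i, b g j))"

definition diag_orbits ::
    "nat \<Rightarrow> 'i set \<Rightarrow> (rat \<Rightarrow> 'i \<Rightarrow> 'i) \<Rightarrow> 'j set \<Rightarrow> (rat \<Rightarrow> 'j \<Rightarrow> 'j) \<Rightarrow> ('i \<times> 'j) set set" where
  "diag_orbits p I a J b = orbits (p_group p) (I \<times> J) (diag_act a b)"

definition orbit_dim ::
    "'i set \<Rightarrow> 'i set \<Rightarrow> 'j set \<Rightarrow> 'j set \<Rightarrow> ('i \<times> 'j) set \<Rightarrow> nat" where
  "orbit_dim I0 I1 J0 J1 o' = min (card ((I0 \<times> J1) \<inter> o')) (card ((I1 \<times> J0) \<inter> o'))"


section \<open>Modules with Frobenius and Verschiebung\<close>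

text \<open>
  A left module over \<open>A = R{F,V}\<close> (\<open>R = W(\<bbbF>\<^sub>Q)\<close>) is an \<open>R\<close>-module with a \<open>\<sigma>\<close>-semilinear \<open>F\<close> and a
  \<open>\<sigma>\<^sup>-\<^sup>1\<close>-semilinear \<open>V\<close> such that \<open>FV = VF = p\<close>. As usual for modules in HOL-Algebra, the ring
  multiplication and unit inherited by the record are not used.
\<close>

record ('r, 'm) fv_module = "('r, 'm) module" +
  frob :: "'m \<Rightarrow> 'm"
  ver :: "'m \<Rightarrow> 'm"

text \<open>
  For a \<open>W(\<bbbF>\<^sub>q)\<close>-algebra \<open>S\<close> that is a quotient \<open>\<pi> : R \<rightarrow> S\<close> of \<open>R = W(\<bbbF>\<^sub>Q)\<close>, with \<open>s\<close>, \<open>t\<close> the maps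
  induced on \<open>S\<close> by \<open>\<sigma>\<close>, \<open>\<sigma>\<^sup>-\<^sup>1\<close>, this is the base change to \<open>S\<close> of the free module with basis
  \<open>e\<^sub>i\<close> (\<open>i \<in> I\<close>): an element \<open>\<Sum>\<^sub>i x\<^sub>i e\<^sub>i\<close> is given by its coordinates, and \<open>R\<close> acts through \<open>\<pi>\<close>.
  From \<open>F(e\<^sub>i) = c\<^sub>i e\<^sub>p\<^sub>i\<close> and \<open>V(e\<^sub>p\<^sub>i) = (p / \<sigma>\<^sup>-\<^sup>1(c\<^sub>i)) e\<^sub>i\<close> (that is,
  \<open>V(e\<^sub>i) = (p / \<sigma>\<^sup>-\<^sup>1(c\<^sub>i\<^sub>/\<^sub>p)) e\<^sub>i\<^sub>/\<^sub>p\<close>) and semilinearity, the coordinate of \<open>F x\<close> at \<open>i\<close> is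
  \<open>c\<^sub>i\<^sub>/\<^sub>p \<sigma>(x\<^sub>i\<^sub>/\<^sub>p)\<close> and that of \<open>V x\<close> is \<open>(p / \<sigma>\<^sup>-\<^sup>1(c\<^sub>i)) \<sigma>\<^sup>-\<^sup>1(x\<^sub>p\<^sub>i)\<close>. The quotient
  \<open>p / \<sigma>\<^sup>-\<^sup>1(c\<^sub>i)\<close> is formed in \<open>W(\<bbbF>\<^sub>q)\<close>, before base change.
\<close>

definition base_change ::
    "nat \<Rightarrow> nat \<Rightarrow> 's ring \<Rightarrow> ('k::alg_closed_field wvec \<Rightarrow> 's) \<Rightarrow> ('s \<Rightarrow> 's) \<Rightarrow> ('s \<Rightarrow> 's)
      \<Rightarrow> 'i set \<Rightarrow> (rat \<Rightarrow> 'i \<Rightarrow> 'i) \<Rightarrow> ('i \<Rightarrow> 'k wvec) \<Rightarrow> ('k wvec, 'i \<Rightarrow> 's) fv_module" where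
  "base_change p q S \<pi> s t I act c =
     \<lparr>carrier = I \<rightarrow>\<^sub>E carrier S,
      monoid.mult = undefined,
      one = undefined,
      ring.zero = (\<lambda>i\<in>I. \<zero>\<^bsub>S\<^esub>),
      ring.add = (\<lambda>x y. \<lambda>i\<in>I. x i \<oplus>\<^bsub>S\<^esub> y i),
      module.smult = (\<lambda>a x. \<lambda>i\<in>I. \<pi> a \<otimes>\<^bsub>S\<^esub> x i),
      frob = (\<lambda>x. \<lambda>i\<in>I. let i' = act (inverse (of_nat p)) i in \<pi> (c i') \<otimes>\<^bsub>S\<^esub> s (x i')),
      ver = (\<lambda>x. \<lambda>i\<in>I. \<pi> (exact_quot (WF p q) (p_elt p (WF p q)) (inv_into UNIV (wfrob p) (c i)))
                          \<otimes>\<^bsub>S\<^esub> t (x (act (of_nat p) i)))\<rparr>"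

text \<open>\<open>M\<^sub>\<nu> = M \<otimes> W\<^sub>\<nu>\<close> with \<open>W\<^sub>\<nu> = WF p (q ^ \<nu>)\<close>.\<close>

definition M_full ::
    "nat \<Rightarrow> nat \<Rightarrow> nat \<Rightarrow> 'i set \<Rightarrow> (rat \<Rightarrow> 'i \<Rightarrow> 'i) \<Rightarrow> ('i \<Rightarrow> 'k::alg_closed_field wvec)
      \<Rightarrow> ('k wvec, 'i \<Rightarrow> 'k wvec) fv_module" where
  "M_full p q \<nu> I act c =
     base_change p q (WF p (q ^ \<nu>)) id (wfrob p) (inv_into UNIV (wfrob p)) I act c"

text \<open>
  \<open>M\<^sub>n\<^sub>,\<^sub>\<nu> = M \<otimes> W\<^sub>n\<^sub>,\<^sub>\<nu>\<close> with \<open>W\<^sub>n\<^sub>,\<^sub>\<nu> = W\<^sub>\<nu>/p\<^sup>n\<close>. Elements of the quotient ring are cosets, and the maps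
  induced by \<open>\<sigma>\<close> and \<open>\<sigma>\<^sup>-\<^sup>1\<close> send a coset to its image.
\<close>

definition M_trunc ::
    "nat \<Rightarrow> nat \<Rightarrow> nat \<Rightarrow> nat \<Rightarrow> 'i set \<Rightarrow> (rat \<Rightarrow> 'i \<Rightarrow> 'i) \<Rightarrow> ('i \<Rightarrow> 'k::alg_closed_field wvec)
      \<Rightarrow> ('k wvec, 'i \<Rightarrow> 'k wvec set) fv_module" where
  "M_trunc p q n \<nu> I act c =
     (let R = WF p (q ^ \<nu>); P = pn_ideal p n R in
      base_change p q (R Quot P) (\<lambda>a. P +>\<^bsub>R\<^esub> a) ((`) (wfrob p)) ((`) (inv_into UNIV (wfrob p))) I act c)"


section \<open>Homomorphisms\<close>

text \<open>\<open>Hom\<^sub>R(N, M)\<close> as an \<open>R\<close>-module.\<close>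

definition lin_hom ::
    "('r, 'x) ring_scheme \<Rightarrow> ('r, 'b, 'y) module_scheme \<Rightarrow> ('r, 'c, 'z) module_scheme
      \<Rightarrow> ('r, 'b \<Rightarrow> 'c) module" where
  "lin_hom R N M =
     \<lparr>carrier = {h \<in> carrier N \<rightarrow>\<^sub>E carrier M.
        (\<forall>x\<in>carrier N. \<forall>y\<in>carrier N. h (x \<oplus>\<^bsub>N\<^esub> y) = h x \<oplus>\<^bsub>M\<^esub> h y) \<and>
        (\<forall>a\<in>carrier R. \<forall>x\<in>carrier N. h (a \<odot>\<^bsub>N\<^esub> x) = a \<odot>\<^bsub>M\<^esub> h x)},
      monoid.mult = undefined,
      one = undefined,
      ring.zero = (\<lambda>x\<in>carrier N. \<zero>\<^bsub>M\<^esub>),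
      ring.add = (\<lambda>g h. \<lambda>x\<in>carrier N. g x \<oplus>\<^bsub>M\<^esub> h x),
      module.smult = (\<lambda>a h. \<lambda>x\<in>carrier N. a \<odot>\<^bsub>M\<^esub> h x)\<rparr>"

text \<open>
  The additive group \<open>Hom\<^sub>A(N, M)\<close>, written multiplicatively as a HOL-Algebra group.
\<close>

definition fv_hom ::
    "('r, 'x) ring_scheme \<Rightarrow> ('r, 'b) fv_module \<Rightarrow> ('r, 'c) fv_module \<Rightarrow> ('b \<Rightarrow> 'c) monoid" where
  "fv_hom R N M =
     \<lparr>carrier = {h \<in> carrier (lin_hom R N M). \<forall>x\<in>carrier N.
        h (frob N x) = frob M (h x) \<and> h (ver N x) = ver M (h x)},
      monoid.mult = ring.add (lin_hom R N M),
      one = ring.zero (lin_hom R N M)\<rparr>"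

text \<open>
  \<open>\<phi>\<^sub>i\<^sub>j : N \<rightarrow> M\<close>, \<open>f\<^sub>j \<mapsto> e\<^sub>i\<close>, \<open>f\<^sub>j\<^sub>' \<mapsto> 0\<close>, for modules given by coordinates: \<open>x \<mapsto> x\<^sub>j e\<^sub>i\<close>.
\<close>

definition elem_hom ::
    "('r, 'j \<Rightarrow> 's) fv_module \<Rightarrow> ('r, 'i \<Rightarrow> 's) fv_module \<Rightarrow> 'i \<times> 'j
      \<Rightarrow> ('j \<Rightarrow> 's) \<Rightarrow> ('i \<Rightarrow> 's)" where
  "elem_hom N M = (\<lambda>(i, j). \<lambda>x\<in>carrier N. \<zero>\<^bsub>M\<^esub>(i := x j))"

text \<open>
  The part of \<open>Hom\<^sub>A(N, M)\<close> supported on \<open>o'\<close>. When \<open>R\<close> acts through a quotient \<open>S\<close>, coefficients in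
  \<open>R\<close> and in \<open>S\<close> give the same subgroup, since \<open>0\<close> lifts to \<open>0\<close>.
\<close>

definition fv_hom_supp ::
    "('r, 'x) ring_scheme \<Rightarrow> 'j set \<Rightarrow> ('r, 'j \<Rightarrow> 's) fv_module \<Rightarrow> 'i set \<Rightarrow> ('r, 'i \<Rightarrow> 's) fv_module
      \<Rightarrow> ('i \<times> 'j) set \<Rightarrow> (('j \<Rightarrow> 's) \<Rightarrow> ('i \<Rightarrow> 's)) set" where
  "fv_hom_supp R J N I M o' =
     {h \<in> carrier (fv_hom R N M). \<exists>\<alpha> \<in> I \<times> J \<rightarrow> carrier R.
        (\<forall>ij \<in> I \<times> J. ij \<notin> o' \<longrightarrow> \<alpha> ij = \<zero>\<^bsub>R\<^esub>) \<and>
        h = (\<Oplus>\<^bsub>lin_hom R N M\<^esub>ij\<in>I \<times> J. \<alpha> ij \<odot>\<^bsub>lin_hom R N M\<^esub> elem_hom N M ij)}"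

definition restrict_group :: "'a monoid \<Rightarrow> 'a set \<Rightarrow> 'a monoid" where
  "restrict_group G H = G\<lparr>carrier := H\<rparr>"

text \<open>\<open>G\<close> is the internal direct sum of the subgroups \<open>K x\<close> for \<open>x\<close> in the finite set \<open>B\<close>.\<close>

definition internal_direct_sum :: "'a monoid \<Rightarrow> 'x set \<Rightarrow> ('x \<Rightarrow> 'a set) \<Rightarrow> bool" where
  "internal_direct_sum G B K \<longleftrightarrow>
     finite B \<and> comm_group G \<and> (\<forall>x\<in>B. subgroup (K x) G) \<and>
     (\<lambda>k. finprod G k B) \<in> iso (sum_group B (\<lambda>x. restrict_group G (K x))) G"

text \<open>The quotient \<open>G/mG\<close> of an abelian group (again written multiplicatively).\<close>

definition quot_mult :: "nat \<Rightarrow> 'a monoid \<Rightarrow> 'a set monoid" where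
  "quot_mult m G = G Mod ((\<lambda>x. x [^]\<^bsub>G\<^esub> m) ` carrier G)"

text \<open>\<open>H\<^sub>\<nu>\<close>, \<open>H\<^sub>n\<^sub>,\<^sub>\<nu>\<close> and their subgroups attached to an orbit.\<close>

definition H_full ::
    "nat \<Rightarrow> nat \<Rightarrow> nat
      \<Rightarrow> 'i set \<Rightarrow> (rat \<Rightarrow> 'i \<Rightarrow> 'i) \<Rightarrow> ('i \<Rightarrow> 'k::alg_closed_field wvec)
      \<Rightarrow> 'j set \<Rightarrow> (rat \<Rightarrow> 'j \<Rightarrow> 'j) \<Rightarrow> ('j \<Rightarrow> 'k wvec)
      \<Rightarrow> (('j \<Rightarrow> 'k wvec) \<Rightarrow> ('i \<Rightarrow> 'k wvec)) monoid" where
  "H_full p q \<nu> I a c J b d =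
     fv_hom (WF p (q ^ \<nu>)) (M_full p q \<nu> J b d) (M_full p q \<nu> I a c)"

definition H_full_orb ::
    "nat \<Rightarrow> nat \<Rightarrow> nat
      \<Rightarrow> 'i set \<Rightarrow> (rat \<Rightarrow> 'i \<Rightarrow> 'i) \<Rightarrow> ('i \<Rightarrow> 'k::alg_closed_field wvec)
      \<Rightarrow> 'j set \<Rightarrow> (rat \<Rightarrow> 'j \<Rightarrow> 'j) \<Rightarrow> ('j \<Rightarrow> 'k wvec)
      \<Rightarrow> ('i \<times> 'j) set \<Rightarrow> (('j \<Rightarrow> 'k wvec) \<Rightarrow> ('i \<Rightarrow> 'k wvec)) set" where
  "H_full_orb p q \<nu> I a c J b d =
     fv_hom_supp (WF p (q ^ \<nu>)) J (M_full p q \<nu> J b d) I (M_full p q \<nu> I a c)"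

definition H_trunc ::
    "nat \<Rightarrow> nat \<Rightarrow> nat \<Rightarrow> nat
      \<Rightarrow> 'i set \<Rightarrow> (rat \<Rightarrow> 'i \<Rightarrow> 'i) \<Rightarrow> ('i \<Rightarrow> 'k::alg_closed_field wvec)
      \<Rightarrow> 'j set \<Rightarrow> (rat \<Rightarrow> 'j \<Rightarrow> 'j) \<Rightarrow> ('j \<Rightarrow> 'k wvec)
      \<Rightarrow> (('j \<Rightarrow> 'k wvec set) \<Rightarrow> ('i \<Rightarrow> 'k wvec set)) monoid" where
  "H_trunc p q n \<nu> I a c J b d =
     fv_hom (WF p (q ^ \<nu>)) (M_trunc p q n \<nu> J b d) (M_trunc p q n \<nu> I a c)"

definition H_trunc_orb ::
    "nat \<Rightarrow> nat \<Rightarrow> nat \<Rightarrow> nat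
      \<Rightarrow> 'i set \<Rightarrow> (rat \<Rightarrow> 'i \<Rightarrow> 'i) \<Rightarrow> ('i \<Rightarrow> 'k::alg_closed_field wvec)
      \<Rightarrow> 'j set \<Rightarrow> (rat \<Rightarrow> 'j \<Rightarrow> 'j) \<Rightarrow> ('j \<Rightarrow> 'k wvec)
      \<Rightarrow> ('i \<times> 'j) set \<Rightarrow> (('j \<Rightarrow> 'k wvec set) \<Rightarrow> ('i \<Rightarrow> 'k wvec set)) set" where
  "H_trunc_orb p q n \<nu> I a c J b d =
     fv_hom_supp (WF p (q ^ \<nu>)) J (M_trunc p q n \<nu> J b d) I (M_trunc p q n \<nu> I a c)"

end

theory Submission
  imports Defs
begin

text \<open>
  A homomorphism \<open>\<Sum> \<alpha>\<^sub>i\<^sub>j \<phi>\<^sub>i\<^sub>j\<close> commutes with \<open>F\<close> and \<open>V\<close> iff its coefficients along each orbit of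
  \<open>I \<times> J\<close> satisfy a cyclic system \<open>p\<^sup>b u \<alpha>\<^sub>k\<^sub>+\<^sub>1 = p\<^sup>a \<sigma>(\<alpha>\<^sub>k)\<close> with units \<open>u\<close>, where \<open>(a, b)\<close> is \<open>(1, 0)\<close> at
  the points of \<open>I\<^sub>1 \<times> J\<^sub>0\<close>, \<open>(0, 1)\<close> at those of \<open>I\<^sub>0 \<times> J\<^sub>1\<close>, and \<open>(0, 0)\<close> elsewhere; this gives the
  decomposition (1). An exact solution modulo \<open>p\<close> is determined by the residue of one coefficient,
  which satisfies \<open>\<sigma>\<^sup>m(x) = u x\<close> where \<open>m\<close> is the length of the cycle, hence (2). For (3), let \<open>A\<close> and \<open>B\<close>
  count the equations with \<open>a = 1\<close> and \<open>b = 1\<close>, and let \<open>A \<le> B\<close>; reversing the cycle exchanges them.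
  From a suitable starting point, going once around the cycle gives a semilinear equation for one
  coefficient, with a number of solutions bounded independently of \<open>\<nu>\<close>, and each equation with
  \<open>a = 1\<close> leaves the top component of one further coefficient free: this is the upper bound.
  Matching the equations with \<open>a = 1\<close> to ones with \<open>b = 1\<close> like parentheses yields \<open>A\<close> independent
  families of solutions, each parametrised by the residue field: this is the lower bound.
\<close>

section \<open>Evaluation of integer polynomials\<close>

text \<open>Modulo p^n a factor p cannot be cancelled without losing a digit, so the equations along
  a cycle cannot simply be composed. The cycle lemma removes this obstacle: if A <= B, some starting
  point keeps all partial sums of a - b nonpositive, and from there the composite holds to full
  precision. It reads \<tau>^m(y) = p^(B-A) U y with a unit U. For A < B this forces y = 0; for A =
  B there are at most p^m choices per digit, hence the constant p^(nm). The count is made over the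
  whole algebraically closed field and so does not see \<nu>. The threshold for n is the orbit
  length m: along a matched segment the walk rises by less than m, so the exponents n - 1 - height
  are nonnegative. All the rings W_\<nu> are placed in one Witt ring, as fixed rings of powers of
  \<sigma>, and the precision n is an extended natural number, so that exact and truncated
  homomorphisms share one development.\<close>

type_synonym 'v zmpoly = "('v \<Rightarrow>\<^sub>0 nat) \<Rightarrow>\<^sub>0 int"

definition mono_eval :: "('v \<Rightarrow> 'a::comm_ring_1) \<Rightarrow> ('v \<Rightarrow>\<^sub>0 nat) \<Rightarrow> 'a" where
  "mono_eval a m = (\<Prod>v\<in>Poly_Mapping.keys m. a v ^ Poly_Mapping.lookup m v)"

text \<open>Variables of arbitrary type are allowed, because later the elements of the field itself
  index the variables.\<close>

definition poly_eval :: "('v \<Rightarrow> 'a::comm_ring_1) \<Rightarrow> 'v zmpoly \<Rightarrow> 'a" where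
  "poly_eval a P = (\<Sum>m\<in>Poly_Mapping.keys P. of_int (Poly_Mapping.lookup P m) * mono_eval a m)"

definition poly_var :: "'v \<Rightarrow> 'v zmpoly" where
  "poly_var v = Poly_Mapping.single (Poly_Mapping.single v 1) 1"

lemma zeval_eq_poly_eval: "zeval = poly_eval"
  by (intro ext) (simp add: zeval_def poly_eval_def mono_eval_def)

lemma zvar_eq_poly_var: "zvar = poly_var"
  by (intro ext) (simp add: zvar_def poly_var_def)

lemma mono_eval_superset:
  assumes "finite A" "Poly_Mapping.keys m \<subseteq> A"
  shows "mono_eval a m = (\<Prod>v\<in>A. a v ^ Poly_Mapping.lookup m v)"
  unfolding mono_eval_def
  by (rule prod.mono_neutral_left) (use assms in \<open>auto simp: in_keys_iff\<close>)

lemma mono_eval_0 [simp]: "mono_eval a 0 = 1"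
  by (simp add: mono_eval_def)

lemma mono_eval_add: "mono_eval a (m + n) = mono_eval a m * mono_eval a n"
proof -
  let ?A = "Poly_Mapping.keys m \<union> Poly_Mapping.keys n"
  have "mono_eval a (m + n) = (\<Prod>v\<in>?A. a v ^ Poly_Mapping.lookup (m + n) v)"
    by (rule mono_eval_superset) (use Poly_Mapping.keys_add[of m n] in auto)
  also have "\<dots> = mono_eval a m * mono_eval a n"
    by (simp add: lookup_add power_add prod.distrib mono_eval_superset[of ?A])
  finally show ?thesis .
qed

lemma poly_eval_superset:
  assumes "finite A" "Poly_Mapping.keys P \<subseteq> A"
  shows "poly_eval a P = (\<Sum>m\<in>A. of_int (Poly_Mapping.lookup P m) * mono_eval a m)"
  unfolding poly_eval_def
  by (rule sum.mono_neutral_left) (use assms in \<open>auto simp: in_keys_iff\<close>)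

lemma poly_eval_0 [simp]: "poly_eval a 0 = 0"
  by (simp add: poly_eval_def)

lemma poly_eval_add: "poly_eval a (P + Q) = poly_eval a P + poly_eval a Q"
proof -
  let ?A = "Poly_Mapping.keys P \<union> Poly_Mapping.keys Q"
  have "poly_eval a (P + Q) = (\<Sum>m\<in>?A. of_int (Poly_Mapping.lookup (P + Q) m) * mono_eval a m)"
    by (rule poly_eval_superset) (use Poly_Mapping.keys_add[of P Q] in auto)
  also have "\<dots> = poly_eval a P + poly_eval a Q"
    by (simp add: lookup_add distrib_right sum.distrib poly_eval_superset[of ?A])
  finally show ?thesis .
qed

lemma poly_eval_single: "poly_eval a (Poly_Mapping.single m c) = of_int c * mono_eval a m"
  by (simp add: poly_eval_def)

lemma poly_mapping_sum_single:
  fixes P :: "'a \<Rightarrow>\<^sub>0 'b::comm_monoid_add"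
  shows "P = (\<Sum>m\<in>Poly_Mapping.keys P. Poly_Mapping.single m (Poly_Mapping.lookup P m))"
proof (rule poly_mapping_eqI)
  fix k
  have "(\<Sum>m\<in>Poly_Mapping.keys P. Poly_Mapping.lookup (Poly_Mapping.single m (Poly_Mapping.lookup P m)) k)
      = (\<Sum>m\<in>Poly_Mapping.keys P. if m = k then Poly_Mapping.lookup P m else 0)"
    by (intro sum.cong) (auto simp: lookup_single when_def)
  also have "\<dots> = Poly_Mapping.lookup P k"
    by (simp add: in_keys_iff)
  finally show "Poly_Mapping.lookup P k = Poly_Mapping.lookup (\<Sum>m\<in>Poly_Mapping.keys P. Poly_Mapping.single m (Poly_Mapping.lookup P m)) k"
    by (simp add: lookup_sum)
qed

lemma poly_mapping_single_add_induct [case_names single add]: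
  fixes P :: "'a \<Rightarrow>\<^sub>0 'b::comm_monoid_add"
  assumes "\<And>m c. R (Poly_Mapping.single m c)" "\<And>P Q. R P \<Longrightarrow> R Q \<Longrightarrow> R (P + Q)"
  shows "R P"
proof -
  have "R (\<Sum>m\<in>A. Poly_Mapping.single m (f m))" if "finite A" for A f
    using that
    by (induction A rule: finite_induct) (use assms(1)[of _ 0] in \<open>simp_all add: assms\<close>)
  then have "R (\<Sum>m\<in>Poly_Mapping.keys P. Poly_Mapping.single m (Poly_Mapping.lookup P m))"
    by simp
  then show ?thesis
    using poly_mapping_sum_single[of P] by simp
qed

lemma poly_eval_mult: "poly_eval a (P * Q) = poly_eval a P * poly_eval a Q"
proof (induction P rule: poly_mapping_single_add_induct)
  case (single m c)
  show ?case
    by (induction Q rule: poly_mapping_single_add_induct)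
       (simp_all add: mult_single poly_eval_single mono_eval_add poly_eval_add algebra_simps)
qed (simp_all add: algebra_simps poly_eval_add)

lemma poly_eval_1 [simp]: "poly_eval a 1 = 1"
  using poly_eval_single[of a 0 1] by simp

lemma poly_eval_power: "poly_eval a (P ^ n) = poly_eval a P ^ n"
  by (induction n) (simp_all add: poly_eval_mult)

lemma poly_eval_of_nat [simp]: "poly_eval a (of_nat n) = of_nat n"
  by (induction n) (simp_all add: poly_eval_add)

lemma poly_eval_var [simp]: "poly_eval a (poly_var v) = a v"
  by (simp add: poly_var_def poly_eval_single mono_eval_def)

lemma poly_eval_diff: "poly_eval a (P - Q) = poly_eval a P - poly_eval a Q"
  using poly_eval_add[of a "P - Q" Q] by simp

lemma poly_eval_dvd:
  assumes "of_nat n dvd P"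
  shows "of_nat n dvd poly_eval a P"
  using assms by (auto elim!: dvdE simp: poly_eval_mult)

text \<open>Integer polynomials, and with them ghost components, commute with every ring
  homomorphism. Evaluations, the Frobenius lift, the residue map and the powers of \<sigma> are all
  instances.\<close>

locale comm_ring_map =
  fixes h :: "'a::comm_ring_1 \<Rightarrow> 'b::comm_ring_1"
  assumes map_add: "h (x + y) = h x + h y"
    and map_mult: "h (x * y) = h x * h y"
    and map_1: "h 1 = 1"
begin

lemma map_0: "h 0 = 0"
  using map_add[of 0 0] by simp

lemma map_diff: "h (x - y) = h x - h y"
  using map_add[of "x - y" y] by simp

lemma map_minus: "h (- y) = - h y"
  using map_diff[of 0 y] by (simp add: map_0)

lemma map_of_nat: "h (of_nat n) = of_nat n"
  by (induction n) (simp_all add: map_0 map_1 map_add)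

lemma map_of_int: "h (of_int n) = of_int n"
  by (cases n rule: int_cases2) (simp_all add: map_of_nat map_minus)

lemma map_power: "h (x ^ n) = h x ^ n"
  by (induction n) (simp_all add: map_1 map_mult)

lemma map_sum: "h (\<Sum>x\<in>A. f x) = (\<Sum>x\<in>A. h (f x))"
  by (induction A rule: infinite_finite_induct) (simp_all add: map_0 map_add)

lemma map_prod: "h (\<Prod>x\<in>A. f x) = (\<Prod>x\<in>A. h (f x))"
  by (induction A rule: infinite_finite_induct) (simp_all add: map_1 map_mult)

lemma map_poly_eval: "h (poly_eval a P) = poly_eval (h \<circ> a) P"
  by (simp add: poly_eval_def mono_eval_def map_sum map_prod map_mult map_of_int map_power)

lemma map_ghost: "h (ghost p n x) = ghost p n (h \<circ> x)"
  by (simp add: ghost_def map_sum map_mult map_power map_of_nat)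

end

lemma comm_ring_map_poly_eval: "comm_ring_map (poly_eval a)"
  by standard (simp_all add: poly_eval_add poly_eval_mult)

lemma lookup_of_nat_mult:
  "Poly_Mapping.lookup (of_nat c * f) k = int c * Poly_Mapping.lookup (f :: 'v zmpoly) k"
  by (induction c) (simp_all add: lookup_add algebra_simps)

text \<open>Torsion freeness of integer polynomials: the reason why ghost components determine a
  sequence over this ring, which fails in characteristic p.\<close>

lemma zmpoly_mult_of_nat_cancel:
  fixes f g :: "'v zmpoly"
  assumes "c > 0" "of_nat c * f = of_nat c * g"
  shows "f = g"
proof (rule poly_mapping_eqI)
  fix k
  have "int c * Poly_Mapping.lookup f k = int c * Poly_Mapping.lookup g k"
    using assms(2) by (metis lookup_of_nat_mult)
  then show "Poly_Mapping.lookup f k = Poly_Mapping.lookup g k"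
    using assms(1) by simp
qed

section \<open>Congruences modulo powers of a prime\<close>

lemma prime_dvd_freshman:
  fixes x y :: "'a::comm_ring_1"
  assumes "Factorial_Ring.prime (p::nat)"
  shows "of_nat p dvd (x + y) ^ p - (x ^ p + y ^ p)"
proof -
  have p: "p > 0" using assms prime_gt_0_nat by blast
  have "(x + y) ^ p = (\<Sum>k\<le>p. of_nat (p choose k) * x ^ k * y ^ (p - k))"
    by (rule binomial_ring)
  also have "\<dots> = (\<Sum>k\<in>{0,p}. of_nat (p choose k) * x ^ k * y ^ (p - k))
      + (\<Sum>k\<in>{..p} - {0,p}. of_nat (p choose k) * x ^ k * y ^ (p - k))"
    by (subst add.commute, rule sum.subset_diff) auto
  also have "(\<Sum>k\<in>{0,p}. of_nat (p choose k) * x ^ k * y ^ (p - k)) = x ^ p + y ^ p"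
    using p by (simp add: add_ac)
  finally have *: "(x + y) ^ p - (x ^ p + y ^ p)
      = (\<Sum>k\<in>{..p} - {0,p}. of_nat (p choose k) * x ^ k * y ^ (p - k))"
    by simp
  have "of_nat p dvd (of_nat (p choose k) :: 'a)" if "k \<in> {..p} - {0,p}" for k
  proof -
    have "p dvd (p choose k)"
      by (rule dvd_choose_prime) (use that assms in auto)
    then show ?thesis by (auto elim!: dvdE)
  qed
  then show ?thesis
    unfolding * by (intro dvd_sum) (simp add: dvd_mult2)
qed

text \<open>The cofactor of x - y in x^p - y^p is a sum of p terms, each congruent to y^(p-1) modulo
  p because p already divides x - y; it supplies one more factor p.\<close>

lemma power_prime_dvd_diff:
  fixes x y :: "'a::comm_ring_1"
  assumes "of_nat p ^ j dvd x - y" "j \<ge> 1"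
  shows "of_nat p ^ Suc j dvd x ^ p - y ^ p"
proof -
  have d: "of_nat p dvd x - y"
    using assms by (metis dvd_trans dvd_power less_le_trans less_numeral_extra(1))
  have "(\<Sum>i<p. y ^ (p - Suc i) * x ^ i) - of_nat p * y ^ (p - 1)
      = (\<Sum>i<p. y ^ (p - Suc i) * x ^ i - y ^ (p - 1))"
    by (simp add: sum_subtractf)
  also have "\<dots> = (\<Sum>i<p. y ^ (p - Suc i) * (x ^ i - y ^ i))"
    by (intro sum.cong refl) (simp add: algebra_simps flip: power_add)
  also have "of_nat p dvd \<dots>"
    by (intro dvd_sum dvd_mult dvd_trans[OF d]) (simp add: power_diff_sumr2)
  finally have "of_nat p dvd (\<Sum>i<p. y ^ (p - Suc i) * x ^ i)"
    by (metis dvd_add_right_iff dvd_triv_left diff_add_cancel add.commute)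
  then have "of_nat p ^ j * of_nat p dvd (x - y) * (\<Sum>i<p. y ^ (p - Suc i) * x ^ i)"
    using assms(1) by (intro mult_dvd_mono)
  then show ?thesis
    by (simp add: power_diff_sumr2 mult.commute)
qed

lemma power_prime_power_dvd_diff:
  fixes x y :: "'a::comm_ring_1"
  assumes "of_nat p dvd x - y"
  shows "of_nat p ^ Suc k dvd x ^ (p ^ k) - y ^ (p ^ k)"
proof (induction k)
  case (Suc k)
  from power_prime_dvd_diff[OF this] show ?case
    by (simp add: power_mult power_Suc2 del: power_Suc)
qed (use assms in simp)

section \<open>Dwork's lemma\<close>

text \<open>The standard Frobenius lift of a polynomial ring over the integers, the datum on which
  Dwork's criterion rests.\<close>

definition frob_lift :: "nat \<Rightarrow> 'v zmpoly \<Rightarrow> 'v zmpoly" where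
  "frob_lift p = poly_eval (\<lambda>v. poly_var v ^ p)"

lemma comm_ring_map_frob_lift: "comm_ring_map (frob_lift p)"
  unfolding frob_lift_def by (rule comm_ring_map_poly_eval)

lemma poly_var_power: "poly_var v ^ n = Poly_Mapping.single (Poly_Mapping.single v n) 1"
  by (induction n) (simp_all add: poly_var_def mult_single flip: single_add)

lemma mono_eval_var: "mono_eval poly_var m = Poly_Mapping.single m 1"
proof -
  have "(\<Prod>v\<in>A. Poly_Mapping.single (f v) (1::int)) = Poly_Mapping.single (\<Sum>v\<in>A. f v) 1"
    for A and f :: "'a \<Rightarrow> ('a \<Rightarrow>\<^sub>0 nat)"
    by (induction A rule: infinite_finite_induct) (simp_all add: mult_single)
  then show ?thesis
    using poly_mapping_sum_single[of m] by (simp add: mono_eval_def poly_var_power)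
qed

lemma mono_eval_power: "mono_eval (\<lambda>v. a v ^ p) m = mono_eval a m ^ p"
  by (simp add: mono_eval_def prod_power_distrib mult.commute flip: power_mult)

text \<open>Both sides are additive modulo p and agree on monomials with coefficient 1, which
  generate the ring additively.\<close>

lemma frob_lift_cong:
  assumes p: "Factorial_Ring.prime p"
  shows "of_nat p dvd frob_lift p P - P ^ p"
proof -
  interpret comm_ring_map "frob_lift p" by (rule comm_ring_map_frob_lift)
  define R :: "'a zmpoly \<Rightarrow> bool" where "R P \<longleftrightarrow> of_nat p dvd frob_lift p P - P ^ p" for P
  have p0: "p > 0" using p prime_gt_0_nat by blast
  have R_add: "R (P + Q)" if "R P" "R Q" for P Q
  proof -
    have "frob_lift p (P + Q) - (P + Q) ^ p
        = (frob_lift p P - P ^ p) + (frob_lift p Q - Q ^ p) - ((P + Q) ^ p - (P ^ p + Q ^ p))"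
      by (simp add: map_add)
    also have "of_nat p dvd \<dots>"
      by (intro dvd_diff dvd_add prime_dvd_freshman[OF p] that[unfolded R_def])
    finally show ?thesis by (simp add: R_def)
  qed
  have R_minus: "R (- P)" if "R P" for P
  proof -
    \<comment> \<open>Applying the congruence for p-th powers of sums to P + (- P) avoids a
      distinction between p = 2 and odd p.\<close>
    have "frob_lift p (- P) - (- P) ^ p
        = - (frob_lift p P - P ^ p) + ((P + - P) ^ p - (P ^ p + (- P) ^ p))"
      using p0 by (simp add: map_minus power_0_left)
    also have "of_nat p dvd \<dots>"
      by (intro dvd_add prime_dvd_freshman[OF p] iffD2[OF dvd_minus_iff] that[unfolded R_def])
    finally show ?thesis by (simp add: R_def)
  qed
  have R_0: "R 0" using p0 by (simp add: R_def map_0 power_0_left)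
  have R_mono: "R (Poly_Mapping.single m 1)" for m
    by (simp add: R_def frob_lift_def poly_eval_single mono_eval_power mono_eval_var)
  have R_nat: "R (Poly_Mapping.single m (int c))" for m c
    by (induction c) (simp_all add: R_0 R_add R_mono single_add)
  have "R P"
  proof (induction P rule: poly_mapping_single_add_induct)
    case (single m c)
    show ?case
      by (cases c rule: int_cases2)
        (use R_nat R_minus in \<open>auto simp: single_uminus simp del: single_of_nat\<close>)
  qed (rule R_add)
  then show ?thesis by (simp add: R_def)
qed

lemma ghost_Suc: "ghost p (Suc n) x = ghost p n (\<lambda>i. x i ^ p) + of_nat (p ^ Suc n) * x (Suc n)"
  by (simp add: ghost_def Suc_diff_le flip: power_mult)

lemma ghost_0 [simp]: "ghost p 0 x = x 0"
  by (simp add: ghost_def)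

lemma ghost_split: "ghost p n x = (\<Sum>i<n. of_nat (p ^ i) * x i ^ (p ^ (n - i))) + of_nat (p ^ n) * x n"
  by (simp add: ghost_def lessThan_Suc_atMost[symmetric])

text \<open>Dwork's congruences. Ghost sequences satisfy them and, conversely, they suffice for
  being one; since they are stable under sums, products and negation, the Witt operations
  exist.\<close>

definition dwork_seq :: "nat \<Rightarrow> (nat \<Rightarrow> 'v zmpoly) \<Rightarrow> bool" where
  "dwork_seq p g \<longleftrightarrow> (\<forall>n. of_nat (p ^ Suc n) dvd g (Suc n) - frob_lift p (g n))"

text \<open>Term i is p^i times a difference of p^(n-i)-th powers of elements congruent modulo p,
  hence divisible by p^i p^(n-i+1).\<close>

lemma ghost_cong_frob:
  assumes "Factorial_Ring.prime p"
  shows "of_nat (p ^ Suc n) dvd ghost p n (\<lambda>i. x i ^ p) - frob_lift p (ghost p n x)"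
proof -
  interpret comm_ring_map "frob_lift p" by (rule comm_ring_map_frob_lift)
  have "ghost p n (\<lambda>i. x i ^ p) - frob_lift p (ghost p n x)
      = (\<Sum>i\<le>n. of_nat (p ^ i) * ((x i ^ p) ^ (p ^ (n - i)) - frob_lift p (x i) ^ (p ^ (n - i))))"
    by (simp add: map_ghost) (simp add: ghost_def sum_subtractf right_diff_distrib)
  also have "of_nat (p ^ Suc n) dvd \<dots>"
  proof (rule dvd_sum)
    fix i assume "i \<in> {..n}"
    then have "(of_nat (p ^ Suc n) :: 'a zmpoly) = of_nat (p ^ i) * of_nat p ^ Suc (n - i)"
      by (simp flip: power_Suc power_add of_nat_power of_nat_mult)
    also have "\<dots> dvd of_nat (p ^ i) * ((x i ^ p) ^ (p ^ (n - i)) - frob_lift p (x i) ^ (p ^ (n - i)))"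
      by (intro mult_dvd_mono dvd_refl power_prime_power_dvd_diff)
        (use frob_lift_cong[OF assms] in \<open>metis dvd_minus_iff minus_diff_eq\<close>)
    finally show "of_nat (p ^ Suc n) dvd of_nat (p ^ i) * ((x i ^ p) ^ (p ^ (n - i)) - frob_lift p (x i) ^ (p ^ (n - i)))" .
  qed
  finally show ?thesis .
qed

lemma dwork_seq_ghost:
  assumes "Factorial_Ring.prime p"
  shows "dwork_seq p (\<lambda>n. ghost p n x)"
  unfolding dwork_seq_def
proof
  fix n
  have "ghost p (Suc n) x - frob_lift p (ghost p n x)
      = (ghost p n (\<lambda>i. x i ^ p) - frob_lift p (ghost p n x)) + of_nat (p ^ Suc n) * x (Suc n)"
    by (simp add: ghost_Suc)
  then show "of_nat (p ^ Suc n) dvd ghost p (Suc n) x - frob_lift p (ghost p n x)"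
    using ghost_cong_frob[OF assms, of n x] by (simp only: dvd_add dvd_triv_left)
qed

lemma dwork_seq_add:
  assumes "dwork_seq p g" "dwork_seq p h"
  shows "dwork_seq p (\<lambda>n. g n + h n)"
proof -
  interpret comm_ring_map "frob_lift p" by (rule comm_ring_map_frob_lift)
  show ?thesis
    using assms unfolding dwork_seq_def map_add by (simp add: add_diff_add dvd_add del: of_nat_power)
qed

lemma dwork_seq_mult:
  assumes "dwork_seq p g" "dwork_seq p h"
  shows "dwork_seq p (\<lambda>n. g n * h n)"
proof -
  interpret comm_ring_map "frob_lift p" by (rule comm_ring_map_frob_lift)
  have "x * y - u * v = (x - u) * y + u * (y - v)" for x y u v :: "'a zmpoly"
    by (simp add: algebra_simps)
  then show ?thesis
    using assms unfolding dwork_seq_def map_mult by (metis dvd_add dvd_mult dvd_mult2)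
qed

lemma dwork_seq_uminus:
  assumes "dwork_seq p g"
  shows "dwork_seq p (\<lambda>n. - g n)"
proof -
  interpret comm_ring_map "frob_lift p" by (rule comm_ring_map_frob_lift)
  show ?thesis
    using assms unfolding dwork_seq_def map_minus minus_diff_minus dvd_minus_iff .
qed

text \<open>Components are found one after another: the congruences make g n minus the contribution
  of the earlier components divisible by p^n, and the quotient is component n.\<close>

lemma dwork:
  fixes g :: "nat \<Rightarrow> 'a zmpoly"
  assumes p: "Factorial_Ring.prime p" and g: "dwork_seq p g"
  shows "\<exists>x. \<forall>n. ghost p n x = g n"
proof -
  interpret comm_ring_map "frob_lift p" by (rule comm_ring_map_frob_lift)
  \<comment> \<open>\<open>R x n r\<close> expresses that r is a correct component n when the
    earlier ones are those of x. It depends on x only below n, as the recursive choice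
    requires.\<close>
  define R :: "(nat \<Rightarrow> 'a zmpoly) \<Rightarrow> nat \<Rightarrow> 'a zmpoly \<Rightarrow> bool"
    where "R x n r \<longleftrightarrow> (\<Sum>i<n. of_nat (p ^ i) * x i ^ (p ^ (n - i))) + of_nat (p ^ n) * r = g n"
    for x n r
  have "\<exists>x. \<forall>n. R x n (x n)"
  proof (rule dependent_wellorder_choice)
    fix r and x y :: "nat \<Rightarrow> 'a zmpoly" and n :: nat
    assume "\<And>i. i < n \<Longrightarrow> x i = y i"
    then show "R x n r = R y n r" by (simp add: R_def)
  next
    fix n :: nat and x :: "nat \<Rightarrow> 'a zmpoly"
    assume IH: "\<And>i. i < n \<Longrightarrow> R x i (x i)"
    have gh: "ghost p i x = g i" if "i < n" for i
      using IH[OF that] unfolding R_def ghost_split .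
    show "\<exists>r. R x n r"
    proof (cases n)
      case 0
      then show ?thesis by (simp add: R_def)
    next
      case (Suc k)
      \<comment> \<open>Both terms are congruent modulo p^n to the Frobenius lift of g k.\<close>
      have "of_nat (p ^ n) dvd g n - ghost p k (\<lambda>i. x i ^ p)"
      proof -
        have "g n - ghost p k (\<lambda>i. x i ^ p)
            = (g (Suc k) - frob_lift p (g k)) - (ghost p k (\<lambda>i. x i ^ p) - frob_lift p (ghost p k x))"
          using Suc gh[of k] by simp
        also have "of_nat (p ^ n) dvd \<dots>"
          unfolding Suc by (rule dvd_diff[OF g[unfolded dwork_seq_def, rule_format] ghost_cong_frob[OF p]])
        finally show ?thesis .
      qed
      then obtain r where "g n - ghost p k (\<lambda>i. x i ^ p) = of_nat (p ^ n) * r"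
        by (elim dvdE)
      moreover have "ghost p k (\<lambda>i. x i ^ p) = (\<Sum>i<n. of_nat (p ^ i) * x i ^ (p ^ (n - i)))"
        unfolding Suc ghost_def lessThan_Suc_atMost
        by (intro sum.cong refl) (simp add: Suc_diff_le flip: power_mult)
      ultimately have "R x n r"
        by (simp only: R_def diff_eq_eq add.commute)
      then show ?thesis ..
    qed
  qed
  then show ?thesis by (simp only: R_def ghost_split)
qed

text \<open>The ghost map is triangular: component n enters ghost component n only through p^n x n,
  and p^n can be cancelled.\<close>

lemma ghost_determines:
  fixes x y :: "nat \<Rightarrow> 'v zmpoly"
  assumes "p > 0" "\<And>k. k \<le> n \<Longrightarrow> ghost p k x = ghost p k y"
  shows "x n = y n"
  using assms(2)
proof (induction n rule: less_induct)
  case (less n)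
  have "x k = y k" if "k < n" for k
    using that less by auto
  then have "(\<Sum>i<n. of_nat (p ^ i) * x i ^ (p ^ (n - i))) = (\<Sum>i<n. of_nat (p ^ i) * y i ^ (p ^ (n - i)))"
    by (intro sum.cong) auto
  with less.prems[of n] have "of_nat (p ^ n) * x n = of_nat (p ^ n) * y n"
    by (simp add: ghost_split del: of_nat_power)
  then show ?case
    by (rule zmpoly_mult_of_nat_cancel[rotated]) (simp add: assms(1))
qed

text \<open>Once the lower components agree modulo p, their contributions agree modulo p^(n+1), so
  p^(n+1) divides p^n (x n - y n). In characteristic p it is therefore enough to know ghost
  components approximately.\<close>

lemma ghost_cong_determines:
  fixes x y :: "nat \<Rightarrow> 'v zmpoly"
  assumes p: "Factorial_Ring.prime p" and "\<And>k. of_nat (p ^ Suc k) dvd ghost p k x - ghost p k y"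
  shows "of_nat p dvd x n - y n"
proof (induction n rule: less_induct)
  case (less n)
  have "of_nat (p ^ Suc n) dvd (\<Sum>i<n. of_nat (p ^ i) * (x i ^ (p ^ (n - i)) - y i ^ (p ^ (n - i))))"
  proof (rule dvd_sum)
    fix i assume i: "i \<in> {..<n}"
    then have "(of_nat (p ^ Suc n) :: 'v zmpoly) = of_nat (p ^ i) * of_nat p ^ Suc (n - i)"
      by (simp flip: power_Suc power_add of_nat_power of_nat_mult)
    also have "\<dots> dvd of_nat (p ^ i) * (x i ^ (p ^ (n - i)) - y i ^ (p ^ (n - i)))"
      by (intro mult_dvd_mono dvd_refl power_prime_power_dvd_diff) (use i less in auto)
    finally show "of_nat (p ^ Suc n) dvd of_nat (p ^ i) * (x i ^ (p ^ (n - i)) - y i ^ (p ^ (n - i)))" .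
  qed
  moreover have "ghost p n x - ghost p n y
      = (\<Sum>i<n. of_nat (p ^ i) * (x i ^ (p ^ (n - i)) - y i ^ (p ^ (n - i)))) + of_nat (p ^ n) * (x n - y n)"
    by (simp add: ghost_split sum_subtractf right_diff_distrib del: of_nat_power)
  ultimately have "of_nat (p ^ Suc n) dvd of_nat (p ^ n) * (x n - y n)"
    using assms(2)[of n] by (simp only: dvd_add_right_iff)
  then obtain z where "of_nat (p ^ n) * (x n - y n) = of_nat (p ^ Suc n) * z"
    by (elim dvdE)
  then have "of_nat (p ^ n) * (x n - y n) = of_nat (p ^ n) * (of_nat p * z)"
    by (simp add: mult_ac)
  then have "x n - y n = of_nat p * z"
    by (rule zmpoly_mult_of_nat_cancel[rotated]) (simp add: prime_gt_0_nat[OF p])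
  then show ?case by simp
qed

text \<open>Existence is Dwork's criterion and uniqueness is triangularity; together they give a
  meaning to the definite descriptions \<open>witt_sum_poly\<close> and
  \<open>witt_prod_poly\<close>.\<close>

lemma witt_poly_ex1:
  fixes g :: "nat \<Rightarrow> 'v zmpoly"
  assumes p: "Factorial_Ring.prime p" and "dwork_seq p g"
  shows "\<exists>!x. \<forall>n. ghost p n x = g n"
proof -
  obtain x where x: "\<forall>n. ghost p n x = g n" using dwork[OF assms] by blast
  show ?thesis
  proof (rule ex1I[of _ x], rule x)
    fix y :: "nat \<Rightarrow> 'v zmpoly" assume y: "\<forall>n. ghost p n y = g n"
    show "y = x"
      by (rule ext, rule ghost_determines[of p]) (use x y prime_gt_0_nat[OF p] in simp_all)
  qed
qed

lemma ghost_witt_sum_poly: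
  assumes "Factorial_Ring.prime p"
  shows "ghost p n (witt_sum_poly p)
    = ghost p n (\<lambda>i. zvar (Inl i)) + ghost p n (\<lambda>i. zvar (Inr i))"
proof -
  let ?g = "\<lambda>n. ghost p n (\<lambda>i. zvar (Inl i)) + ghost p n (\<lambda>i. zvar (Inr i))"
  have "\<exists>!x. \<forall>n. ghost p n x = ?g n"
    by (rule witt_poly_ex1[OF assms], rule dwork_seq_add; rule dwork_seq_ghost[OF assms])
  from theI'[OF this] show ?thesis
    unfolding witt_sum_poly_def by (rule spec)
qed

lemma ghost_witt_prod_poly:
  assumes "Factorial_Ring.prime p"
  shows "ghost p n (witt_prod_poly p)
    = ghost p n (\<lambda>i. zvar (Inl i)) * ghost p n (\<lambda>i. zvar (Inr i))"
proof -
  let ?g = "\<lambda>n. ghost p n (\<lambda>i. zvar (Inl i)) * ghost p n (\<lambda>i. zvar (Inr i))"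
  have "\<exists>!x. \<forall>n. ghost p n x = ?g n"
    by (rule witt_poly_ex1[OF assms], rule dwork_seq_mult; rule dwork_seq_ghost[OF assms])
  from theI'[OF this] show ?thesis
    unfolding witt_prod_poly_def by (rule spec)
qed

section \<open>The ring of Witt vectors as a type\<close>

text \<open>
  Witt vectors form a ring for every prime. Taking the characteristic whenever it is prime, and
  the junk value 2 otherwise, makes them an instance of the class of commutative rings.
\<close>

definition witt_prime :: "'k::comm_ring_1 itself \<Rightarrow> nat" where
  "witt_prime _ = (if Factorial_Ring.prime CHAR('k) then CHAR('k) else 2)"

lemma prime_witt_prime: "Factorial_Ring.prime (witt_prime TYPE('k::comm_ring_1))"
  by (simp add: witt_prime_def)

lemma witt_prime_neq_0 [simp]: "witt_prime TYPE('k::comm_ring_1) \<noteq> 0"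
  using prime_gt_0_nat[OF prime_witt_prime[where ?'k='k]] by simp

typedef 'k witt = "UNIV :: (nat \<Rightarrow> 'k) set" morphisms wcomp Witt ..

lemma wcomp_Witt [simp]: "wcomp (Witt f) = f"
  by (simp add: Witt_inverse)

lemma witt_eqI: "(\<And>n. wcomp x n = wcomp y n) \<Longrightarrow> x = y"
  by (metis ext wcomp_inverse)

instantiation witt :: (comm_ring_1) "{zero, one, plus, times, uminus, minus}"
begin

definition "0 = Witt (\<lambda>_. 0)"
definition "1 = Witt (\<lambda>n. if n = 0 then 1 else 0)"
definition "x + y = Witt (\<lambda>n. zeval (case_sum (wcomp x) (wcomp y)) (witt_sum_poly (witt_prime TYPE('a)) n))"
definition "x * y = Witt (\<lambda>n. zeval (case_sum (wcomp x) (wcomp y)) (witt_prod_poly (witt_prime TYPE('a)) n))"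
text \<open>Negation is chosen instead of computed; that an additive inverse exists follows below
  from Dwork's criterion for the negated ghost sequence.\<close>

definition "- x = (SOME y::'a witt. x + y = 0)"
definition "x - y = x + - (y::'a witt)"

instance ..

end

lemma wcomp_0 [simp]: "wcomp 0 n = 0"
  by (simp add: zero_witt_def)

lemma wcomp_1: "wcomp 1 n = (if n = 0 then 1 else 0)"
  by (simp add: one_witt_def)

text \<open>
  \<open>ghost_rep g x\<close>: the Witt vector \<open>x\<close> is the image of a sequence over \<open>\<int>[U\<^sub>z | z \<in> 'k]\<close> with ghost
  components \<open>g\<close>. As this ring is torsion free, identities between Witt vectors reduce to
  identities between ghost components.
\<close>

definition ghost_rep :: "(nat \<Rightarrow> 'k zmpoly) \<Rightarrow> 'k::comm_ring_1 witt \<Rightarrow> bool" where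
  "ghost_rep g x \<longleftrightarrow> (\<exists>U. (\<forall>n. ghost (witt_prime TYPE('k)) n U = g n) \<and> (\<forall>n. wcomp x n = poly_eval id (U n)))"

lemma ghost_repI:
  fixes x :: "'k::comm_ring_1 witt"
  assumes "\<And>n. ghost (witt_prime TYPE('k)) n U = g n" "\<And>n. wcomp x n = poly_eval id (U n)"
  shows "ghost_rep g x"
  using assms by (auto simp: ghost_rep_def)

text \<open>Kept local in n on purpose: component n depends only on the ghost components up to n,
  which is what compatibility with truncation needs.\<close>

lemma ghost_rep_agree:
  fixes x y :: "'k::comm_ring_1 witt"
  assumes "ghost_rep g x" "ghost_rep h y" "\<And>k. k \<le> n \<Longrightarrow> g k = h k"
  shows "wcomp x n = wcomp y n"
proof -
  let ?p = "witt_prime TYPE('k)"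
  obtain U V where U: "\<And>n. ghost ?p n U = g n" "\<And>n. wcomp x n = poly_eval id (U n)"
    and V: "\<And>n. ghost ?p n V = h n" "\<And>n. wcomp y n = poly_eval id (V n)"
    using assms(1,2) unfolding ghost_rep_def by metis
  have "U n = V n"
    by (rule ghost_determines[of ?p])
      (use assms(3) U(1) V(1) prime_gt_0_nat[OF prime_witt_prime[where ?'k='k]] in simp_all)
  then show ?thesis by (simp add: U V)
qed

lemma ghost_rep_inj: "ghost_rep g x \<Longrightarrow> ghost_rep g y \<Longrightarrow> x = y"
  by (rule witt_eqI) (erule (1) ghost_rep_agree, rule refl)

text \<open>The tautological lift: a component z is lifted to the variable indexed by z, and
  evaluation at the identity returns z.\<close>

lemma ghost_rep_ghost:
  fixes x :: "'k::comm_ring_1 witt"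
  shows "ghost_rep (\<lambda>n. ghost (witt_prime TYPE('k)) n (\<lambda>i. poly_var (wcomp x i))) x"
  by (rule ghost_repI[of "\<lambda>i. poly_var (wcomp x i)"]) simp_all

lemma ghost_rep_dwork_seq:
  fixes x :: "'k::comm_ring_1 witt"
  assumes "ghost_rep g x"
  shows "dwork_seq (witt_prime TYPE('k)) g"
proof -
  obtain U where U: "\<And>n. ghost (witt_prime TYPE('k)) n U = g n"
    using assms unfolding ghost_rep_def by metis
  show ?thesis using dwork_seq_ghost[OF prime_witt_prime[where ?'k='k], of U] by (simp add: U)
qed

lemma dwork_seq_ghost_rep:
  assumes "dwork_seq (witt_prime TYPE('k)) g"
  shows "\<exists>x::'k::comm_ring_1 witt. ghost_rep g x"
proof -
  obtain U where "\<forall>n. ghost (witt_prime TYPE('k)) n U = g n"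
    using dwork[OF prime_witt_prime assms] by blast
  then have "ghost_rep g (Witt (\<lambda>n. poly_eval id (U n)))"
    by (intro ghost_repI) simp_all
  then show ?thesis ..
qed

lemma ghost_rep_0: "ghost_rep (\<lambda>_. 0) 0"
  by (rule ghost_repI[of "\<lambda>_. 0"])
    (simp_all add: ghost_def power_0_left)

lemma ghost_rep_1: "ghost_rep (\<lambda>_. 1) 1"
proof (rule ghost_repI)
  fix n
  show "ghost (witt_prime TYPE('a)) n (\<lambda>n. if n = 0 then 1 else 0) = (1 :: 'a zmpoly)"
  proof -
    have "ghost (witt_prime TYPE('a)) n (\<lambda>n. if n = 0 then 1 else 0)
        = (\<Sum>i\<le>n. if i = 0 then 1 else (0 :: 'a zmpoly))"
      unfolding ghost_def by (intro sum.cong refl) (simp add: power_0_left)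
    then show ?thesis by simp
  qed
qed (simp add: wcomp_1)

lemma poly_eval_comp:
  assumes "comm_ring_map h"
  shows "h (poly_eval a P) = poly_eval (\<lambda>v. h (a v)) P"
  using comm_ring_map.map_poly_eval[OF assms, of a P] by (simp add: comp_def)

text \<open>The addition polynomials are applied before evaluation, over the polynomial ring, where
  their ghost components are known; evaluation commutes with them.\<close>

lemma ghost_rep_plus:
  fixes x y :: "'k::comm_ring_1 witt"
  assumes "ghost_rep g x" "ghost_rep h y"
  shows "ghost_rep (\<lambda>n. g n + h n) (x + y)"
proof -
  let ?p = "witt_prime TYPE('k)"
  obtain U V where U: "\<And>n. ghost ?p n U = g n" "\<And>n. wcomp x n = poly_eval id (U n)"
    and V: "\<And>n. ghost ?p n V = h n" "\<And>n. wcomp y n = poly_eval id (V n)"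
    using assms(1,2) unfolding ghost_rep_def by metis
  let ?Z = "\<lambda>n. poly_eval (case_sum U V) (witt_sum_poly ?p n)"
  show ?thesis
  proof (rule ghost_repI)
    fix n
    interpret E: comm_ring_map "poly_eval (case_sum U V)" by (rule comm_ring_map_poly_eval)
    have "ghost ?p n ?Z = poly_eval (case_sum U V) (ghost ?p n (witt_sum_poly ?p))"
      by (simp add: E.map_ghost comp_def)
    also have "\<dots> = ghost ?p n U + ghost ?p n V"
      by (simp add: ghost_witt_sum_poly prime_witt_prime E.map_add E.map_ghost comp_def zvar_eq_poly_var)
    finally show "ghost ?p n ?Z = g n + h n" by (simp add: U V)
    have *: "case_sum (wcomp x) (wcomp y) = (\<lambda>v. poly_eval id (case_sum U V v))"
      by (auto simp: fun_eq_iff U V split: sum.split)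
    show "wcomp (x + y) n = poly_eval id (?Z n)"
      by (simp add: plus_witt_def zeval_eq_poly_eval * poly_eval_comp[OF comm_ring_map_poly_eval])
  qed
qed

lemma ghost_rep_times:
  fixes x y :: "'k::comm_ring_1 witt"
  assumes "ghost_rep g x" "ghost_rep h y"
  shows "ghost_rep (\<lambda>n. g n * h n) (x * y)"
proof -
  let ?p = "witt_prime TYPE('k)"
  obtain U V where U: "\<And>n. ghost ?p n U = g n" "\<And>n. wcomp x n = poly_eval id (U n)"
    and V: "\<And>n. ghost ?p n V = h n" "\<And>n. wcomp y n = poly_eval id (V n)"
    using assms(1,2) unfolding ghost_rep_def by metis
  let ?Z = "\<lambda>n. poly_eval (case_sum U V) (witt_prod_poly ?p n)"
  show ?thesis
  proof (rule ghost_repI)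
    fix n
    interpret E: comm_ring_map "poly_eval (case_sum U V)" by (rule comm_ring_map_poly_eval)
    have "ghost ?p n ?Z = poly_eval (case_sum U V) (ghost ?p n (witt_prod_poly ?p))"
      by (simp add: E.map_ghost comp_def)
    also have "\<dots> = ghost ?p n U * ghost ?p n V"
      by (simp add: ghost_witt_prod_poly prime_witt_prime E.map_mult E.map_ghost comp_def zvar_eq_poly_var)
    finally show "ghost ?p n ?Z = g n * h n" by (simp add: U V)
    have *: "case_sum (wcomp x) (wcomp y) = (\<lambda>v. poly_eval id (case_sum U V v))"
      by (auto simp: fun_eq_iff U V split: sum.split)
    show "wcomp (x * y) n = poly_eval id (?Z n)"
      by (simp add: times_witt_def zeval_eq_poly_eval * poly_eval_comp[OF comm_ring_map_poly_eval])
  qed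
qed

lemma witt_add_inverse_ex: "\<exists>y. x + y = (0 :: 'k::comm_ring_1 witt)"
proof -
  let ?g = "\<lambda>n. ghost (witt_prime TYPE('k)) n (\<lambda>i. poly_var (wcomp x i))"
  obtain y :: "'k witt" where y: "ghost_rep (\<lambda>n. - ?g n) y"
    using dwork_seq_ghost_rep dwork_seq_uminus[OF ghost_rep_dwork_seq[OF ghost_rep_ghost[of x]]] by blast
  have "ghost_rep (\<lambda>n. ?g n + - ?g n) (x + y)"
    by (rule ghost_rep_plus[OF ghost_rep_ghost y])
  then have "x + y = 0"
    by (intro ghost_rep_inj[OF _ ghost_rep_0]) simp
  then show ?thesis ..
qed

instance witt :: (comm_ring_1) comm_ring_1
proof
  fix x y z :: "'a witt"
  obtain f g h where f: "ghost_rep f x" and g: "ghost_rep g y" and h: "ghost_rep h z"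
    using ghost_rep_ghost by meson
  show "x + y + z = x + (y + z)"
    by (rule ghost_rep_inj[OF ghost_rep_plus[OF ghost_rep_plus[OF f g] h]])
      (use ghost_rep_plus[OF f ghost_rep_plus[OF g h]] in \<open>simp add: add.assoc\<close>)
  have comm: "x + y = y + x" if "ghost_rep f x" "ghost_rep g y" for f g and x y :: "'a witt"
    by (rule ghost_rep_inj[OF ghost_rep_plus[OF that]])
      (use ghost_rep_plus[OF that(2,1)] in \<open>simp add: add.commute\<close>)
  show "x + y = y + x"
    by (rule comm[OF f g])
  show "0 + x = x"
    by (rule ghost_rep_inj[OF ghost_rep_plus[OF ghost_rep_0 f]]) (use f in simp)
  show "x * y * z = x * (y * z)"
    by (rule ghost_rep_inj[OF ghost_rep_times[OF ghost_rep_times[OF f g] h]])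
      (use ghost_rep_times[OF f ghost_rep_times[OF g h]] in \<open>simp add: mult.assoc\<close>)
  show "x * y = y * x"
    by (rule ghost_rep_inj[OF ghost_rep_times[OF f g]]) (use ghost_rep_times[OF g f] in \<open>simp add: mult.commute\<close>)
  show "1 * x = x"
    by (rule ghost_rep_inj[OF ghost_rep_times[OF ghost_rep_1 f]]) (use f in simp)
  show "(x + y) * z = x * z + y * z"
    by (rule ghost_rep_inj[OF ghost_rep_times[OF ghost_rep_plus[OF f g] h]])
      (use ghost_rep_plus[OF ghost_rep_times[OF f h] ghost_rep_times[OF g h]] in \<open>simp add: distrib_right\<close>)
  show "- x + x = 0"
    using someI_ex[OF witt_add_inverse_ex[of x]] comm[OF ghost_rep_ghost ghost_rep_ghost]
    by (simp add: uminus_witt_def)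
  show "x - y = x + - y"
    by (simp add: minus_witt_def)
  show "(0 :: 'a witt) \<noteq> 1"
    by (metis wcomp_0 wcomp_1 zero_neq_one)
qed

lemma ghost_rep_of_nat: "ghost_rep (\<lambda>_. of_nat n) (of_nat n)"
  by (induction n) (simp_all add: ghost_rep_0 ghost_rep_plus ghost_rep_1)

lemma ghost_rep_wcomp_0: "ghost_rep g x \<Longrightarrow> wcomp x 0 = poly_eval id (g 0)"
  unfolding ghost_rep_def by (metis ghost_0)

lemma wcomp_add_0: "wcomp (x + y) 0 = wcomp x 0 + wcomp y 0"
  using ghost_rep_wcomp_0[OF ghost_rep_plus[OF ghost_rep_ghost[of x] ghost_rep_ghost[of y]]]
  by (simp add: poly_eval_add)

lemma wcomp_mult_0: "wcomp (x * y) 0 = wcomp x 0 * wcomp y 0"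
  using ghost_rep_wcomp_0[OF ghost_rep_times[OF ghost_rep_ghost[of x] ghost_rep_ghost[of y]]]
  by (simp add: poly_eval_mult)

lemma comm_ring_map_wcomp_0: "comm_ring_map (\<lambda>x. wcomp x 0)"
  by standard (simp_all add: wcomp_add_0 wcomp_mult_0 wcomp_1)

section \<open>Truncation\<close>

text \<open>Agreement of the components below \<open>n\<close>, that is congruence modulo \<open>p\<^sup>n\<close>; equality for \<open>n = \<infinity>\<close>.\<close>

definition weq :: "enat \<Rightarrow> 'k witt \<Rightarrow> 'k witt \<Rightarrow> bool" where
  "weq n x y \<longleftrightarrow> (\<forall>i. enat i < n \<longrightarrow> wcomp x i = wcomp y i)"

lemma weq_refl [simp, intro]: "weq n x x"
  by (simp add: weq_def)

lemma weq_sym: "weq n x y \<Longrightarrow> weq n y x"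
  by (simp add: weq_def)

lemma weq_trans [trans]: "weq n x y \<Longrightarrow> weq n y z \<Longrightarrow> weq n x z"
  by (simp add: weq_def)

lemma weq_infinity [simp]: "weq \<infinity> x y \<longleftrightarrow> x = y"
  by (auto simp: weq_def intro: witt_eqI)

lemma ghost_eq_if_weq:
  fixes x y :: "'k::comm_ring_1 witt"
  assumes "weq n x y" "enat k < n"
  shows "ghost (witt_prime TYPE('k)) k (\<lambda>i. poly_var (wcomp x i))
    = ghost (witt_prime TYPE('k)) k (\<lambda>i. poly_var (wcomp y i))"
proof -
  have "wcomp x i = wcomp y i" if "i \<le> k" for i
  proof -
    have "enat i < n" using that assms(2) by (meson enat_ord_simps(1) order.strict_trans1)
    then show ?thesis using assms(1) by (simp add: weq_def)
  qed
  then show ?thesis by (simp add: ghost_def)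
qed

text \<open>The components of the summands up to i determine the ghost components of the sum up to
  i, and these determine its component i.\<close>

lemma weq_add:
  fixes x y :: "'k::comm_ring_1 witt"
  assumes "weq n x x'" "weq n y y'"
  shows "weq n (x + y) (x' + y')"
  unfolding weq_def
proof (intro allI impI)
  fix i assume i: "enat i < n"
  have "enat k < n" if "k \<le> i" for k
    using that i by (meson enat_ord_simps(1) order.strict_trans1)
  then show "wcomp (x + y) i = wcomp (x' + y') i"
    by (intro ghost_rep_agree[OF ghost_rep_plus[OF ghost_rep_ghost ghost_rep_ghost] ghost_rep_plus[OF ghost_rep_ghost ghost_rep_ghost]])
      (simp add: ghost_eq_if_weq[OF assms(1)] ghost_eq_if_weq[OF assms(2)])
qed

lemma weq_mult:
  fixes x y :: "'k::comm_ring_1 witt"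
  assumes "weq n x x'" "weq n y y'"
  shows "weq n (x * y) (x' * y')"
  unfolding weq_def
proof (intro allI impI)
  fix i assume i: "enat i < n"
  have "enat k < n" if "k \<le> i" for k
    using that i by (meson enat_ord_simps(1) order.strict_trans1)
  then show "wcomp (x * y) i = wcomp (x' * y') i"
    by (intro ghost_rep_agree[OF ghost_rep_times[OF ghost_rep_ghost ghost_rep_ghost] ghost_rep_times[OF ghost_rep_ghost ghost_rep_ghost]])
      (simp add: ghost_eq_if_weq[OF assms(1)] ghost_eq_if_weq[OF assms(2)])
qed

lemma weq_diff_iff: 
  fixes x y :: "'k::comm_ring_1 witt"
  shows "weq n x y \<longleftrightarrow> weq n (x - y) 0"
  using weq_add[of n x y "- y" "- y"] weq_add[of n "x - y" 0 y y] by auto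

lemma weq_minus:
  fixes x y :: "'k::comm_ring_1 witt"
  assumes "weq n x y"
  shows "weq n (- x) (- y)"
  using weq_add[OF weq_sym[OF assms] weq_refl[of n "- x - y"]] by (simp add: algebra_simps)

lemma weq_diff:
  fixes x y :: "'k::comm_ring_1 witt"
  assumes "weq n x x'" "weq n y y'"
  shows "weq n (x - y) (x' - y')"
  using weq_add[OF assms(1) weq_minus[OF assms(2)]] by simp

lemma weq_sum:
  fixes f :: "'b \<Rightarrow> 'k::comm_ring_1 witt"
  assumes "\<And>x. x \<in> A \<Longrightarrow> weq n (f x) (g x)"
  shows "weq n (\<Sum>x\<in>A. f x) (\<Sum>x\<in>A. g x)"
  using assms by (induction A rule: infinite_finite_induct) (simp_all add: weq_add)

text \<open>A normal form for classes modulo p^n, by which solutions modulo p^n can be counted as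
  functions.\<close>

definition wtrunc :: "enat \<Rightarrow> 'k::comm_ring_1 witt \<Rightarrow> 'k witt" where
  "wtrunc n x = Witt (\<lambda>i. if enat i < n then wcomp x i else 0)"

lemma weq_wtrunc [simp]: "weq n (wtrunc n x) x"
  by (simp add: weq_def wtrunc_def)

lemma wtrunc_eq_iff: "wtrunc n x = wtrunc n y \<longleftrightarrow> weq n x y"
proof
  assume "wtrunc n x = wtrunc n y"
  then have "weq n x (wtrunc n y)" by (metis weq_sym weq_wtrunc)
  then show "weq n x y" using weq_trans weq_wtrunc by blast
qed (auto simp: weq_def wtrunc_def intro!: witt_eqI)

section \<open>Witt vectors over an algebraically closed field of characteristic \<open>p\<close>\<close>

definition wphi :: "nat \<Rightarrow> 'k::alg_closed_field witt \<Rightarrow> 'k witt" where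
  "wphi p x = Witt (wfrob p (wcomp x))"

definition wphi_inv :: "nat \<Rightarrow> 'k::alg_closed_field witt \<Rightarrow> 'k witt" where
  "wphi_inv p x = Witt (\<lambda>n. inv_into UNIV (\<lambda>z. z ^ p) (wcomp x n))"

definition fixed_field :: "nat \<Rightarrow> 'k::alg_closed_field set" where
  "fixed_field Q = {z. z ^ Q = z}"

definition wring :: "nat \<Rightarrow> 'k::alg_closed_field witt set" where
  "wring Q = {x. \<forall>n. wcomp x n \<in> fixed_field Q}"

lemma wcomp_wphi [simp]: "wcomp (wphi p x) n = wcomp x n ^ p"
  by (simp add: wphi_def wfrob_def)

lemma comm_ring_map_funpow:
  fixes h :: "'a::comm_ring_1 \<Rightarrow> 'a"
  assumes "comm_ring_map h"
  shows "comm_ring_map (h ^^ n)"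
proof -
  interpret comm_ring_map h by fact
  show ?thesis
    by (induction n) (simp_all add: comm_ring_map_def map_add map_mult map_1)
qed

text \<open>For N >= 2 the polynomial z^N - u z keeps its leading term for every u. The case u = 1
  gives the finite fields, general u the digits of semilinear fixed points.\<close>

lemma card_power_eq_mult_le:
  fixes u :: "'a::idom"
  assumes "N \<ge> 2"
  shows "finite {z. z ^ N = u * z} \<and> card {z. z ^ N = u * z} \<le> N"
proof -
  let ?P = "Polynomial.monom 1 N - Polynomial.monom u 1"
  have "Polynomial.coeff ?P N = 1" using assms by simp
  then have nz: "?P \<noteq> 0" by (metis Polynomial.coeff_0 zero_neq_one)
  have deg: "Polynomial.degree ?P \<le> N"
    by (rule Polynomial.degree_le) (use assms in simp)
  have "{z. z ^ N = u * z} = {z. poly ?P z = 0}"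
    by (simp add: poly_monom)
  then show ?thesis
    using poly_roots_finite[OF nz] card_poly_roots_bound[OF nz] deg by (simp add: le_trans)
qed

lemma poly_smult_prod_mset_root:
  fixes P :: "'a::idom poly"
  assumes "P = Polynomial.smult c (\<Prod>x\<in>#A. [:-x, 1:])" "A = add_mset a B"
  shows "poly P a = 0"
  unfolding assms by (simp only: poly_smult image_mset_add_mset prod_mset.add_mset Polynomial.poly_mult) simp

lemma pderiv_smult_prod_mset_double_root:
  fixes P :: "'a::idom poly"
  assumes "P = Polynomial.smult c (\<Prod>x\<in>#A. [:-x, 1:])" "A = add_mset a (add_mset a B)"
  shows "poly (pderiv P) a = 0"
proof -
  have "P = [:-a, 1:] * ([:-a, 1:] * Polynomial.smult c (\<Prod>x\<in>#B. [:-x, 1:]))"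
    unfolding assms by (simp only: image_mset_add_mset prod_mset.add_mset mult_smult_right)
  then show ?thesis by (simp add: pderiv_mult pderiv_smult del: mult_pCons_left)
qed

locale witt_field =
  fixes p :: nat and ty :: "'k::alg_closed_field itself"
  assumes prime_p: "Factorial_Ring.prime p" and char_p: "CHAR('k) = p"
begin

abbreviation pp :: "'k witt" where "pp \<equiv> of_nat p"

lemma p_gt_0 [simp]: "0 < p"
  using prime_gt_0_nat[OF prime_p] .

lemma p_neq_0 [simp]: "p \<noteq> 0"
  using p_gt_0 by simp

lemma p_ge_2: "p \<ge> 2"
  using prime_ge_2_nat[OF prime_p] .

lemma witt_prime_eq [simp]: "witt_prime TYPE('k) = p"
  using prime_p by (simp add: witt_prime_def char_p)

lemma of_nat_p_field [simp]: "of_nat p = (0 :: 'k)"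
  using char_p by (metis of_nat_CHAR)

lemma comm_ring_map_power_p: "comm_ring_map (\<lambda>z::'k. z ^ p)"
  by standard (use prime_p char_p in \<open>simp_all add: freshmans_dream power_mult_distrib\<close>)

lemma bij_power_p: "bij (\<lambda>z::'k. z ^ p)"
proof (rule bijI)
  interpret comm_ring_map "\<lambda>z::'k. z ^ p" by (rule comm_ring_map_power_p)
  show "inj (\<lambda>z::'k. z ^ p)"
  proof (rule injI)
    fix x y :: 'k assume "x ^ p = y ^ p"
    then have "(x - y) ^ p = 0" by (simp add: map_diff)
    then show "x = y" by simp
  qed
  show "surj (\<lambda>z::'k. z ^ p)"
    by (rule surjI[of _ "\<lambda>z. SOME y. y ^ p = z"]) (rule someI_ex, rule nth_root_exists, simp)
qed

lemma power_p_eq_iff [simp]: "x ^ p = y ^ p \<longleftrightarrow> x = (y :: 'k)"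
  using bij_power_p by (auto simp: bij_def dest: injD)

lemma power_p_power_eq_iff [simp]: "x ^ (p ^ j) = y ^ (p ^ j) \<longleftrightarrow> x = (y :: 'k)"
  by (induction j) (simp_all add: power_mult power_Suc2 del: power_Suc)

lemma power_p_inv [simp]: "inv_into UNIV (\<lambda>z::'k. z ^ p) z ^ p = z"
  using bij_power_p by (simp add: bij_is_surj surj_f_inv_f[where f="\<lambda>z::'k. z ^ p"])

lemma inv_power_p [simp]: "inv_into UNIV (\<lambda>z::'k. z ^ p) (z ^ p) = z"
  by (rule inv_f_f[OF bij_is_inj[OF bij_power_p]])

lemma wphi_wphi_inv [simp]: "wphi p (wphi_inv p x) = (x :: 'k witt)"
  by (rule witt_eqI) (simp add: wphi_inv_def)

lemma wphi_inv_wphi [simp]: "wphi_inv p (wphi p x) = (x :: 'k witt)"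
  by (rule witt_eqI) (simp add: wphi_inv_def)

lemma comm_ring_map_wphi: "comm_ring_map (wphi p :: 'k witt \<Rightarrow> 'k witt)"
proof
  interpret comm_ring_map "\<lambda>z::'k. z ^ p" by (rule comm_ring_map_power_p)
  have *: "(\<lambda>v. (case v of Inl n \<Rightarrow> wcomp x n | Inr n \<Rightarrow> wcomp y n) ^ p)
      = case_sum (\<lambda>n. wcomp x n ^ p) (\<lambda>n. wcomp y n ^ p)" for x y :: "'k witt"
    by (auto simp: fun_eq_iff split: sum.split)
  have **: "wcomp (wphi p x) = (\<lambda>n. wcomp x n ^ p)" for x :: "'k witt"
    by auto
  fix x y :: "'k witt"
  show "wphi p (x + y) = wphi p x + wphi p y" "wphi p (x * y) = wphi p x * wphi p y"
    by (rule witt_eqI,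
        simp add: plus_witt_def times_witt_def zeval_eq_poly_eval poly_eval_comp[OF comm_ring_map_power_p] * **)+
qed (rule witt_eqI, simp add: wcomp_1)

lemma comm_ring_map_wphi_inv: "comm_ring_map (wphi_inv p :: 'k witt \<Rightarrow> 'k witt)"
proof
  interpret comm_ring_map "wphi p :: 'k witt \<Rightarrow> 'k witt" by (rule comm_ring_map_wphi)
  fix x y :: "'k witt"
  show "wphi_inv p (x + y) = wphi_inv p x + wphi_inv p y"
    by (metis map_add wphi_inv_wphi wphi_wphi_inv)
  show "wphi_inv p (x * y) = wphi_inv p x * wphi_inv p y"
    by (metis map_mult wphi_inv_wphi wphi_wphi_inv)
  show "wphi_inv p (1 :: 'k witt) = 1"
    by (metis map_1 wphi_inv_wphi)
qed

lemma weq_wphi [simp]: "weq n (wphi p x) (wphi p y) \<longleftrightarrow> weq n x (y :: 'k witt)"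
  by (simp add: weq_def)

lemma weq_wphi_inv [simp]: "weq n (wphi_inv p x) (wphi_inv p y) \<longleftrightarrow> weq n x (y :: 'k witt)"
  by (metis weq_wphi wphi_wphi_inv)

text \<open>Here characteristic p enters: lifts that agree modulo p become equal after evaluation,
  so ghost components matter only modulo p^(n+1).\<close>

lemma ghost_rep_cong:
  fixes x y :: "'k witt"
  assumes "ghost_rep g x" "ghost_rep h y" "\<And>n. of_nat (p ^ Suc n) dvd g n - h n"
  shows "x = y"
proof (rule witt_eqI)
  fix n
  obtain U V where U: "\<And>n. ghost p n U = g n" "\<And>n. wcomp x n = poly_eval id (U n)"
    and V: "\<And>n. ghost p n V = h n" "\<And>n. wcomp y n = poly_eval id (V n)"
    using assms(1,2) unfolding ghost_rep_def witt_prime_eq by metis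
  have "of_nat p dvd U n - V n"
    by (rule ghost_cong_determines[OF prime_p]) (simp only: U V assms(3))
  from poly_eval_dvd[OF this, of id] have "of_nat p dvd wcomp x n - wcomp y n"
    by (simp add: U V poly_eval_diff)
  then show "wcomp x n = wcomp y n" by simp
qed

text \<open>Multiplication by p is Frobenius followed by the shift. The shifted sequence of p-th
  powers of the lift has ghost components that differ from p times the original ones by exactly
  p^(n+1) times component n, which \<open>ghost_rep_cong\<close> does not see.\<close>

lemma wcomp_p_mult: "wcomp (pp * x) n = (case n of 0 \<Rightarrow> 0 | Suc m \<Rightarrow> wcomp x m ^ p)"
proof -
  let ?U = "\<lambda>i. poly_var (wcomp x i)"
  let ?V = "\<lambda>n. case n of 0 \<Rightarrow> 0 | Suc m \<Rightarrow> ?U m ^ p"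
  let ?y = "Witt (\<lambda>n. case n of 0 \<Rightarrow> 0 | Suc m \<Rightarrow> wcomp x m ^ p)"
  have y: "ghost_rep (\<lambda>n. ghost p n ?V) ?y"
    by (rule ghost_repI[of ?V]) (simp_all add: poly_eval_power split: nat.split)
  have x: "ghost_rep (\<lambda>n. of_nat p * ghost p n ?U) (pp * x)"
    using ghost_rep_times[OF ghost_rep_of_nat ghost_rep_ghost[of x]] by simp
  have *: "of_nat p * ghost p n ?U - ghost p n ?V = of_nat (p ^ Suc n) * ?U n" for n
  proof (cases n)
    case (Suc m)
    have "ghost p (Suc m) ?V = (\<Sum>i\<in>insert 0 (Suc ` {..m}). of_nat (p ^ i) * ?V i ^ (p ^ (Suc m - i)))"
      unfolding ghost_def by (rule sum.cong) (auto simp: image_iff intro: Suc_pred[symmetric])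
    also have "\<dots> = (\<Sum>i\<le>m. of_nat (p ^ Suc i) * (?U i ^ p) ^ (p ^ (m - i)))"
      by (simp add: sum.reindex power_0_left)
    also have "\<dots> = of_nat p * ghost p m (\<lambda>i. ?U i ^ p)"
      by (simp add: ghost_def sum_distrib_left mult_ac)
    finally show ?thesis
      by (simp add: Suc ghost_Suc algebra_simps)
  qed simp
  have "pp * x = ?y"
    by (rule ghost_rep_cong[OF x y]) (simp only: * dvd_triv_left)
  then show ?thesis by (simp split: nat.split)
qed

lemma wcomp_p_power_mult:
  "wcomp (pp ^ j * x) n = (if n < j then 0 else wcomp x (n - j) ^ (p ^ j))"
proof (induction j arbitrary: n)
  case (Suc j)
  have "wcomp (pp ^ Suc j * x) n = wcomp (pp * (pp ^ j * x)) n" by (simp add: mult.assoc)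
  also have "\<dots> = (if n < Suc j then 0 else wcomp x (n - Suc j) ^ (p ^ Suc j))"
    by (simp only: wcomp_p_mult Suc) (auto split: nat.split simp: power_0_left mult.commute simp flip: power_mult)
  finally show ?case .
qed simp

text \<open>The field is perfect, so the remaining components have p^j-th roots, and these form the
  quotient.\<close>

lemma p_power_dvd_iff: "pp ^ j dvd x \<longleftrightarrow> (\<forall>i<j. wcomp x i = 0)"
proof
  assume z: "\<forall>i<j. wcomp x i = 0"
  have "surj (\<lambda>z::'k. z ^ (p ^ j))"
    by (rule surjI[of _ "\<lambda>z. SOME y. y ^ (p ^ j) = z"]) (rule someI_ex, rule nth_root_exists, simp)
  then have r: "inv_into UNIV (\<lambda>z::'k. z ^ (p ^ j)) z ^ (p ^ j) = z" for z
    by (rule surj_f_inv_f)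
  have "x = pp ^ j * Witt (\<lambda>n. inv_into UNIV (\<lambda>z::'k. z ^ (p ^ j)) (wcomp x (n + j)))"
    using z by (intro witt_eqI) (simp add: wcomp_p_power_mult r)
  then show "pp ^ j dvd x" by (rule dvdI)
qed (auto elim!: dvdE simp: wcomp_p_power_mult)

lemma weq_enat_iff_dvd: "weq (enat n) x y \<longleftrightarrow> pp ^ n dvd x - y"
  by (subst weq_diff_iff) (simp add: p_power_dvd_iff weq_def)

text \<open>Cancelling p^j costs exactly j digits of precision; at infinite precision nothing is
  lost, so p is not a zero divisor.\<close>

lemma weq_p_power_mult_iff: "weq (n + enat j) (pp ^ j * x) (pp ^ j * y) \<longleftrightarrow> weq n x y"
proof
  assume *: "weq (n + enat j) (pp ^ j * x) (pp ^ j * y)"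
  show "weq n x y"
    unfolding weq_def
  proof (intro allI impI)
    fix i assume "enat i < n"
    then have "enat (i + j) < n + enat j"
      by (cases n) auto
    with * have "wcomp (pp ^ j * x) (i + j) = wcomp (pp ^ j * y) (i + j)"
      unfolding weq_def by blast
    then show "wcomp x i = wcomp y i"
      by (simp add: wcomp_p_power_mult)
  qed
next
  assume *: "weq n x y"
  show "weq (n + enat j) (pp ^ j * x) (pp ^ j * y)"
    unfolding weq_def
  proof (intro allI impI)
    fix i assume i: "enat i < n + enat j"
    then have "enat (i - j) < n" if "j \<le> i"
      using that by (cases n) auto
    with * show "wcomp (pp ^ j * x) i = wcomp (pp ^ j * y) i"
      by (auto simp: wcomp_p_power_mult weq_def)
  qed
qed

lemma p_power_mult_cancel [simp]: "pp ^ j * x = pp ^ j * y \<longleftrightarrow> x = y"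
  using weq_p_power_mult_iff[of \<infinity> j x y] by simp

lemma p_mult_cancel [simp]: "pp * x = pp * y \<longleftrightarrow> x = y"
  using p_power_mult_cancel[of 1 x y] by simp

text \<open>Geometric series: if \<open>p\<close> divides \<open>1 - x\<close>, the partial sums of \<open>\<Sum> (1 - x)\<^sup>k\<close> converge to an inverse.\<close>

lemma witt_unit_1:
  assumes "wcomp x 0 = 1"
  shows "\<exists>y. x * y = (1 :: 'k witt)"
proof -
  have d: "pp dvd 1 - x"
    using p_power_dvd_iff[of 1 "1 - x"] comm_ring_map.map_diff[OF comm_ring_map_wcomp_0, of 1 x] assms
    by (simp add: wcomp_1)
  define s :: "nat \<Rightarrow> 'k witt" where "s n = (\<Sum>k<n. (1 - x) ^ k)" for n
  have s: "x * s n = 1 - (1 - x) ^ n" for n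
    using power_diff_1_eq[of "1 - x" n] by (simp add: s_def algebra_simps)
  have dn: "weq (enat n) ((1 - x) ^ n) 0" for n
    using dvd_power_same[OF d, of n] by (simp add: weq_enat_iff_dvd)
  have step: "weq (enat n) (s (Suc n)) (s n)" for n
    using weq_add[OF weq_refl[of "enat n" "s n"] dn[of n]] by (simp add: s_def)
  have mono: "weq (enat n) (s (n + k)) (s n)" for n k
  proof (induction k)
    case (Suc k)
    have "weq (enat n) (s (Suc (n + k))) (s (n + k))"
      using step[of "n + k"] by (simp add: weq_def)
    with Suc show ?case by (metis add_Suc_right weq_trans)
  qed simp
  define y where "y = Witt (\<lambda>i. wcomp (s (Suc i)) i)"
  have y: "weq (enat n) y (s n)" for n
    unfolding weq_def
  proof (intro allI impI)
    fix i assume "enat i < enat n"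
    then show "wcomp y i = wcomp (s n) i"
      using mono[of "Suc i" "n - Suc i"] by (simp add: y_def weq_def)
  qed
  have "weq (enat n) (x * y) 1" for n
  proof -
    have "weq (enat n) (x * y) (x * s n)" by (rule weq_mult[OF weq_refl y])
    also have "weq (enat n) (x * s n) (1 - 0)"
      unfolding s by (rule weq_diff[OF weq_refl dn])
    finally show ?thesis by simp
  qed
  then have "weq \<infinity> (x * y) 1"
    unfolding weq_def by (metis enat_ord_simps(2) lessI)
  then show ?thesis by auto
qed

lemma witt_unit_iff: "(\<exists>y. x * y = (1 :: 'k witt)) \<longleftrightarrow> wcomp x 0 \<noteq> 0"
proof
  assume "\<exists>y. x * y = 1"
  then obtain y where "x * y = 1" ..
  then have "wcomp x 0 * wcomp y 0 = 1"
    by (metis wcomp_mult_0 wcomp_1)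
  then show "wcomp x 0 \<noteq> 0" by auto
next
  assume nz: "wcomp x 0 \<noteq> 0"
  \<comment> \<open>Only component 0 matters; any vector with this residue reduces the claim to
    residue 1.\<close>
  let ?z = "Witt (\<lambda>_. inverse (wcomp x 0))"
  have "wcomp (x * ?z) 0 = 1" using nz by (simp add: wcomp_mult_0)
  from witt_unit_1[OF this] show "\<exists>y. x * y = 1"
    by (metis mult.assoc)
qed

text \<open>z^Q - z splits, and its derivative -1 excludes double roots; hence the number of its
  roots equals its degree.\<close>

lemma card_fixed_field:
  assumes "f \<ge> 1"
  shows "finite (fixed_field (p ^ f) :: 'k set)" "card (fixed_field (p ^ f) :: 'k set) = p ^ f"
proof -
  let ?Q = "p ^ f"
  have Q2: "?Q \<ge> 2"
    using self_le_power[of p f] p_ge_2 assms by simp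
  have eq: "(fixed_field ?Q :: 'k set) = {z. z ^ ?Q = 1 * z}"
    by (simp add: fixed_field_def)
  show fin: "finite (fixed_field ?Q :: 'k set)"
    using card_power_eq_mult_le[OF Q2, of "1::'k"] unfolding eq by blast
  define P where "P = Polynomial.monom 1 ?Q - Polynomial.monom (1::'k) 1"
  have cf: "Polynomial.coeff P ?Q = 1" using Q2 by (simp add: P_def)
  have nz: "P \<noteq> 0" using cf by (metis Polynomial.coeff_0 zero_neq_one)
  have "Polynomial.degree P \<ge> ?Q" using cf by (intro le_degree) simp
  obtain A c where A: "size A = Polynomial.degree P" "P = Polynomial.smult c (\<Prod>x\<in>#A. [:-x, 1:])"
    using alg_closed_imp_factorization[OF nz] by blast
  have root: "poly P z = 0 \<longleftrightarrow> z \<in> fixed_field ?Q" for z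
    by (simp add: P_def poly_monom fixed_field_def)
  have Aroot: "a \<in> fixed_field ?Q" if a: "a \<in># A" for a
  proof -
    obtain B where B: "A = add_mset a B" using multi_member_split[OF a] by blast
    from poly_smult_prod_mset_root[OF A(2) B] have "poly P a = 0" .
    then show ?thesis by (simp add: root)
  qed
  have dA: "count A a \<le> 1" for a
  proof (rule ccontr)
    assume "\<not> count A a \<le> 1"
    then have "{#a, a#} \<subseteq># A"
      by (intro mset_subset_eqI) auto
    then obtain B where "A = {#a, a#} + B"
      by (metis subset_mset.add_diff_inverse)
    then have "A = add_mset a (add_mset a B)" by simp
    from pderiv_smult_prod_mset_double_root[OF A(2) this] have "poly (pderiv P) a = 0" .
    moreover have "pderiv P = [:-1:]"
    proof -
      have "(of_nat ?Q :: 'k) = 0" using assms by (simp add: power_0_left)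
      then show ?thesis by (simp add: P_def pderiv_diff pderiv_monom monom_0 del: of_nat_power)
    qed
    ultimately show False by simp
  qed
  have "size A = (\<Sum>a\<in>set_mset A. count A a)" by (simp add: size_multiset_overloaded_eq)
  also have "\<dots> \<le> (\<Sum>a\<in>set_mset A. 1)" by (intro sum_mono dA)
  also have "\<dots> \<le> card (fixed_field ?Q :: 'k set)" using Aroot by (simp, intro card_mono[OF fin]) auto
  finally have "?Q \<le> card (fixed_field ?Q :: 'k set)"
    using A(1) \<open>Polynomial.degree P \<ge> ?Q\<close> by simp
  moreover have "card (fixed_field ?Q :: 'k set) \<le> ?Q"
    using card_power_eq_mult_le[OF Q2, of "1::'k"] unfolding eq by blast
  ultimately show "card (fixed_field ?Q :: 'k set) = ?Q" by simp
qed

lemma wcomp_funpow_wphi: "wcomp ((wphi p ^^ f) x) n = wcomp (x :: 'k witt) n ^ (p ^ f)"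
  by (induction f) (simp_all add: mult.commute flip: power_mult)

text \<open>Frobenius acts componentwise, so the Witt ring of a finite field is the fixed ring of
  one of its powers. Closure under the ring operations then follows without looking at Witt
  polynomials.\<close>

lemma wring_iff_fixed: "x \<in> wring (p ^ f) \<longleftrightarrow> (wphi p ^^ f) x = (x :: 'k witt)"
proof
  assume "x \<in> wring (p ^ f)"
  then show "(wphi p ^^ f) x = x"
    by (intro witt_eqI) (simp add: wcomp_funpow_wphi wring_def fixed_field_def)
next
  assume "(wphi p ^^ f) x = x"
  then show "x \<in> wring (p ^ f)"
    using wcomp_funpow_wphi[of f x] by (simp add: wring_def fixed_field_def)
qed

lemma wring_closed:
  fixes x y :: "'k witt"
  shows "(0 :: 'k witt) \<in> wring (p ^ f)" "(1 :: 'k witt) \<in> wring (p ^ f)" "(of_nat n :: 'k witt) \<in> wring (p ^ f)"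
    "x \<in> wring (p ^ f) \<Longrightarrow> y \<in> wring (p ^ f) \<Longrightarrow> x + y \<in> wring (p ^ f)"
    "x \<in> wring (p ^ f) \<Longrightarrow> y \<in> wring (p ^ f) \<Longrightarrow> x - y \<in> wring (p ^ f)"
    "x \<in> wring (p ^ f) \<Longrightarrow> y \<in> wring (p ^ f) \<Longrightarrow> x * y \<in> wring (p ^ f)"
    "x \<in> wring (p ^ f) \<Longrightarrow> - x \<in> wring (p ^ f)"
    "x \<in> wring (p ^ f) \<Longrightarrow> x ^ n \<in> wring (p ^ f)"
proof -
  interpret comm_ring_map "wphi p ^^ f :: 'k witt \<Rightarrow> 'k witt"
    by (rule comm_ring_map_funpow[OF comm_ring_map_wphi])
  show "(0 :: 'k witt) \<in> wring (p ^ f)" "(1 :: 'k witt) \<in> wring (p ^ f)" "(of_nat n :: 'k witt) \<in> wring (p ^ f)"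
    "x \<in> wring (p ^ f) \<Longrightarrow> y \<in> wring (p ^ f) \<Longrightarrow> x + y \<in> wring (p ^ f)"
    "x \<in> wring (p ^ f) \<Longrightarrow> y \<in> wring (p ^ f) \<Longrightarrow> x - y \<in> wring (p ^ f)"
    "x \<in> wring (p ^ f) \<Longrightarrow> y \<in> wring (p ^ f) \<Longrightarrow> x * y \<in> wring (p ^ f)"
    "x \<in> wring (p ^ f) \<Longrightarrow> - x \<in> wring (p ^ f)"
    "x \<in> wring (p ^ f) \<Longrightarrow> x ^ n \<in> wring (p ^ f)"
    by (simp_all add: wring_iff_fixed map_0 map_1 map_of_nat map_add map_diff map_mult map_minus map_power)
qed

lemma wring_sum:
  fixes g :: "'b \<Rightarrow> 'k witt"
  assumes "\<And>x. x \<in> A \<Longrightarrow> g x \<in> wring (p ^ f)"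
  shows "(\<Sum>x\<in>A. g x) \<in> wring (p ^ f)"
  using assms by (induction A rule: infinite_finite_induct) (simp_all add: wring_closed)

text \<open>The power of Frobenius that fixes x sends y to another inverse of x, and inverses are
  unique.\<close>

lemma wring_inverse:
  fixes x y :: "'k witt"
  assumes "x \<in> wring (p ^ f)" "x * y = 1"
  shows "y \<in> wring (p ^ f)"
proof -
  interpret comm_ring_map "wphi p ^^ f :: 'k witt \<Rightarrow> 'k witt"
    by (rule comm_ring_map_funpow[OF comm_ring_map_wphi])
  have "x * (wphi p ^^ f) y = 1"
    using assms map_mult[of x y] by (simp add: wring_iff_fixed map_1)
  then have "(wphi p ^^ f) y = y"
    using assms(2) by (metis mult.assoc mult.commute mult_1)
  then show ?thesis by (simp add: wring_iff_fixed)
qed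

text \<open>p is fixed by Frobenius and can be cancelled, so a quotient by p^j formed over the large
  field stays in the small ring.\<close>

lemma wring_p_power_mult_iff: "pp ^ j * x \<in> wring (p ^ f) \<longleftrightarrow> x \<in> wring (p ^ f)"
proof -
  interpret comm_ring_map "wphi p ^^ f :: 'k witt \<Rightarrow> 'k witt"
    by (rule comm_ring_map_funpow[OF comm_ring_map_wphi])
  show ?thesis
    by (simp add: wring_iff_fixed map_mult map_power map_of_nat)
qed

lemma wring_wphi: "wphi p x \<in> wring (p ^ f) \<longleftrightarrow> (x :: 'k witt) \<in> wring (p ^ f)"
  by (simp add: wring_def fixed_field_def mult.commute[of p] power_mult[of _ p] flip: power_mult)
    (metis mult.commute power_mult power_p_eq_iff)

lemma wring_wphi_inv: "wphi_inv p x \<in> wring (p ^ f) \<longleftrightarrow> (x :: 'k witt) \<in> wring (p ^ f)"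
  using wring_wphi[of "wphi_inv p x" f] by simp

lemma wring_wtrunc: "(x :: 'k witt) \<in> wring (p ^ f) \<Longrightarrow> wtrunc n x \<in> wring (p ^ f)"
  by (simp add: wring_def wtrunc_def fixed_field_def power_0_left)

lemma wring_p_multE:
  assumes "x \<in> wring (p ^ f)" "weq (enat j) x 0"
  obtains y where "y \<in> wring (p ^ f)" "x = pp ^ j * y"
  using assms by (auto simp: weq_enat_iff_dvd elim!: dvdE) (metis wring_p_power_mult_iff)

lemma wring_mono:
  assumes "f dvd g"
  shows "(wring (p ^ f) :: 'k witt set) \<subseteq> wring (p ^ g)"
proof
  fix x :: "'k witt" assume x: "x \<in> wring (p ^ f)"
  obtain h where g: "g = f * h" using assms by (elim dvdE)
  have "((wphi p ^^ f) ^^ h) x = x"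
    using x by (induction h) (simp_all add: wring_iff_fixed)
  then show "x \<in> wring (p ^ g)"
    by (simp add: wring_iff_fixed g funpow_mult mult.commute)
qed

end

section \<open>Periodic sequences of integers\<close>

lemma card_le_fibres:
  assumes "finite B" "f ` A \<subseteq> B" "\<And>y. y \<in> B \<Longrightarrow> finite {x \<in> A. f x = y} \<and> card {x \<in> A. f x = y} \<le> c"
  shows "finite A \<and> card A \<le> c * card B"
proof -
  have A: "A = (\<Union>y\<in>B. {x \<in> A. f x = y})" using assms(2) by auto
  have "card (\<Union>y\<in>B. {x \<in> A. f x = y}) \<le> (\<Sum>y\<in>B. card {x \<in> A. f x = y})"
    by (rule card_UN_le[OF assms(1)])
  also have "\<dots> \<le> (\<Sum>y\<in>B. c)" using assms(3) by (intro sum_mono) auto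
  finally have "card A \<le> c * card B" using A by (simp add: mult.commute)
  moreover have "finite A" by (subst A) (use assms in auto)
  ultimately show ?thesis by simp
qed

lemma ex_int_antiderivative: "\<exists>P::int \<Rightarrow> int. \<forall>k. P (k + 1) = P k + w k"
proof -
  let ?P = "\<lambda>k::int. if k \<ge> 0 then (\<Sum>i<nat k. w (int i)) else - (\<Sum>i<nat (- k). w (- 1 - int i))"
  have "?P (k + 1) = ?P k + w k" for k
  proof (cases "k \<ge> 0")
    case True
    then have "nat (k + 1) = Suc (nat k)" by simp
    then show ?thesis using True by simp
  next
    case False
    then have "nat (- k) = Suc (nat (- (k + 1)))" by simp
    then show ?thesis using False by (cases "k = -1") auto
  qed
  then show ?thesis by (intro exI[of _ ?P] allI)
qed

lemma int_periodic_shift: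
  fixes g :: "int \<Rightarrow> 'a"
  assumes "\<And>k. g (k + int m) = g k"
  shows "g (k + int m * q) = g k"
proof (induction q rule: int_induct[where k=0])
  case (step1 i)
  then show ?case using assms[of "k + int m * i"] by (simp add: algebra_simps)
next
  case (step2 i)
  then show ?case using assms[of "k + int m * (i - 1)"] by (simp add: algebra_simps)
qed simp

text \<open>A lattice path with periodic steps. The path itself is periodic only up to a linear
  term, whose slope is governed by the net change over one period.\<close>

locale int_walk =
  fixes w P :: "int \<Rightarrow> int" and m :: nat
  assumes m_pos: "m > 0" and w_period: "w (k + int m) = w k" and P_step: "P (k + 1) = P k + w k"
begin

definition "drift = (\<Sum>i<m. w (int i))"

lemma P_add: "P (k + int j) = P k + (\<Sum>i<j. w (k + int i))"
proof (induction j)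
  case (Suc j)
  then show ?case using P_step[of "k + int j"] by (simp add: add_ac)
qed simp

lemma P_period: "P (k + int m) = P k + drift"
proof (induction k rule: int_induct[where k=0])
  case base
  show ?case using P_add[of 0 m] by (simp add: drift_def)
next
  case (step1 i)
  then show ?case using P_step[of "i + int m"] P_step[of i] w_period[of i] by (simp add: algebra_simps)
next
  case (step2 i)
  then show ?case using P_step[of "i - 1 + int m"] P_step[of "i - 1"] w_period[of "i - 1"] by (simp add: algebra_simps)
qed

lemma P_shift: "P (k + int m * q) = P k + drift * q"
proof (induction q rule: int_induct[where k=0])
  case (step1 i)
  then show ?case using P_period[of "k + int m * i"] by (simp add: algebra_simps)
next
  case (step2 i)
  then show ?case using P_period[of "k + int m * (i - 1)"] by (simp add: algebra_simps)
qed simp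

text \<open>Start where P is maximal over one period. Since the drift is nonpositive, later periods
  lie no higher, and the path never exceeds its starting level afterwards.\<close>

lemma cycle_lemma:
  assumes "drift \<le> 0"
  obtains k0 where "\<And>j. (\<Sum>i<j. w (k0 + int i)) \<le> 0"
proof -
  have "finite (P ` {0..<int m})" "P ` {0..<int m} \<noteq> {}" using m_pos by auto
  then have "Max (P ` {0..<int m}) \<in> P ` {0..<int m}" by (rule Max_in)
  then obtain k0 where k0': "Max (P ` {0..<int m}) = P k0" "k0 \<in> {0..<int m}" by (rule imageE)
  then have k0: "k0 \<in> {0..<int m}" "\<And>k. k \<in> {0..<int m} \<Longrightarrow> P k \<le> P k0"
    by (simp_all flip: k0'(1))
  have "P k \<le> P k0" if "k \<ge> 0" for k
  proof -
    have "P k = P (k mod int m) + drift * (k div int m)"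
      using P_shift[of "k mod int m" "k div int m"] by simp
    moreover have "drift * (k div int m) \<le> 0"
      using assms that m_pos by (intro mult_nonpos_nonneg) (simp_all add: pos_imp_zdiv_nonneg_iff)
    moreover have "P (k mod int m) \<le> P k0" using m_pos by (intro k0(2)) simp
    ultimately show ?thesis by linarith
  qed
  then have "P (k0 + int j) \<le> P k0" for j using k0(1) by simp
  then have "(\<Sum>i<j. w (k0 + int i)) \<le> 0" for j
    using P_add[of k0 j] by (metis add_le_same_cancel1)
  then show ?thesis by (rule that)
qed

end

section \<open>Cyclic systems of semilinear equations\<close>

text \<open>Indices run over all integers with period m instead of residues, because the walk
  \<open>P\<close> attached to the system need not be periodic. The map \<tau> is kept abstract,
  together with its inverse \<tau>', so that the reversed cycle is again an instance.\<close>

locale cyclic_system = witt_field p ty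
  for p :: nat and ty :: "'k::alg_closed_field itself" +
  fixes f m :: nat and \<tau> \<tau>' :: "'k witt \<Rightarrow> 'k witt" and u :: "int \<Rightarrow> 'k witt" and a b :: "int \<Rightarrow> nat"
  assumes f_pos: "f \<ge> 1" and m_pos: "m \<ge> 1"
    and hom_tau: "comm_ring_map \<tau>" and hom_tau': "comm_ring_map \<tau>'"
    and tau_tau' [simp]: "\<tau> (\<tau>' x) = x" and tau'_tau [simp]: "\<tau>' (\<tau> x) = x"
    and weq_tau [simp]: "weq n (\<tau> x) (\<tau> y) \<longleftrightarrow> weq n x y"
    and wring_tau [simp]: "\<tau> x \<in> wring (p ^ f) \<longleftrightarrow> x \<in> wring (p ^ f)"
    and u_unit: "wcomp (u k) 0 \<noteq> 0" and u_wring: "u k \<in> wring (p ^ f)"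
    and u_period: "u (k + int m) = u k"
    and a_period: "a (k + int m) = a k" and b_period: "b (k + int m) = b k"
    and ab: "(a k, b k) \<in> {(0, 0), (1, 0), (0, 1)}"
begin

definition rel :: "enat \<Rightarrow> (int \<Rightarrow> 'k witt) \<Rightarrow> bool" where
  "rel n \<alpha> \<longleftrightarrow> (\<forall>k. weq n (pp ^ b k * (u k * \<alpha> (k + 1))) (pp ^ a k * \<tau> (\<alpha> k)))"

text \<open>Entries are in normal form modulo p^n, so that different functions are different
  solutions; for infinite n this is no condition.\<close>

definition sols :: "enat \<Rightarrow> (int \<Rightarrow> 'k witt) set" where
  "sols n = {\<alpha>. (\<forall>k. \<alpha> k \<in> wring (p ^ f)) \<and> (\<forall>k. wtrunc n (\<alpha> k) = \<alpha> k)
     \<and> (\<forall>k. \<alpha> (k + int m) = \<alpha> k) \<and> rel n \<alpha>}"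

definition A where "A = (\<Sum>i<m. a (int i))"
definition B where "B = (\<Sum>i<m. b (int i))"

sublocale tau: comm_ring_map \<tau> by (rule hom_tau)
sublocale tau': comm_ring_map \<tau>' by (rule hom_tau')

lemma tau_p_power [simp]: "\<tau> (pp ^ j) = pp ^ j"
  by (simp add: tau.map_power tau.map_of_nat)

lemma weq_tau' [simp]: "weq n (\<tau>' x) (\<tau>' y) \<longleftrightarrow> weq n x y"
  using weq_tau[of n "\<tau>' x" "\<tau>' y"] by simp

lemma wring_tau' [simp]: "\<tau>' x \<in> wring (p ^ f) \<longleftrightarrow> x \<in> wring (p ^ f)"
  using wring_tau[of "\<tau>' x"] by simp

lemma wcomp_0_tau_eq_0: "wcomp (\<tau> x) 0 = 0 \<longleftrightarrow> wcomp x 0 = 0"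
  using weq_tau[of 1 x 0] by (simp add: weq_def tau.map_0 one_enat_def)

lemma weq_tau_funpow [simp]: "weq n ((\<tau> ^^ j) x) ((\<tau> ^^ j) y) \<longleftrightarrow> weq n x y"
  by (induction j) simp_all

lemma tau_funpow_0 [simp]: "(\<tau> ^^ j) 0 = 0"
  by (induction j) (simp_all add: tau.map_0)

lemma shift_period:
  "u (k + int m * q) = u k" "a (k + int m * q) = a k" "b (k + int m * q) = b k"
  by (rule int_periodic_shift; simp add: u_period a_period b_period)+

lemma sols_shift: "\<alpha> \<in> sols n \<Longrightarrow> \<alpha> (k + int m * q) = \<alpha> k"
  by (rule int_periodic_shift) (simp add: sols_def)

text \<open>Only differences of P have a meaning, so any antiderivative of a - b may be
  chosen.\<close>

definition P :: "int \<Rightarrow> int" where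
  "P = (SOME P. \<forall>k. P (k + 1) = P k + (int (a k) - int (b k)))"

lemma P_Suc: "P (k + 1) = P k + (int (a k) - int (b k))"
  using someI_ex[OF ex_int_antiderivative[of "\<lambda>k. int (a k) - int (b k)"]] unfolding P_def by blast

sublocale walk: int_walk "\<lambda>k. int (a k) - int (b k)" P m
  by standard (use m_pos P_Suc a_period b_period in auto)

lemma drift_eq: "walk.drift = int A - int B"
  by (simp add: walk.drift_def A_def B_def sum_subtractf)

text \<open>The unit collected when j successive equations, starting with the one at k0, are
  composed.\<close>

fun uprod :: "int \<Rightarrow> nat \<Rightarrow> 'k witt" where
  "uprod k0 0 = 1"
| "uprod k0 (Suc j) = \<tau> (uprod k0 j) * u (k0 + int j)"

lemma uprod_unit: "wcomp (uprod k0 j) 0 \<noteq> 0"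
  by (induction j) (simp_all add: wcomp_1 wcomp_mult_0 u_unit wcomp_0_tau_eq_0)

lemma uprod_mult_eq_0_mod: "weq (enat n) (uprod k0 j * x) 0 \<longleftrightarrow> weq (enat n) x 0"
proof -
  obtain v where v: "uprod k0 j * v = 1" using witt_unit_iff uprod_unit by metis
  show ?thesis
  proof
    assume "weq (enat n) (uprod k0 j * x) 0"
    then have "weq (enat n) (v * (uprod k0 j * x)) (v * 0)" by (rule weq_mult[OF weq_refl])
    moreover have "v * (uprod k0 j * x) = (uprod k0 j * v) * x" by (simp add: mult_ac)
    ultimately show "weq (enat n) x 0" by (simp add: v)
  next
    assume "weq (enat n) x 0"
    then have "weq (enat n) (uprod k0 j * x) (uprod k0 j * 0)" by (rule weq_mult[OF weq_refl])
    then show "weq (enat n) (uprod k0 j * x) 0" by simp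
  qed
qed

text \<open>The powers of p accumulate on both sides and nothing is cancelled. For exact solutions
  this is enough, since there the cancellation can be done afterwards.\<close>

lemma rel_iterate:
  assumes "rel n \<alpha>"
  shows "weq n (pp ^ (\<Sum>i<j. b (k0 + int i)) * (uprod k0 j * \<alpha> (k0 + int j)))
    (pp ^ (\<Sum>i<j. a (k0 + int i)) * (\<tau> ^^ j) (\<alpha> k0))"
proof (induction j)
  case (Suc j)
  let ?B = "\<Sum>i<j. b (k0 + int i)" and ?A = "\<Sum>i<j. a (k0 + int i)" and ?k = "k0 + int j"
  have "pp ^ (\<Sum>i<Suc j. b (k0 + int i)) * (uprod k0 (Suc j) * \<alpha> (k0 + int (Suc j)))
      = (pp ^ ?B * \<tau> (uprod k0 j)) * (pp ^ b ?k * (u ?k * \<alpha> (?k + 1)))"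
    by (simp add: power_add mult_ac add_ac)
  also have "weq n \<dots> ((pp ^ ?B * \<tau> (uprod k0 j)) * (pp ^ a ?k * \<tau> (\<alpha> ?k)))"
    by (rule weq_mult[OF weq_refl]) (use assms in \<open>simp add: rel_def\<close>)
  also have "(pp ^ ?B * \<tau> (uprod k0 j)) * (pp ^ a ?k * \<tau> (\<alpha> ?k))
      = pp ^ a ?k * \<tau> (pp ^ ?B * (uprod k0 j * \<alpha> ?k))"
    by (simp add: tau.map_mult mult_ac)
  also have "weq n \<dots> (pp ^ a ?k * \<tau> (pp ^ ?A * (\<tau> ^^ j) (\<alpha> k0)))"
    by (rule weq_mult[OF weq_refl]) (use Suc in simp)
  also have "pp ^ a ?k * \<tau> (pp ^ ?A * (\<tau> ^^ j) (\<alpha> k0)) = pp ^ (\<Sum>i<Suc j. a (k0 + int i)) * (\<tau> ^^ Suc j) (\<alpha> k0)"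
    by (simp add: tau.map_mult power_add mult_ac)
  finally show ?case .
qed simp

text \<open>
  As long as the partial sums of \<open>a - b\<close> stay nonpositive, no power of \<open>p\<close> has to be cancelled, so
  the composed relation holds to full precision.
\<close>

lemma rel_iterate_exact:
  assumes "rel n \<alpha>" "\<And>i. i \<le> j \<Longrightarrow> (\<Sum>i<i. int (a (k0 + int i)) - int (b (k0 + int i))) \<le> 0"
  shows "weq n ((\<tau> ^^ j) (\<alpha> k0))
    (pp ^ nat (- (\<Sum>i<j. int (a (k0 + int i)) - int (b (k0 + int i)))) * (uprod k0 j * \<alpha> (k0 + int j)))"
  using assms(2)
proof (induction j)
  case (Suc j)
  let ?k = "k0 + int j"
  let ?S = "\<lambda>j. \<Sum>i<j. int (a (k0 + int i)) - int (b (k0 + int i))"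
  have S: "?S (Suc j) = ?S j + (int (a ?k) - int (b ?k))" by simp
  have le: "?S j \<le> 0" "?S (Suc j) \<le> 0" using Suc.prems[of j] Suc.prems[of "Suc j"] by simp_all
  have IH: "weq n ((\<tau> ^^ j) (\<alpha> k0)) (pp ^ nat (- ?S j) * (uprod k0 j * \<alpha> ?k))"
    using Suc by simp
  have rel: "weq n (pp ^ a ?k * \<tau> (\<alpha> ?k)) (pp ^ b ?k * (u ?k * \<alpha> (?k + 1)))"
    using assms(1) by (simp add: rel_def weq_sym)
  \<comment> \<open>The power of p collected so far contains the factor p^a of the next equation: if
    a = 1, then b = 0, and the next partial sum is still nonpositive.\<close>
  have e: "nat (- ?S j) = (nat (- ?S j) - a ?k) + a ?k \<and> nat (- ?S (Suc j)) = (nat (- ?S j) - a ?k) + b ?k"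
    using ab[of ?k] le S by auto
  define c where "c = nat (- ?S j) - a ?k"
  have "(\<tau> ^^ Suc j) (\<alpha> k0) = \<tau> ((\<tau> ^^ j) (\<alpha> k0))" by simp
  also have "weq n \<dots> (\<tau> (pp ^ nat (- ?S j) * (uprod k0 j * \<alpha> ?k)))"
    using IH by simp
  also have "\<tau> (pp ^ nat (- ?S j) * (uprod k0 j * \<alpha> ?k)) = (pp ^ c * \<tau> (uprod k0 j)) * (pp ^ a ?k * \<tau> (\<alpha> ?k))"
    using e by (simp add: tau.map_mult c_def mult_ac flip: power_add)
  also have "weq n \<dots> ((pp ^ c * \<tau> (uprod k0 j)) * (pp ^ b ?k * (u ?k * \<alpha> (?k + 1))))"
    by (rule weq_mult[OF weq_refl rel])
  also have "(pp ^ c * \<tau> (uprod k0 j)) * (pp ^ b ?k * (u ?k * \<alpha> (?k + 1)))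
      = pp ^ (c + b ?k) * (uprod k0 (Suc j) * \<alpha> (?k + 1))"
    by (simp add: power_add mult_ac)
  also have "c + b ?k = nat (- ?S (Suc j))" using e by (simp add: c_def)
  finally show ?case by (simp only: of_nat_Suc add_ac)
qed simp

text \<open>Divisibility improves itself: if p^l divides y, then p^(l+1) divides the right-hand
  side, hence the image of y under a power of \<tau>, hence y, as long as l < n.\<close>

lemma shifted_fixpoint_eq_0:
  assumes "weq (enat n) ((\<tau> ^^ j) y) (pp ^ e * (uprod k0 i * y))" "e \<ge> 1"
  shows "weq (enat n) y 0"
proof -
  have "weq (enat l) y 0" if "l \<le> n" for l
    using that
  proof (induction l)
    case (Suc l)
    then have d: "pp ^ l dvd y" by (simp add: weq_enat_iff_dvd)
    have "pp ^ Suc l dvd pp ^ e * (uprod k0 i * y)"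
      unfolding power_Suc by (rule mult_dvd_mono) (use d assms(2) in \<open>auto intro: dvd_power\<close>)
    then have "weq (enat (Suc l)) (pp ^ e * (uprod k0 i * y)) 0" by (simp add: weq_enat_iff_dvd)
    moreover have "weq (enat (Suc l)) ((\<tau> ^^ j) y) (pp ^ e * (uprod k0 i * y))"
      using assms(1) Suc.prems by (auto simp: weq_def)
    ultimately have "weq (enat (Suc l)) ((\<tau> ^^ j) y) ((\<tau> ^^ j) 0)"
      using weq_trans tau_funpow_0 by metis
    then show ?case by (simp only: weq_tau_funpow)
  qed (simp add: weq_def zero_enat_def[symmetric])
  then show ?thesis by simp
qed

end

section \<open>Fixed points of a semilinear map modulo p^n\<close>

context witt_field
begin

text \<open>Induction on the precision: two solutions modulo p^(n+1) with the same truncation differ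
  by a multiple of p^n, and component n of the difference is a root of a polynomial of degree p^m.
  So each digit costs at most a factor p^m, even over the whole field.\<close>

lemma semilinear_fixpoints_bound:
  assumes "m \<ge> 1"
  shows "finite {y :: 'k witt. wtrunc (enat n) y = y \<and> weq (enat n) ((wphi p ^^ m) y) (U * y)} \<and>
    card {y :: 'k witt. wtrunc (enat n) y = y \<and> weq (enat n) ((wphi p ^^ m) y) (U * y)} \<le> p ^ (m * n)"
    (is "finite (?Y n) \<and> card (?Y n) \<le> _")
proof (induction n)
  case 0
  have "?Y 0 \<subseteq> {0}" by (auto simp: wtrunc_def zero_witt_def zero_enat_def[symmetric])
  then have "finite (?Y 0) \<and> card (?Y 0) \<le> card {0 :: 'k witt}"
    by (meson card_mono finite.emptyI finite.insertI finite_subset)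
  then show ?case by simp
next
  case (Suc n)
  interpret tm: comm_ring_map "wphi p ^^ m :: 'k witt \<Rightarrow> 'k witt"
    by (rule comm_ring_map_funpow[OF comm_ring_map_wphi])
  have pm: "p ^ m \<ge> 2"
    using self_le_power[of p m] p_ge_2 assms by simp
  have step: "finite (?Y (Suc n)) \<and> card (?Y (Suc n)) \<le> p ^ m * card (?Y n)"
  proof (rule card_le_fibres[of _ "wtrunc (enat n)"])
    show "finite (?Y n)" using Suc by blast
    show "wtrunc (enat n) ` ?Y (Suc n) \<subseteq> ?Y n"
    proof (rule image_subsetI)
      fix y assume y: "y \<in> ?Y (Suc n)"
      let ?t = "wtrunc (enat n) y"
      have "weq (enat n) ((wphi p ^^ m) ?t) ((wphi p ^^ m) y)"
        by (simp add: weq_def wcomp_funpow_wphi wtrunc_def)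
      also have "weq (enat n) ((wphi p ^^ m) y) (U * y)" using y by (auto simp: weq_def)
      also have "weq (enat n) (U * y) (U * ?t)" by (rule weq_mult[OF weq_refl weq_sym[OF weq_wtrunc]])
      finally show "?t \<in> ?Y n" by (simp add: wtrunc_eq_iff)
    qed
    fix y1 assume "y1 \<in> ?Y n"
    let ?F = "{y \<in> ?Y (Suc n). wtrunc (enat n) y = y1}"
    show "finite ?F \<and> card ?F \<le> p ^ m"
    proof (cases "?F = {}")
      case True
      then show ?thesis by (simp only: finite.emptyI card.empty) simp
    next
      case False
      then obtain y0 where y0: "y0 \<in> ?F" by blast
      let ?g = "\<lambda>y. wcomp (y - y0) n"
      \<comment> \<open>Component n of p^n z is the p^n-th power of the residue of z, and therefore
        the residue of U enters with exponent p^n.\<close>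
      let ?R = "{z. z ^ (p ^ m) = (wcomp U 0 ^ (p ^ n)) * z}"
      have dv: "weq (enat n) (y - y0) 0" if "y \<in> ?F" for y
        using that y0 wtrunc_eq_iff[of "enat n" y y0] weq_diff_iff by auto
      have inj: "inj_on ?g ?F"
      proof (rule inj_onI)
        fix y y' assume y: "y \<in> ?F" "y' \<in> ?F" "?g y = ?g y'"
        have "weq (enat (Suc n)) (y - y0) (y' - y0)"
          using dv[OF y(1)] dv[OF y(2)] y(3) by (auto simp: weq_def less_Suc_eq)
        then have "weq (enat (Suc n)) (y - y0 + y0) (y' - y0 + y0)" by (intro weq_add weq_refl)
        then have "wtrunc (enat (Suc n)) y = wtrunc (enat (Suc n)) y'" by (simp add: wtrunc_eq_iff)
        then show "y = y'" using y by auto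
      qed
      have img: "?g ` ?F \<subseteq> ?R"
      proof (rule image_subsetI)
        fix y assume y: "y \<in> ?F"
        have "pp ^ n dvd y - y0" using dv[OF y] by (simp add: weq_enat_iff_dvd)
        then obtain z where z: "y - y0 = pp ^ n * z" by (elim dvdE)
        have "weq (enat (Suc n)) ((wphi p ^^ m) (y - y0)) (U * y - U * y0)"
          unfolding tm.map_diff using y y0 by (intro weq_diff) auto
        moreover have "U * y - U * y0 = pp ^ n * (U * z)"
          using z by (metis mult.left_commute right_diff_distrib)
        ultimately have "wcomp ((wphi p ^^ m) (y - y0)) n = wcomp (pp ^ n * (U * z)) n"
          by (simp add: weq_def)
        then show "?g y \<in> ?R"
          by (simp add: wcomp_funpow_wphi z wcomp_p_power_mult wcomp_mult_0 power_mult_distrib)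
      qed
      have R: "finite ?R \<and> card ?R \<le> p ^ m"
        using pm by (rule card_power_eq_mult_le)
      then show ?thesis
        using card_inj_on_le[OF inj img] inj_on_finite[OF inj img] by linarith
    qed
  qed
  have "p ^ m * card (?Y n) \<le> p ^ m * p ^ (m * n)" using Suc by simp
  also have "\<dots> = p ^ (m * Suc n)" by (simp add: power_add)
  finally show ?case using step by linarith
qed

end

section \<open>Upper bound for the number of solutions modulo p^n\<close>

context cyclic_system
begin

definition plus_edges :: "int set" where
  "plus_edges = {t \<in> {0..<int m}. a t = 1}"

lemma a_cases: "a k = 0 \<or> a k = 1"
  using ab[of k] by auto

lemma a_1_imp_b_0: "a k = 1 \<Longrightarrow> b k = 0"
  using ab[of k] by auto

lemma finite_plus_edges: "finite plus_edges"
  by (rule finite_subset[of _ "{0..<int m}"]) (auto simp: plus_edges_def)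

lemma card_plus_edges: "card plus_edges = A"
proof -
  have "A = (\<Sum>i\<in>{..<m}. if a (int i) = 1 then 1 else 0)"
    unfolding A_def by (intro sum.cong refl) (use a_cases in auto)
  also have "\<dots> = card {i \<in> {..<m}. a (int i) = 1}"
    by (simp add: sum.If_cases Int_def)
  also have "\<dots> = card (int ` {i \<in> {..<m}. a (int i) = 1})"
    by (simp add: card_image)
  also have "int ` {i \<in> {..<m}. a (int i) = 1} = plus_edges"
  proof
    show "plus_edges \<subseteq> int ` {i \<in> {..<m}. a (int i) = 1}"
    proof
      fix t assume "t \<in> plus_edges"
      then show "t \<in> int ` {i \<in> {..<m}. a (int i) = 1}"
        by (intro image_eqI[of _ _ "nat t"]) (auto simp: plus_edges_def)
    qed
  qed (auto simp: plus_edges_def)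
  finally show ?thesis by simp
qed

lemma sum_a_minus_b:
  "(\<Sum>i<m. int (a (k0 + int i)) - int (b (k0 + int i))) = int A - int B"
  using walk.P_add[of k0 m] walk.P_period[of k0] by (simp add: drift_eq)

lemma solsD:
  assumes "\<alpha> \<in> sols n"
  shows "\<alpha> k \<in> wring (p ^ f)" "wtrunc n (\<alpha> k) = \<alpha> k" "\<alpha> (k + int m) = \<alpha> k" "rel n \<alpha>"
  using assms by (auto simp: sols_def)

lemma card_PiE_fixed_field:
  assumes "finite S"
  shows "finite (S \<rightarrow>\<^sub>E (fixed_field (p ^ f) :: 'k set))"
    "card (S \<rightarrow>\<^sub>E (fixed_field (p ^ f) :: 'k set)) = (p ^ f) ^ card S"
  using card_fixed_field[OF f_pos] assms by (simp_all add: finite_PiE card_PiE)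

text \<open>
  Walking backwards from a starting index, an equation with \<open>a = 1\<close> leaves only the top component
  of the preceding entry undetermined, and the other equations determine it.
\<close>

lemma sols_encode_inj:
  assumes "n \<ge> 1"
  shows "inj_on (\<lambda>\<alpha>. (\<alpha> k0, \<lambda>t\<in>plus_edges. wcomp (\<alpha> t) (n - 1))) (sols (enat n))"
proof (rule inj_onI)
  fix \<alpha> \<beta> assume \<alpha>: "\<alpha> \<in> sols (enat n)" and \<beta>: "\<beta> \<in> sols (enat n)"
    and eq: "(\<alpha> k0, \<lambda>t\<in>plus_edges. wcomp (\<alpha> t) (n - 1)) = (\<beta> k0, \<lambda>t\<in>plus_edges. wcomp (\<beta> t) (n - 1))"
  have top: "wcomp (\<alpha> k) (n - 1) = wcomp (\<beta> k) (n - 1)" if "a k = 1" for k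
  proof -
    have k: "k = k mod int m + int m * (k div int m)" by simp
    have "a (k mod int m) = 1" using that shift_period(2)[of "k mod int m" "k div int m"] by simp
    then have "k mod int m \<in> plus_edges" using m_pos by (simp add: plus_edges_def)
    moreover have "restrict (\<lambda>t. wcomp (\<alpha> t) (n - 1)) plus_edges = restrict (\<lambda>t. wcomp (\<beta> t) (n - 1)) plus_edges"
      using eq by simp
    ultimately have "wcomp (\<alpha> (k mod int m)) (n - 1) = wcomp (\<beta> (k mod int m)) (n - 1)"
      by (metis restrict_apply')
    then show ?thesis
      using sols_shift[OF \<alpha>, of "k mod int m" "k div int m"] sols_shift[OF \<beta>, of "k mod int m" "k div int m"]
      by simp
  qed
  have bwd: "\<alpha> (k0 - int j) = \<beta> (k0 - int j)" for j
  proof (induction j)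
    case 0
    then show ?case using eq by simp
  next
    case (Suc j)
    let ?k = "k0 - int (Suc j)"
    have k: "?k + 1 = k0 - int j" by simp
    have "weq (enat n) (pp ^ a ?k * \<tau> (\<alpha> ?k)) (pp ^ b ?k * (u ?k * \<alpha> (?k + 1)))"
      using solsD(4)[OF \<alpha>] by (simp only: rel_def weq_sym)
    also have "\<alpha> (?k + 1) = \<beta> (?k + 1)" using Suc k by simp
    also have "weq (enat n) (pp ^ b ?k * (u ?k * \<beta> (?k + 1))) (pp ^ a ?k * \<tau> (\<beta> ?k))"
      using solsD(4)[OF \<beta>] by (simp only: rel_def)
    finally have *: "weq (enat n) (pp ^ a ?k * \<tau> (\<alpha> ?k)) (pp ^ a ?k * \<tau> (\<beta> ?k))" .
    have "weq (enat n) (\<alpha> ?k) (\<beta> ?k)"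
    proof (cases "a ?k = 1")
      case True
      have "enat n = enat (n - 1) + enat 1" using assms by simp
      with * True have "weq (enat (n - 1)) (\<tau> (\<alpha> ?k)) (\<tau> (\<beta> ?k))"
        by (simp only: weq_p_power_mult_iff)
      then have "weq (enat (n - 1)) (\<alpha> ?k) (\<beta> ?k)" by simp
      show ?thesis
        unfolding weq_def
      proof (intro allI impI)
        fix i assume "enat i < enat n"
        then show "wcomp (\<alpha> ?k) i = wcomp (\<beta> ?k) i"
          using \<open>weq (enat (n - 1)) (\<alpha> ?k) (\<beta> ?k)\<close> top[OF True]
          by (cases "i = n - 1") (auto simp: weq_def)
      qed
    next
      case False
      then have "a ?k = 0" using a_cases by blast
      with * show ?thesis by simp
    qed
    then have "wtrunc (enat n) (\<alpha> ?k) = wtrunc (enat n) (\<beta> ?k)" by (simp only: wtrunc_eq_iff)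
    then show ?case using solsD(2)[OF \<alpha>] solsD(2)[OF \<beta>] by simp
  qed
  show "\<alpha> = \<beta>"
  proof
    fix k
    \<comment> \<open>A large multiple of the period moves the index k to the left of k0, where the
      backward induction applies.\<close>
    define q where "q = \<bar>k\<bar> + \<bar>k0\<bar>"
    have "q \<le> int m * q"
      using m_pos mult_right_mono[of 1 "int m" q] by (simp add: q_def)
    then have "0 \<le> k0 - k + int m * q" by (simp add: q_def)
    then have "k + int m * (- q) = k0 - int (nat (k0 - k + int m * q))" by simp
    then show "\<alpha> k = \<beta> k"
      using sols_shift[OF \<alpha>, of k "- q"] sols_shift[OF \<beta>, of k "- q"]
        bwd[of "nat (k0 - k + int m * q)"] by simp
  qed
qed

text \<open>The entry y at the starting index satisfies \<tau>^m(y) = p^(B-A) U y to full precision: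
  no freedom if A < B, a fixed point problem for Frobenius if A = B. The strict case holds for
  abstract \<tau> and so also serves the reversed cycle.\<close>

lemma card_sols_upper:
  assumes "n \<ge> 1" and AB: "A < B \<or> A = B \<and> \<tau> = wphi p"
  shows "finite (sols (enat n))" "card (sols (enat n)) \<le> p ^ (n * m) * (p ^ f) ^ A"
proof -
  have "walk.drift \<le> 0" using AB by (auto simp: drift_eq)
  from walk.cycle_lemma[OF this] obtain k0
    where k0: "\<And>j. (\<Sum>i<j. int (a (k0 + int i)) - int (b (k0 + int i))) \<le> 0" by blast
  define Z where "Z = (\<lambda>\<alpha>. \<alpha> k0) ` sols (enat n)"
  have Z: "weq (enat n) ((\<tau> ^^ m) y) (pp ^ (B - A) * (uprod k0 m * y))" "wtrunc (enat n) y = y"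
    if y: "y \<in> Z" for y
  proof -
    obtain \<alpha> where \<alpha>: "\<alpha> \<in> sols (enat n)" "y = \<alpha> k0" using y by (auto simp: Z_def)
    show "weq (enat n) ((\<tau> ^^ m) y) (pp ^ (B - A) * (uprod k0 m * y))"
      using rel_iterate_exact[OF solsD(4)[OF \<alpha>(1)] k0, of m] solsD(3)[OF \<alpha>(1), of k0] AB \<alpha>(2)
      by (auto simp: sum_a_minus_b nat_diff_distrib)
    show "wtrunc (enat n) y = y" using solsD(2)[OF \<alpha>(1)] \<alpha>(2) by simp
  qed
  have card_Z: "finite Z \<and> card Z \<le> p ^ (n * m)"
  proof (cases "A < B")
    case True
    have "Z \<subseteq> {0}"
    proof
      fix y assume y: "y \<in> Z"
      have "weq (enat n) y 0"
        by (rule shifted_fixpoint_eq_0[OF Z(1)[OF y]]) (use True in simp)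
      then have "y = wtrunc (enat n) 0" using Z(2)[OF y] by (metis wtrunc_eq_iff)
      also have "\<dots> = 0" by (rule witt_eqI) (simp add: wtrunc_def)
      finally show "y \<in> {0}" by simp
    qed
    then have "finite Z \<and> card Z \<le> 1"
      using card_mono[of "{0 :: 'k witt}" Z] finite_subset[of Z "{0}"] by simp
    moreover have "1 \<le> p ^ (n * m)" by (rule one_le_power) (use p_ge_2 in simp)
    ultimately show ?thesis by linarith
  next
    case False
    let ?Y = "{y :: 'k witt. wtrunc (enat n) y = y \<and> weq (enat n) ((wphi p ^^ m) y) (uprod k0 m * y)}"
    have "Z \<subseteq> ?Y" using Z AB False by auto
    moreover have "finite ?Y \<and> card ?Y \<le> p ^ (m * n)"
      by (rule semilinear_fixpoints_bound[OF m_pos])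
    ultimately show ?thesis
      using card_mono[of ?Y Z] finite_subset[of Z ?Y] by (simp add: mult.commute)
  qed
  let ?E = "\<lambda>\<alpha>. (\<alpha> k0, \<lambda>t\<in>plus_edges. wcomp (\<alpha> t) (n - 1))"
  let ?C = "Z \<times> (plus_edges \<rightarrow>\<^sub>E (fixed_field (p ^ f) :: 'k set))"
  have img: "?E ` sols (enat n) \<subseteq> ?C"
    using solsD(1) by (auto simp: Z_def wring_def)
  have fin: "finite ?C" using card_Z card_PiE_fixed_field(1)[OF finite_plus_edges] by simp
  show "finite (sols (enat n))"
    by (rule inj_on_finite[OF sols_encode_inj[OF assms(1)] img fin])
  have "card (sols (enat n)) \<le> card ?C"
    by (rule card_inj_on_le[OF sols_encode_inj[OF assms(1)] img fin])
  also have "\<dots> = card Z * (p ^ f) ^ A"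
    by (simp only: card_cartesian_product card_PiE_fixed_field(2)[OF finite_plus_edges] card_plus_edges)
  also have "\<dots> \<le> p ^ (n * m) * (p ^ f) ^ A"
    using card_Z by (intro mult_right_mono) auto
  finally show "card (sols (enat n)) \<le> p ^ (n * m) * (p ^ f) ^ A" .
qed

section \<open>Lower bound: independent families of solutions\<close>

definition teich :: "'k \<Rightarrow> 'k witt" where
  "teich y = Witt (\<lambda>i. if i = 0 then y else 0)"

text \<open>The rise of the walk over the j steps that lead to index t; the step of the equation at
  t itself is not included.\<close>

definition height :: "int \<Rightarrow> nat \<Rightarrow> int" where
  "height t j = P t - P (t - int j)"

text \<open>
  Each equation with \<open>a = 1\<close> at \<open>t\<close> is matched with the closest preceding equation with \<open>b = 1\<close> that
  brings the walk \<open>P\<close> down to the level of \<open>t\<close>. The entries strictly between these two equations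
  support a family of solutions parametrised by the residue field.
\<close>

definition seg :: "int \<Rightarrow> nat" where
  "seg t = (LEAST j. height t (Suc j) < 0)"

text \<open>The entry j places before t, freed from its power of p. The equation between
  neighbouring entries is solved backwards through \<tau>'.\<close>

fun seg_val :: "int \<Rightarrow> 'k \<Rightarrow> nat \<Rightarrow> 'k witt" where
  "seg_val t y 0 = teich y"
| "seg_val t y (Suc j) = \<tau>' (u (t - int j - 1) * seg_val t y j)"

text \<open>At t the exponent is n - 1, so only the residue y matters modulo p^n. Further back the
  exponent drops by the height, which balances the factors p^a and p^b of the equations passed on
  the way. Here j is the distance from k forward to t modulo the period.\<close>

definition seg_sol :: "nat \<Rightarrow> int \<Rightarrow> 'k \<Rightarrow> int \<Rightarrow> 'k witt" where
  "seg_sol n t y k = (let j = nat ((t - k) mod int m) in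
     if j \<le> seg t then pp ^ (n - 1 - nat (height t j)) * seg_val t y j else 0)"

lemma height_0 [simp]: "height t 0 = 0"
  by (simp add: height_def)

lemma height_Suc: "height t (Suc j) = height t j + int (a (t - int j - 1)) - int (b (t - int j - 1))"
  using P_Suc[of "t - int j - 1"] by (simp add: height_def algebra_simps)

lemma height_le: "height t j \<le> int j"
proof (induction j)
  case (Suc j)
  then show ?case using ab[of "t - int j - 1"] by (auto simp: height_Suc)
qed simp

text \<open>A whole period changes the walk by A - B <= 0, and the equation at t contributes +1 to
  it. The other m - 1 steps thus sum to a negative number, and the segment closes within one
  period.\<close>

lemma seg_le:
  assumes "A \<le> B" "a t = 1"
  shows "height t (Suc (seg t)) < 0" "Suc (seg t) < m"
proof -
  have "P (t + 1) = P t + 1" using P_Suc[of t] assms(2) a_1_imp_b_0[of t] by simp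
  moreover have "P (t + 1) = P (t - int (m - 1)) + walk.drift"
    using walk.P_period[of "t - int (m - 1)"] m_pos by (simp add: of_nat_diff algebra_simps)
  ultimately have h: "height t (m - 1) < 0"
    using assms(1) by (simp add: height_def drift_eq)
  then obtain j where j: "m - 1 = Suc j" by (cases "m - 1") auto
  show "height t (Suc (seg t)) < 0"
    unfolding seg_def by (rule LeastI[of _ j]) (use h j in simp)
  have "seg t \<le> j" unfolding seg_def by (rule Least_le) (use h j in simp)
  then show "Suc (seg t) < m" using j by simp
qed

lemma height_nonneg:
  assumes "j \<le> seg t"
  shows "height t j \<ge> 0"
proof (cases j)
  case (Suc i)
  then show ?thesis using not_less_Least[of i "\<lambda>j. height t (Suc j) < 0"] assms
    by (simp add: seg_def[symmetric])
qed simp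

lemma seg_sol_period: "seg_sol n t y (k + int m) = seg_sol n t y k"
proof -
  have "(t - (k + int m)) mod int m = (t - k) mod int m"
    by (metis diff_diff_eq minus_mod_self2)
  then show ?thesis by (simp add: seg_sol_def)
qed

lemma seg_sol_wring:
  assumes "y \<in> fixed_field (p ^ f)"
  shows "seg_sol n t y k \<in> wring (p ^ f)"
proof -
  have "teich y \<in> wring (p ^ f)"
    using assms by (simp add: teich_def wring_def fixed_field_def power_0_left)
  then have "seg_val t y j \<in> wring (p ^ f)" for j
    by (induction j) (simp_all add: wring_closed u_wring)
  then show ?thesis
    by (simp add: seg_sol_def Let_def wring_closed)
qed

lemma weq_p_power_ge_0: "n \<le> e \<Longrightarrow> weq (enat n) (pp ^ e * x) 0"
  by (simp add: weq_enat_iff_dvd dvd_mult2 le_imp_power_dvd)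

text \<open>Inside the segment the equations hold exactly by the choice of exponents and of
  \<open>seg_val\<close>; at either end a factor p meets the exponent n - 1 and gives zero modulo
  p^n; elsewhere both sides vanish.\<close>

lemma rel_seg_sol:
  assumes "A \<le> B" "a t = 1" "n \<ge> m"
  shows "rel (enat n) (seg_sol n t y)"
  unfolding rel_def
proof
  fix k
  define j where "j = nat ((t - k) mod int m)"
  have jm: "j < m" using m_pos by (simp add: j_def nat_less_iff)
  have ij: "int j = (t - k) mod int m" using m_pos by (simp add: j_def)
  have "t - k = int j + int m * ((t - k) div int m)" by (simp add: ij)
  then obtain q where k: "k = t - int j + int m * q" by (metis (no_types, opaque_lifting) add.commute diff_add_cancel diff_diff_eq2 diff_eq_eq minus_mult_right add_uminus_conv_diff)
  have per: "u k = u (t - int j)" "a k = a (t - int j)" "b k = b (t - int j)"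
    by (simp_all only: k shift_period)
  have heights: "0 \<le> height t i \<and> height t i \<le> int (n - 1)" if "i \<le> seg t" for i
    using height_nonneg[OF that] height_le[of t i] seg_le(2)[OF assms(1,2)] that assms(3) by auto
  have val_k: "seg_sol n t y k = (if j \<le> seg t then pp ^ (n - 1 - nat (height t j)) * seg_val t y j else 0)"
    by (simp add: seg_sol_def j_def Let_def)
  show "weq (enat n) (pp ^ b k * (u k * seg_sol n t y (k + 1))) (pp ^ a k * \<tau> (seg_sol n t y k))"
  proof (cases j)
    case 0
    \<comment> \<open>The index after t lies m - 1 places before the next copy of t, just outside
      the segment because \<open>Suc (seg t) < m\<close>.\<close>
    have "(t - (k + 1)) mod int m = int (m - 1) mod int m"
    proof -
      have "t - (k + 1) = int (m - 1) + int m * (- q - 1)" using k 0 m_pos by (simp add: of_nat_diff algebra_simps)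
      then show ?thesis by (metis mod_mult_self2)
    qed
    also have "\<dots> = int (m - 1)" using m_pos by (intro mod_pos_pos_trivial) auto
    finally have "nat ((t - (k + 1)) mod int m) = m - 1" by (simp only: nat_int)
    then have "seg_sol n t y (k + 1) = 0"
      using seg_le(2)[OF assms(1,2)] by (simp add: seg_sol_def Let_def)
    moreover have "a k = 1" using per 0 assms(2) by simp
    moreover have "pp * \<tau> (seg_sol n t y k) = pp ^ n * \<tau> (teich y)"
    proof -
      have "pp * \<tau> (seg_sol n t y k) = pp ^ Suc (n - 1) * \<tau> (teich y)"
        by (simp add: val_k 0 tau.map_mult mult.assoc)
      then show ?thesis using m_pos assms(3) by simp
    qed
    ultimately show ?thesis using weq_sym[OF weq_p_power_ge_0[of n n]] by simp
  next
    case (Suc i)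
    have "(t - (k + 1)) mod int m = int i mod int m"
    proof -
      have "t - (k + 1) = int i + int m * (- q)" using k Suc by (simp add: algebra_simps)
      then show ?thesis by (metis mod_mult_self2)
    qed
    then have "nat ((t - (k + 1)) mod int m) = i" using jm Suc by simp
    then have val_k1: "seg_sol n t y (k + 1) = (if i \<le> seg t then pp ^ (n - 1 - nat (height t i)) * seg_val t y i else 0)"
      by (simp add: seg_sol_def Let_def)
    have tk: "t - int j = t - int i - 1" using Suc by simp
    have hS: "height t j = height t i + int (a k) - int (b k)"
      unfolding per(2,3) tk using height_Suc[of t i] Suc by (simp only:)
    have uk: "u k = u (t - int i - 1)" unfolding per(1) tk ..
    show ?thesis
    proof (cases "j \<le> seg t")
      case True
      then have i: "i \<le> seg t" using Suc by simp
      \<comment> \<open>Heights on the segment lie between 0 and n - 1, so the subtraction of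
        natural numbers is a true one.\<close>
      have e: "b k + (n - 1 - nat (height t i)) = a k + (n - 1 - nat (height t j))"
        using hS heights[OF i] heights[OF True] by linarith
      have "pp ^ b k * (u k * seg_sol n t y (k + 1)) = pp ^ (b k + (n - 1 - nat (height t i))) * (u k * seg_val t y i)"
        using i by (simp add: val_k1 power_add mult_ac)
      also have "\<dots> = pp ^ (a k + (n - 1 - nat (height t j))) * (u k * seg_val t y i)"
        by (simp only: e)
      also have "\<dots> = pp ^ a k * \<tau> (seg_sol n t y k)"
        using True Suc by (simp add: uk val_k tau.map_mult power_add mult_ac)
      finally show ?thesis by simp
    next
      case False
      then have z: "seg_sol n t y k = 0" by (simp add: val_k)
      show ?thesis
      proof (cases "i = seg t")
        case True
        then have "height t j < 0" using seg_le(1)[OF assms(1,2)] Suc by simp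
        \<comment> \<open>The height passes from nonnegative to negative in a single step, so it was
          0 and the step is one with b = 1.\<close>
        then have h: "height t i = 0" "b k = 1"
          using hS heights[of i] True ab[of k] by auto
        have "pp ^ b k * (u k * seg_sol n t y (k + 1)) = pp ^ Suc (n - 1) * (u k * seg_val t y i)"
          using h True by (simp add: val_k1 mult_ac)
        moreover have "Suc (n - 1) = n" using m_pos assms(3) by simp
        ultimately show ?thesis
          using weq_p_power_ge_0[of n n "u k * seg_val t y i"] by (simp add: z tau.map_0)
      next
        case False
        then have "\<not> i \<le> seg t" using \<open>\<not> j \<le> seg t\<close> Suc by simp
        then show ?thesis by (simp add: val_k1 z tau.map_0)
      qed
    qed
  qed
qed

text \<open>Segments nest like matched parentheses. Seen from t', the walk gains at least one unit
  before it reaches t going backwards, so seen from t it falls below zero no later than the end of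
  the segment of t'.\<close>

lemma seg_nested:
  assumes "A \<le> B" "t \<in> plus_edges" "t' \<in> plus_edges" "t \<noteq> t'" "nat ((t' - t) mod int m) \<le> seg t'"
  shows "seg t < seg t'"
proof -
  define j where "j = nat ((t' - t) mod int m)"
  have at: "a t = 1" "a t' = 1" and tt: "0 \<le> t" "t < int m" "0 \<le> t'" "t' < int m"
    using assms(2,3) by (auto simp: plus_edges_def)
  have ij: "int j = (t' - t) mod int m" using m_pos by (simp add: j_def)
  have j: "j \<ge> 1"
  proof (rule ccontr)
    assume "\<not> j \<ge> 1"
    then have "(t' - t) mod int m = 0" using ij by simp
    then have "t' mod int m = t mod int m" by (metis mod_eq_dvd_iff mod_0_imp_dvd)
    then show False using tt assms(4) by simp
  qed
  have "t' - t = int j + int m * ((t' - t) div int m)" by (simp add: ij)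
  then obtain q where q: "t' - int j = t + int m * q"
    by (metis add.commute add_diff_cancel_left' diff_add_cancel diff_diff_eq)
  have jle: "j \<le> seg t'" using assms(5) by (simp add: j_def)
  obtain i where i: "j = Suc i" using j by (cases j) auto
  have "a (t' - int j) = 1" using at(1) by (simp only: q shift_period)
  then have hj: "height t' j = height t' i + 1"
    using height_Suc[of t' i] i a_1_imp_b_0[of "t' - int j"] by (simp add: algebra_simps)
  have "height t' i \<ge> 0" using height_nonneg[of i t'] jle i by simp
  have hdiff: "height t l = height t' (j + l) - height t' j" for l
  proof -
    have e: "t' - int (j + l) = t - int l + int m * q" using q by simp
    show ?thesis
      unfolding height_def e q by (simp only: walk.P_shift)
  qed
  have "height t (Suc (seg t' - j)) = height t' (Suc (seg t')) - height t' j"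
    using hdiff[of "Suc (seg t' - j)"] jle by simp
  also have "\<dots> < 0"
    using seg_le(1)[OF assms(1) at(2)] hj \<open>height t' i \<ge> 0\<close> by linarith
  finally have "seg t \<le> seg t' - j" unfolding seg_def[of t] by (rule Least_le)
  then show ?thesis using j jle by simp
qed

text \<open>The families are superposed. If two parameter vectors differ, let t be a place of
  difference with the longest segment. By nesting, no other differing family has a segment covering
  t, so the entry at t recovers the parameter of t.\<close>

lemma card_sols_lower:
  assumes "A \<le> B" "n \<ge> m" "finite (sols (enat n))"
  shows "(p ^ f) ^ A \<le> card (sols (enat n))"
proof -
  let ?F = "plus_edges \<rightarrow>\<^sub>E (fixed_field (p ^ f) :: 'k set)"
  define S where "S y k = (\<Sum>t\<in>plus_edges. seg_sol n t (y t) k)" for y k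
  define \<Phi> where "\<Phi> y = (\<lambda>k. wtrunc (enat n) (S y k))" for y
  have a1: "a t = 1" if "t \<in> plus_edges" for t using that by (simp add: plus_edges_def)
  have "\<Phi> y \<in> sols (enat n)" if y: "y \<in> ?F" for y
  proof -
    have w: "S y k \<in> wring (p ^ f)" for k
      unfolding S_def by (intro wring_sum seg_sol_wring) (use y in auto)
    have "weq (enat n) (pp ^ b k * (u k * S y (k + 1))) (pp ^ a k * \<tau> (S y k))" for k
      unfolding S_def tau.map_sum sum_distrib_left
      by (intro weq_sum) (use rel_seg_sol[OF assms(1) a1 assms(2)] in \<open>simp add: rel_def\<close>)
    moreover have "weq (enat n) (pp ^ b k * (u k * \<Phi> y (k + 1))) (pp ^ b k * (u k * S y (k + 1)))"
      "weq (enat n) (pp ^ a k * \<tau> (S y k)) (pp ^ a k * \<tau> (\<Phi> y k))" for k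
      by (rule weq_mult[OF weq_refl], (rule weq_mult[OF weq_refl])?, simp add: \<Phi>_def weq_sym)+
    ultimately have "rel (enat n) (\<Phi> y)"
      unfolding rel_def using weq_trans by meson
    moreover have "S y (k + int m) = S y k" for k by (simp add: S_def seg_sol_period)
    ultimately show ?thesis
      using w by (simp add: sols_def \<Phi>_def wring_wtrunc wtrunc_eq_iff)
  qed
  moreover have "inj_on \<Phi> ?F"
  proof (rule inj_onI, rule ccontr)
    fix y y' assume y: "y \<in> ?F" "y' \<in> ?F" and eq: "\<Phi> y = \<Phi> y'" and ne: "y \<noteq> y'"
    let ?D = "{t \<in> plus_edges. y t \<noteq> y' t}"
    have "?D \<noteq> {}" using y ne by (auto intro: PiE_ext)
    then have "Max (seg ` ?D) \<in> seg ` ?D" using finite_plus_edges by (intro Max_in) auto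
    then obtain t where t': "Max (seg ` ?D) = seg t" "t \<in> ?D" by (rule imageE)
    then have t: "t \<in> ?D" "\<And>t'. t' \<in> ?D \<Longrightarrow> seg t' \<le> seg t"
      using finite_plus_edges by (simp_all flip: t'(1))
    have same: "seg_sol n t' (y t') t = seg_sol n t' (y' t') t" if t': "t' \<in> plus_edges - {t}" for t'
    proof (cases "y t' = y' t'")
      case False
      then have "\<not> seg t < seg t'" using t(2)[of t'] t' by (simp add: not_less)
      then have "\<not> nat ((t' - t) mod int m) \<le> seg t'"
        using seg_nested[OF assms(1), of t t'] t(1) t' by auto
      then show ?thesis by (simp add: seg_sol_def Let_def)
    qed simp
    define c where "c = (\<Sum>t'\<in>plus_edges - {t}. seg_sol n t' (y' t') t)"
    have c_same: "c = (\<Sum>t'\<in>plus_edges - {t}. seg_sol n t' (y t') t)"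
      unfolding c_def by (intro sum.cong refl same[symmetric])
    have "S y t = seg_sol n t (y t) t + c"
      unfolding S_def c_same by (rule sum.remove) (use t(1) finite_plus_edges in auto)
    moreover have "S y' t = seg_sol n t (y' t) t + c"
      unfolding S_def c_def by (rule sum.remove) (use t(1) finite_plus_edges in auto)
    moreover have "weq (enat n) (S y t) (S y' t)"
      using fun_cong[OF eq, of t] by (simp add: \<Phi>_def wtrunc_eq_iff)
    ultimately have "weq (enat n) (seg_sol n t (y t) t) (seg_sol n t (y' t) t)"
      using weq_diff[OF _ weq_refl[of "enat n" c], of "S y t" "S y' t"] by simp
    \<comment> \<open>Index t is position 0 of its own segment, with height 0, so the parameter sits
      in component n - 1.\<close>
    then have "weq (enat n) (pp ^ (n - 1) * teich (y t)) (pp ^ (n - 1) * teich (y' t))"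
      by (simp add: seg_sol_def Let_def)
    then have "wcomp (pp ^ (n - 1) * teich (y t)) (n - 1) = wcomp (pp ^ (n - 1) * teich (y' t)) (n - 1)"
      using m_pos assms(2) by (simp add: weq_def)
    then have "y t = y' t" by (simp add: wcomp_p_power_mult teich_def)
    then show False using t(1) by simp
  qed
  ultimately have "card ?F \<le> card (sols (enat n))"
    using assms(3) by (intro card_inj_on_le[of \<Phi>]) auto
  then show ?thesis
    by (simp only: card_PiE_fixed_field(2)[OF finite_plus_edges] card_plus_edges)
qed

text \<open>Reversing the cycle replaces \<open>\<tau>\<close> by its inverse and exchanges the roles of \<open>a\<close> and \<open>b\<close>.\<close>

lemma reversed_system:
  "\<exists>v. cyclic_system p f m \<tau>' \<tau> v (\<lambda>k. b (- k - 1)) (\<lambda>k. a (- k - 1)) \<and>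
    (\<forall>n. card (cyclic_system.sols p f m \<tau>' v (\<lambda>k. b (- k - 1)) (\<lambda>k. a (- k - 1)) n) = card (sols n)) \<and>
    (\<forall>n. finite (cyclic_system.sols p f m \<tau>' v (\<lambda>k. b (- k - 1)) (\<lambda>k. a (- k - 1)) n) = finite (sols n))"
proof -
  have tau'_0: "wcomp (\<tau>' x) 0 = 0 \<longleftrightarrow> wcomp x 0 = 0" for x
    using wcomp_0_tau_eq_0[of "\<tau>' x"] by simp
  \<comment> \<open>Applying \<tau>' to an equation and dividing by \<tau>'(u) solves it in the
    opposite direction; the new unit is the inverse of \<tau>'(u). Its uniqueness makes the chosen
    family periodic.\<close>
  have "\<exists>v. \<tau>' (u k) * v = 1" for k
    by (simp add: witt_unit_iff tau'_0 u_unit)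
  then obtain v0 where v0: "\<And>k. \<tau>' (u k) * v0 k = 1" by metis
  have v0_unique: "v0 k = v0 l" if "u k = u l" for k l
  proof -
    have "v0 k = v0 k * (\<tau>' (u l) * v0 l)" using v0[of l] by simp
    also have "\<dots> = (\<tau>' (u k) * v0 k) * v0 l" using that by (simp add: mult_ac)
    finally show ?thesis using v0[of k] by simp
  qed
  \<comment> \<open>The equation at k links the entries at k and k + 1; after reflection of the
    indices it is the equation at -k - 1.\<close>
  define v where "v k = v0 (- k - 1)" for k
  have neg: "- (k + int m) - 1 = (- k - 1) + int m * (- 1)" for k by simp
  have v: "cyclic_system p f m \<tau>' \<tau> v (\<lambda>k. b (- k - 1)) (\<lambda>k. a (- k - 1))"
  proof (unfold_locales, goal_cases)
    case (7 k)
    have "\<tau>' (u (- k - 1)) * v k = 1" using v0 by (simp add: v_def)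
    then have "wcomp (\<tau>' (u (- k - 1))) 0 * wcomp (v k) 0 = 1"
      by (simp add: wcomp_1 flip: wcomp_mult_0)
    then show ?case by auto
  next
    case (8 k)
    have "\<tau>' (u (- k - 1)) * v k = 1" using v0 by (simp add: v_def)
    then show ?case by (rule wring_inverse[rotated]) (simp add: u_wring)
  next
    case (9 k)
    show ?case unfolding v_def by (rule v0_unique) (simp only: neg shift_period)
  next
    case (12 k)
    then show ?case using ab[of "- k - 1"] by auto
  qed (use f_pos m_pos tau'.map_add tau'.map_mult tau'.map_1 tau.map_add tau.map_mult tau.map_1 in
      \<open>simp_all only: neg shift_period tau_tau' tau'_tau weq_tau' wring_tau'\<close>)
  interpret R: cyclic_system p ty f m \<tau>' \<tau> v "\<lambda>k. b (- k - 1)" "\<lambda>k. a (- k - 1)" by (rule v)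
  have rel_rev: "R.rel n (\<lambda>k. \<alpha> (- k)) \<longleftrightarrow> rel n \<alpha>" for n \<alpha>
  proof -
    have "weq n (pp ^ a (- k - 1) * (v k * \<alpha> (- (k + 1)))) (pp ^ b (- k - 1) * \<tau>' (\<alpha> (- k)))
        \<longleftrightarrow> weq n (pp ^ b (- k - 1) * (u (- k - 1) * \<alpha> ((- k - 1) + 1))) (pp ^ a (- k - 1) * \<tau> (\<alpha> (- k - 1)))"
      (is "?L \<longleftrightarrow> ?R") for k
    proof -
      let ?l = "- k - 1"
      have l: "- (k + 1) = ?l" "?l + 1 = - k" by simp_all
      have vu: "\<tau>' (u ?l) * v k = 1" using v0 by (simp add: v_def)
      have cancel: "weq n (v k * x) (v k * y) \<longleftrightarrow> weq n x y" for x y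
      proof
        assume "weq n (v k * x) (v k * y)"
        from weq_mult[OF weq_refl[of n "\<tau>' (u ?l)"] this] show "weq n x y"
          using vu by (simp flip: mult.assoc)
      qed (rule weq_mult[OF weq_refl])
      have tau'_pp: "\<tau>' (pp ^ j) = pp ^ j" for j
        by (simp add: tau'.map_power tau'.map_of_nat)
      have "?R \<longleftrightarrow> weq n (\<tau>' (pp ^ b ?l * (u ?l * \<alpha> (- k)))) (\<tau>' (pp ^ a ?l * \<tau> (\<alpha> ?l)))"
        unfolding l weq_tau' ..
      also have "\<dots> \<longleftrightarrow> weq n (v k * (\<tau>' (u ?l) * (pp ^ b ?l * \<tau>' (\<alpha> (- k))))) (v k * (pp ^ a ?l * \<alpha> ?l))"
        unfolding cancel by (simp add: tau'.map_mult tau'_pp mult_ac)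
      also have "v k * (\<tau>' (u ?l) * (pp ^ b ?l * \<tau>' (\<alpha> (- k)))) = pp ^ b ?l * \<tau>' (\<alpha> (- k))"
      proof -
        have "v k * (\<tau>' (u ?l) * x) = (\<tau>' (u ?l) * v k) * x" for x by (simp add: mult_ac)
        then show ?thesis by (simp add: vu)
      qed
      also have "weq n (pp ^ b ?l * \<tau>' (\<alpha> (- k))) (v k * (pp ^ a ?l * \<alpha> ?l)) \<longleftrightarrow> ?L"
        unfolding l mult.left_commute[of "v k"] using weq_sym[of n] by blast
      finally show ?thesis ..
    qed
    then have "R.rel n (\<lambda>k. \<alpha> (- k)) \<longleftrightarrow>
        (\<forall>k. weq n (pp ^ b (- k - 1) * (u (- k - 1) * \<alpha> ((- k - 1) + 1))) (pp ^ a (- k - 1) * \<tau> (\<alpha> (- k - 1))))"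
      unfolding R.rel_def by blast
    also have "\<dots> \<longleftrightarrow> rel n \<alpha>"
    proof
      assume *: "\<forall>k. weq n (pp ^ b (- k - 1) * (u (- k - 1) * \<alpha> ((- k - 1) + 1))) (pp ^ a (- k - 1) * \<tau> (\<alpha> (- k - 1)))"
      show "rel n \<alpha>"
        unfolding rel_def
      proof
        fix k
        show "weq n (pp ^ b k * (u k * \<alpha> (k + 1))) (pp ^ a k * \<tau> (\<alpha> k))"
          using *[rule_format, of "- k - 1"] by simp
      qed
    qed (unfold rel_def, blast)
    finally show ?thesis .
  qed
  have per_rev: "(\<forall>k. \<alpha> (- (k + int m)) = \<alpha> (- k)) \<longleftrightarrow> (\<forall>k. \<alpha> (k + int m) = \<alpha> k)" for \<alpha> :: "int \<Rightarrow> 'k witt"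
  proof
    assume *: "\<forall>k. \<alpha> (- (k + int m)) = \<alpha> (- k)"
    show "\<forall>k. \<alpha> (k + int m) = \<alpha> k"
    proof
      fix k show "\<alpha> (k + int m) = \<alpha> k" using *[rule_format, of "- k - int m"] by (simp add: add.commute)
    qed
  next
    assume *: "\<forall>k. \<alpha> (k + int m) = \<alpha> k"
    show "\<forall>k. \<alpha> (- (k + int m)) = \<alpha> (- k)"
    proof
      fix k show "\<alpha> (- (k + int m)) = \<alpha> (- k)" using *[rule_format, of "- (k + int m)"] by simp
    qed
  qed
  have all_neg: "(\<forall>k::int. Q (- k)) \<longleftrightarrow> (\<forall>k. Q k)" for Q
  proof
    assume *: "\<forall>k. Q (- k)"
    show "\<forall>k. Q k"
    proof
      fix k show "Q k" using *[rule_format, of "- k"] by simp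
    qed
  qed simp
  have sols_rev: "(\<lambda>k. \<alpha> (- k)) \<in> R.sols n \<longleftrightarrow> \<alpha> \<in> sols n" for n \<alpha>
    unfolding R.sols_def sols_def mem_Collect_eq rel_rev per_rev
    using all_neg[of "\<lambda>k. \<alpha> k \<in> wring (p ^ f)"] all_neg[of "\<lambda>k. wtrunc n (\<alpha> k) = \<alpha> k"] by simp
  have bij: "bij_betw (\<lambda>\<alpha> k. \<alpha> (- k)) (sols n) (R.sols n)" for n
  proof (rule bij_betw_byWitness[of _ "\<lambda>\<alpha> k. \<alpha> (- k)"])
    show "(\<lambda>\<alpha> k. \<alpha> (- k)) ` R.sols n \<subseteq> sols n"
    proof (rule image_subsetI)
      fix \<alpha> assume "\<alpha> \<in> R.sols n"
      then show "(\<lambda>k. \<alpha> (- k)) \<in> sols n" using sols_rev[of "\<lambda>k. \<alpha> (- k)" n] by simp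
    qed
  qed (use sols_rev in auto)
  have "card (R.sols n) = card (sols n)" "finite (R.sols n) = finite (sols n)" for n
    using bij_betw_same_card[OF bij[of n]] bij_betw_finite[OF bij[of n]] by simp_all
  then show ?thesis by (intro exI[of _ v] conjI allI v)
qed

lemma sum_reverse_period:
  fixes g :: "int \<Rightarrow> nat"
  assumes "\<And>k. g (k + int m) = g k"
  shows "(\<Sum>i<m. g (- int i - 1)) = (\<Sum>i<m. g (int i))"
proof -
  have "(\<Sum>i<m. g (- int i - 1)) = (\<Sum>i<m. g (int (m - Suc i)))"
  proof (intro sum.cong refl)
    fix i assume "i \<in> {..<m}"
    then have "int (m - Suc i) = (- int i - 1) + int m" by (simp add: of_nat_diff)
    then show "g (- int i - 1) = g (int (m - Suc i))" by (simp only: assms)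
  qed
  then show ?thesis by (simp only: sum.nat_diff_reindex[of "\<lambda>i. g (int i)"])
qed

text \<open>Reversal is used only for A > B. The reversed cycle then falls under the strict case,
  and no fixed points of the inverse Frobenius have to be counted.\<close>

theorem card_sols_bounds:
  assumes "\<tau> = wphi p" "n \<ge> m"
  shows "finite (sols (enat n))" "(p ^ f) ^ min A B \<le> card (sols (enat n))"
    "card (sols (enat n)) \<le> p ^ (n * m) * (p ^ f) ^ min A B"
proof -
  have n: "n \<ge> 1" using assms(2) m_pos by simp
  have "finite (sols (enat n)) \<and> (p ^ f) ^ min A B \<le> card (sols (enat n))
    \<and> card (sols (enat n)) \<le> p ^ (n * m) * (p ^ f) ^ min A B"
  proof (cases "A \<le> B")
    case True
    then have "A < B \<or> A = B \<and> \<tau> = wphi p" using assms(1) by auto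
    from card_sols_upper[OF n this] card_sols_lower[OF True assms(2)] True show ?thesis
      by simp
  next
    case False
    obtain v where v: "cyclic_system p f m \<tau>' \<tau> v (\<lambda>k. b (- k - 1)) (\<lambda>k. a (- k - 1))"
      "\<And>n. card (cyclic_system.sols p f m \<tau>' v (\<lambda>k. b (- k - 1)) (\<lambda>k. a (- k - 1)) n) = card (sols n)"
      "\<And>n. finite (cyclic_system.sols p f m \<tau>' v (\<lambda>k. b (- k - 1)) (\<lambda>k. a (- k - 1)) n) = finite (sols n)"
      using reversed_system by blast
    interpret R: cyclic_system p ty f m \<tau>' \<tau> v "\<lambda>k. b (- k - 1)" "\<lambda>k. a (- k - 1)" by (rule v(1))
    have AB: "R.A = B" "R.B = A"
      unfolding R.A_def R.B_def A_def B_def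
      by (rule sum_reverse_period, rule a_period b_period)+
    then have "R.A < R.B" "R.A \<le> R.B" using False by simp_all
    with R.card_sols_upper[OF n] R.card_sols_lower[OF _ assms(2)] AB False v(2,3) show ?thesis
      by simp
  qed
  then show "finite (sols (enat n))" "(p ^ f) ^ min A B \<le> card (sols (enat n))"
    "card (sols (enat n)) \<le> p ^ (n * m) * (p ^ f) ^ min A B"
    by simp_all
qed

section \<open>Exact solutions and their reduction modulo p\<close>

lemma rel_diff:
  assumes "rel n \<alpha>" "rel n \<beta>"
  shows "rel n (\<lambda>k. \<alpha> k - \<beta> k)"
  unfolding rel_def
proof
  fix k
  show "weq n (pp ^ b k * (u k * (\<alpha> (k + 1) - \<beta> (k + 1)))) (pp ^ a k * \<tau> (\<alpha> k - \<beta> k))"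
    using weq_diff[OF assms[unfolded rel_def, rule_format, of k]]
    by (simp add: right_diff_distrib tau.map_diff)
qed

text \<open>If A and B differ, going once around makes every entry divisible by all powers of p, so
  only the zero solution exists. If they are equal, a suitable entry satisfies a polynomial equation
  modulo p, and its residue controls whether the residues of all the others vanish.\<close>

lemma exact_wcomp_0_eq_0:
  assumes "\<tau> = wphi p"
  obtains k0 where
    "\<And>\<alpha>. \<alpha> \<in> sols \<infinity> \<Longrightarrow> wcomp (\<alpha> k0) 0 ^ (p ^ m) = wcomp (uprod k0 m) 0 * wcomp (\<alpha> k0) 0"
    "\<And>\<alpha> k. \<alpha> \<in> sols \<infinity> \<Longrightarrow> wcomp (\<alpha> k0) 0 = 0 \<Longrightarrow> wcomp (\<alpha> k) 0 = 0"
proof -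
  have sumA: "(\<Sum>i<m. a (k + int i)) = A" and sumB: "(\<Sum>i<m. b (k + int i)) = B" for k
  proof -
    have "(\<Sum>i<m. g (k + int i)) = (\<Sum>i<m. g (int i))" if "\<And>k. g (k + int m) = g k" for g :: "int \<Rightarrow> nat"
    proof (induction k rule: int_induct[where k=0])
      case (step1 k)
      have "(\<Sum>i<Suc m. g (k + int i)) = g k + (\<Sum>i<m. g (k + 1 + int i))"
        by (subst sum.lessThan_Suc_shift) (simp add: add_ac)
      then show ?case using step1 that[of k] by simp
    next
      case (step2 k)
      have "(\<Sum>i<Suc m. g (k - 1 + int i)) = g (k - 1) + (\<Sum>i<m. g (k + int i))"
        by (subst sum.lessThan_Suc_shift) (simp add: add_ac)
      then show ?case using step2 that[of "k - 1"] by simp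
    qed simp
    then show "(\<Sum>i<m. a (k + int i)) = A" "(\<Sum>i<m. b (k + int i)) = B"
      unfolding A_def B_def by (simp_all add: a_period b_period)
  qed
  have cyc: "pp ^ B * (uprod k m * \<alpha> k) = pp ^ A * (\<tau> ^^ m) (\<alpha> k)" if "\<alpha> \<in> sols \<infinity>" for \<alpha> k
    using rel_iterate[OF solsD(4)[OF that], of k m] solsD(3)[OF that, of k] by (simp add: sumA sumB)
  show ?thesis
  proof (cases "A = B")
    case True
    have "int_walk (\<lambda>k. int (b k) - int (a k)) (\<lambda>k. - P k) m"
      by standard (use m_pos P_Suc a_period b_period in auto)
    then interpret Q: int_walk "\<lambda>k. int (b k) - int (a k)" "\<lambda>k. - P k" m .
    have "Q.drift \<le> 0" using True by (simp add: Q.drift_def sum_subtractf A_def B_def flip: of_nat_sum)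
    \<comment> \<open>The opposite choice to the upper bound: from k0 on the walk P never falls
      below its starting level. After exact cancellation each later entry is, up to a unit, a
      Frobenius power of the entry at k0 times a nonnegative power of p.\<close>
    from Q.cycle_lemma[OF this] obtain k0
      where k0: "\<And>j. (\<Sum>i<j. int (b (k0 + int i)) - int (a (k0 + int i))) \<le> 0" by blast
    show ?thesis
    proof (rule that[of k0])
      fix \<alpha> assume \<alpha>: "\<alpha> \<in> sols \<infinity>"
      have "uprod k0 m * \<alpha> k0 = (\<tau> ^^ m) (\<alpha> k0)" using cyc[OF \<alpha>, of k0] True by simp
      then show "wcomp (\<alpha> k0) 0 ^ (p ^ m) = wcomp (uprod k0 m) 0 * wcomp (\<alpha> k0) 0"
        by (metis assms wcomp_funpow_wphi wcomp_mult_0)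
    next
      fix \<alpha> k assume \<alpha>: "\<alpha> \<in> sols \<infinity>" and z: "wcomp (\<alpha> k0) 0 = 0"
      have *: "wcomp (\<alpha> (k0 + int j)) 0 = 0" for j
      proof -
        let ?B = "\<Sum>i<j. b (k0 + int i)" and ?A = "\<Sum>i<j. a (k0 + int i)"
        have "int ?B \<le> int ?A" using k0[of j] by (simp add: sum_subtractf)
        then have le: "?B \<le> ?A" by linarith
        have "pp ^ ?B * (uprod k0 j * \<alpha> (k0 + int j)) = pp ^ ?B * (pp ^ (?A - ?B) * (\<tau> ^^ j) (\<alpha> k0))"
          using rel_iterate[OF solsD(4)[OF \<alpha>], of k0 j] le
          by (simp flip: mult.assoc power_add)
        then have "uprod k0 j * \<alpha> (k0 + int j) = pp ^ (?A - ?B) * (\<tau> ^^ j) (\<alpha> k0)"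
          by (simp only: p_power_mult_cancel)
        then have "wcomp (uprod k0 j) 0 * wcomp (\<alpha> (k0 + int j)) 0
            = wcomp (pp ^ (?A - ?B)) 0 * wcomp (\<alpha> k0) 0 ^ (p ^ j)"
          by (metis assms wcomp_funpow_wphi wcomp_mult_0)
        then show ?thesis using uprod_unit[of k0 j] z by (simp add: power_0_left)
      qed
      define q where "q = \<bar>k\<bar> + \<bar>k0\<bar>"
      have "q \<le> int m * q"
        using m_pos mult_right_mono[of 1 "int m" q] by (simp add: q_def)
      then have "0 \<le> k - k0 + int m * q" by (simp add: q_def)
      then have "k + int m * q = k0 + int (nat (k - k0 + int m * q))" by simp
      then show "wcomp (\<alpha> k) 0 = 0" using * sols_shift[OF \<alpha>, of k q] by metis
    qed
  next
    case False
    have zero: "\<alpha> k = 0" if \<alpha>: "\<alpha> \<in> sols \<infinity>" for \<alpha> k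
    proof -
      have "weq (enat n) (\<alpha> k) 0" for n
      proof (cases "A < B")
        case True
        have "pp ^ A * (pp ^ (B - A) * (uprod k m * \<alpha> k)) = pp ^ A * (\<tau> ^^ m) (\<alpha> k)"
          using cyc[OF \<alpha>, of k] True by (simp flip: mult.assoc power_add)
        then have "(\<tau> ^^ m) (\<alpha> k) = pp ^ (B - A) * (uprod k m * \<alpha> k)"
          by (simp only: p_power_mult_cancel)
        then show ?thesis using True by (intro shifted_fixpoint_eq_0[of n m _ "B - A" k m]) simp_all
      next
        case nless: False
        have "pp ^ B * (uprod k m * \<alpha> k) = pp ^ B * (pp ^ (A - B) * (\<tau> ^^ m) (\<alpha> k))"
          using cyc[OF \<alpha>, of k] nless by (simp flip: mult.assoc power_add)
        \<comment> \<open>Now the power of p stands on the Frobenius side; since the other factor is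
          a unit, divisibility of the entry still improves by one digit.\<close>
        then have e: "uprod k m * \<alpha> k = pp ^ (A - B) * (\<tau> ^^ m) (\<alpha> k)"
          by (simp only: p_power_mult_cancel)
        show ?thesis
        proof (induction n)
          case (Suc n)
          then have "weq (enat n) ((\<tau> ^^ m) (\<alpha> k)) ((\<tau> ^^ m) 0)" by (simp only: weq_tau_funpow)
          then have "pp ^ n dvd (\<tau> ^^ m) (\<alpha> k)" by (simp add: weq_enat_iff_dvd)
          then have "pp * pp ^ n dvd pp ^ (A - B) * (\<tau> ^^ m) (\<alpha> k)"
            using nless False by (intro mult_dvd_mono) (auto intro: dvd_power)
          then have "weq (enat (Suc n)) (uprod k m * \<alpha> k) 0" by (simp add: weq_enat_iff_dvd e)
          then show ?case by (simp only: uprod_mult_eq_0_mod)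
        qed (simp add: weq_def zero_enat_def[symmetric])
      qed
      then have "weq \<infinity> (\<alpha> k) 0" unfolding weq_def by (metis enat_ord_simps(2) lessI)
      then show ?thesis by simp
    qed
    show ?thesis
      by (rule that[of 0]) (simp_all add: zero power_0_left)
  qed
qed

text \<open>One solution is chosen for each residue that occurs at k0. A solution with the same
  residue differs from it by a solution divisible by p, and the factor p can be cancelled from the
  equations.\<close>

theorem exact_sols_mod_p:
  assumes "\<tau> = wphi p"
  obtains C where "C \<subseteq> sols \<infinity>" "finite C" "card C \<le> p ^ m"
    "\<And>\<alpha>. \<alpha> \<in> sols \<infinity> \<Longrightarrow> \<exists>\<beta>\<in>C. \<exists>\<gamma>\<in>sols \<infinity>. \<forall>k. \<alpha> k = \<beta> k + pp * \<gamma> k"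
proof -
  obtain k0 where fixp: "\<And>\<alpha>. \<alpha> \<in> sols \<infinity> \<Longrightarrow> wcomp (\<alpha> k0) 0 ^ (p ^ m) = wcomp (uprod k0 m) 0 * wcomp (\<alpha> k0) 0"
    and zero: "\<And>\<alpha> k. \<alpha> \<in> sols \<infinity> \<Longrightarrow> wcomp (\<alpha> k0) 0 = 0 \<Longrightarrow> wcomp (\<alpha> k) 0 = 0"
    using exact_wcomp_0_eq_0[OF assms] by blast
  let ?g = "\<lambda>\<alpha>. wcomp (\<alpha> k0) 0"
  let ?Z = "{z. z ^ (p ^ m) = wcomp (uprod k0 m) 0 * z}"
  have "p ^ m \<ge> 2" using self_le_power[of p m] p_ge_2 m_pos by simp
  then have Z: "finite ?Z \<and> card ?Z \<le> p ^ m" by (rule card_power_eq_mult_le)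
  have sub: "?g ` sols \<infinity> \<subseteq> ?Z" using fixp by auto
  define r where "r z = (SOME \<alpha>. \<alpha> \<in> sols \<infinity> \<and> ?g \<alpha> = z)" for z
  have r: "r z \<in> sols \<infinity> \<and> ?g (r z) = z" if z: "z \<in> ?g ` sols \<infinity>" for z
    unfolding r_def by (rule someI_ex[of "\<lambda>\<alpha>. \<alpha> \<in> sols \<infinity> \<and> ?g \<alpha> = z"]) (use z in auto)
  show ?thesis
  proof (rule that[of "r ` ?g ` sols \<infinity>"])
    show "r ` ?g ` sols \<infinity> \<subseteq> sols \<infinity>" using r by auto
    have fin: "finite (?g ` sols \<infinity>)" using sub Z finite_subset by blast
    then show "finite (r ` ?g ` sols \<infinity>)" by simp
    have "card (r ` ?g ` sols \<infinity>) \<le> card (?g ` sols \<infinity>)" by (rule card_image_le[OF fin])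
    also have "\<dots> \<le> card ?Z" using Z sub by (intro card_mono) auto
    finally show "card (r ` ?g ` sols \<infinity>) \<le> p ^ m" using Z by simp
    fix \<alpha> assume \<alpha>: "\<alpha> \<in> sols \<infinity>"
    let ?\<beta> = "r (?g \<alpha>)"
    have \<beta>: "?\<beta> \<in> sols \<infinity>" "?g ?\<beta> = ?g \<alpha>" using r[of "?g \<alpha>"] \<alpha> by auto
    define \<delta> where "\<delta> k = \<alpha> k - ?\<beta> k" for k
    have wt: "wtrunc \<infinity> x = x" for x :: "'k witt" by (rule witt_eqI) (simp add: wtrunc_def)
    have \<delta>: "\<delta> \<in> sols \<infinity>"
      using solsD[OF \<alpha>] solsD[OF \<beta>(1)] rel_diff[of \<infinity> \<alpha> ?\<beta>]
      by (simp add: sols_def \<delta>_def[abs_def] wring_closed wt)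
    have "wcomp (\<delta> k0) 0 = 0"
      using comm_ring_map.map_diff[OF comm_ring_map_wcomp_0, of "\<alpha> k0" "?\<beta> k0"] \<beta>(2) by (simp add: \<delta>_def)
    then have "weq (enat 1) (\<delta> k) 0" for k
      using zero[OF \<delta>, of k] by (auto simp: weq_def)
    then have "\<exists>y. y \<in> wring (p ^ f) \<and> \<delta> k = pp * y" for k
      using wring_p_multE[of "\<delta> k" f 1] solsD(1)[OF \<delta>, of k] by (metis power_one_right)
    then obtain \<gamma> where \<gamma>: "\<And>k. \<gamma> k \<in> wring (p ^ f)" "\<And>k. \<delta> k = pp * \<gamma> k" by metis
    have "\<gamma> (k + int m) = \<gamma> k" for k
      using solsD(3)[OF \<delta>, of k] by (simp add: \<gamma>(2))
    moreover have "rel \<infinity> \<gamma>"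
      unfolding rel_def
    proof
      fix k
      have "pp ^ b k * (u k * \<delta> (k + 1)) = pp ^ a k * \<tau> (\<delta> k)"
        using solsD(4)[OF \<delta>] by (simp add: rel_def)
      then have "pp * (pp ^ b k * (u k * \<gamma> (k + 1))) = pp * (pp ^ a k * \<tau> (\<gamma> k))"
        by (simp add: \<gamma>(2) tau.map_mult tau.map_of_nat mult_ac)
      then show "weq \<infinity> (pp ^ b k * (u k * \<gamma> (k + 1))) (pp ^ a k * \<tau> (\<gamma> k))"
        by (simp only: p_mult_cancel weq_infinity)
    qed
    ultimately have "\<gamma> \<in> sols \<infinity>" by (simp add: sols_def \<gamma>(1) wt)
    moreover have "\<alpha> k = ?\<beta> k + pp * \<gamma> k" for k
      using \<gamma>(2)[of k] by (simp add: \<delta>_def algebra_simps)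
    ultimately show "\<exists>\<beta>\<in>r ` ?g ` sols \<infinity>. \<exists>\<gamma>\<in>sols \<infinity>. \<forall>k. \<alpha> k = \<beta> k + pp * \<gamma> k"
      using \<alpha> by blast
  qed
qed

end

section \<open>Abelian groups\<close>

lemma (in comm_group) hom_finprod:
  assumes "h \<in> hom G G" "finite U" "g \<in> U \<rightarrow> carrier G"
  shows "h (finprod G g U) = finprod G (\<lambda>x. h (g x)) U"
  using assms(2,3)
proof (induction U rule: finite_induct)
  case empty
  show ?case using hom_one[OF assms(1) group_axioms group_axioms] by simp
next
  case (insert x U)
  then have "(\<lambda>x. h (g x)) \<in> U \<rightarrow> carrier G" "h (g x) \<in> carrier G"
    using assms(1) by (auto simp: hom_def Pi_iff)
  then show ?case
    using insert hom_mult[OF assms(1)] by (simp add: Pi_iff)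
qed

text \<open>Orthogonal projections that sum to the identity: \<open>pr x\<close> recovers the
  component at x, which gives injectivity, and \<open>total\<close> gives surjectivity.\<close>

lemma internal_direct_sumI:
  fixes G (structure)
  assumes G: "comm_group G" and B: "finite B" and K: "\<And>x. x \<in> B \<Longrightarrow> subgroup (K x) G"
    and hom: "\<And>x. x \<in> B \<Longrightarrow> pr x \<in> hom G G"
    and into: "\<And>x g. x \<in> B \<Longrightarrow> g \<in> carrier G \<Longrightarrow> pr x g \<in> K x"
    and id: "\<And>x g. x \<in> B \<Longrightarrow> g \<in> K x \<Longrightarrow> pr x g = g"
    and orth: "\<And>x y g. x \<in> B \<Longrightarrow> y \<in> B \<Longrightarrow> x \<noteq> y \<Longrightarrow> g \<in> K y \<Longrightarrow> pr x g = \<one>"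
    and total: "\<And>g. g \<in> carrier G \<Longrightarrow> finprod G (\<lambda>x. pr x g) B = g"
  shows "internal_direct_sum G B K"
proof -
  interpret comm_group G by (rule G)
  let ?S = "sum_group B (\<lambda>x. restrict_group G (K x))"
  let ?\<Phi> = "\<lambda>k. finprod G k B"
  have grp: "Group.group (restrict_group G (K x))" if "x \<in> B" for x
    unfolding restrict_group_def by (rule subgroup_imp_group[OF K[OF that]])
  have carrier_S: "carrier ?S = (\<Pi>\<^sub>E x\<in>B. K x)"
    using grp B by (simp add: carrier_sum_group restrict_group_def)
  have sub: "g \<in> carrier G" if "x \<in> B" "g \<in> K x" for x g
    using subgroup.mem_carrier[OF K[OF that(1)] that(2)] .
  have closed: "k \<in> B \<rightarrow> carrier G" if "k \<in> carrier ?S" for k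
    using that sub by (auto simp: carrier_S)
  have proj: "pr x (?\<Phi> k) = k x" if k: "k \<in> carrier ?S" and x: "x \<in> B" for k x
  proof -
    have kK: "k y \<in> K y" if "y \<in> B" for y using k that by (auto simp: carrier_S)
    have "pr x (?\<Phi> k) = finprod G (\<lambda>y. pr x (k y)) B"
      by (rule hom_finprod[OF hom[OF x] B closed[OF k]])
    also have "\<dots> = finprod G (\<lambda>y. if x = y then k y else \<one>) B"
      using kK id[OF x] orth[OF x] closed[OF k] by (intro finprod_cong') (auto simp: Pi_iff)
    also have "\<dots> = k x" by (rule finprod_singleton[OF x B closed[OF k]])
    finally show ?thesis .
  qed
  have "?\<Phi> \<in> hom ?S G"
  proof (rule homI)
    fix k l assume kl: "k \<in> carrier ?S" "l \<in> carrier ?S"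
    have "?\<Phi> (k \<otimes>\<^bsub>?S\<^esub> l) = finprod G (\<lambda>x. k x \<otimes> l x) B"
      using closed[OF kl(1)] closed[OF kl(2)]
      by (intro finprod_cong') (auto simp: restrict_group_def Pi_iff)
    then show "?\<Phi> (k \<otimes>\<^bsub>?S\<^esub> l) = ?\<Phi> k \<otimes> ?\<Phi> l"
      using closed[OF kl(1)] closed[OF kl(2)] by simp
  qed (simp add: closed)
  moreover have "bij_betw ?\<Phi> (carrier ?S) (carrier G)"
    unfolding bij_betw_def
  proof
    show "inj_on ?\<Phi> (carrier ?S)"
    proof (rule inj_onI)
      fix k l assume kl: "k \<in> carrier ?S" "l \<in> carrier ?S" "?\<Phi> k = ?\<Phi> l"
      have "k x = l x" if "x \<in> B" for x
        using proj[OF kl(1) that] proj[OF kl(2) that] kl(3) by simp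
      then show "k = l" using kl by (auto simp: carrier_S intro: PiE_ext)
    qed
    have "g \<in> ?\<Phi> ` carrier ?S" if g: "g \<in> carrier G" for g
    proof (rule image_eqI)
      show "(\<lambda>x\<in>B. pr x g) \<in> carrier ?S" using into g by (simp add: carrier_S)
      have "?\<Phi> (\<lambda>x\<in>B. pr x g) = finprod G (\<lambda>x. pr x g) B"
        using into[OF _ g] sub by (intro finprod_cong') auto
      then show "g = ?\<Phi> (\<lambda>x\<in>B. pr x g)" by (simp add: total[OF g])
    qed
    then show "?\<Phi> ` carrier ?S = carrier G" using closed by auto
  qed
  ultimately show ?thesis
    using B K G unfolding internal_direct_sum_def iso_def by blast
qed

text \<open>Expansion to base p: each element is a digit from C times a p-th power, and expanding
  the base of that power again n times leaves n digits.\<close>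

lemma card_quot_mult_power_le:
  fixes G (structure)
  assumes "comm_group G" "finite C" "C \<subseteq> carrier G"
    "\<And>g. g \<in> carrier G \<Longrightarrow> \<exists>c\<in>C. \<exists>h\<in>carrier G. g = c \<otimes> h [^] p"
  shows "finite (carrier (quot_mult (p ^ n) G)) \<and> card (carrier (quot_mult (p ^ n) G)) \<le> card C ^ n"
proof -
  interpret comm_group G by (rule assms(1))
  have "\<exists>D. finite D \<and> D \<subseteq> carrier G \<and> card D \<le> card C ^ n \<and>
      (\<forall>g\<in>carrier G. \<exists>c\<in>D. \<exists>h\<in>carrier G. g = c \<otimes> h [^] (p ^ n))"
  proof (induction n)
    case 0
    show ?case by (intro exI[of _ "{\<one>}"]) auto
  next
    case (Suc n)
    then obtain D where D: "finite D" "D \<subseteq> carrier G" "card D \<le> card C ^ n"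
      "\<And>g. g \<in> carrier G \<Longrightarrow> \<exists>c\<in>D. \<exists>h\<in>carrier G. g = c \<otimes> h [^] (p ^ n)" by blast
    let ?D = "(\<lambda>(c, e). c \<otimes> e [^] (p ^ n)) ` (D \<times> C)"
    have "card ?D \<le> card (D \<times> C)" using D assms by (intro card_image_le) auto
    also have "\<dots> \<le> card C ^ Suc n" using D(3) by (simp add: card_cartesian_product mult.commute)
    finally have "card ?D \<le> card C ^ Suc n" .
    moreover have "\<exists>c\<in>?D. \<exists>h\<in>carrier G. g = c \<otimes> h [^] (p ^ Suc n)" if g: "g \<in> carrier G" for g
    proof -
      obtain c h where c: "c \<in> D" "h \<in> carrier G" "g = c \<otimes> h [^] (p ^ n)" using D(4)[OF g] by blast
      obtain e k where e: "e \<in> C" "k \<in> carrier G" "h = e \<otimes> k [^] p" using assms(4)[OF c(2)] by blast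
      have cl: "c \<in> carrier G" "e \<in> carrier G" using c e D assms by auto
      have "g = (c \<otimes> e [^] (p ^ n)) \<otimes> k [^] (p ^ Suc n)"
        using cl e c by (simp add: nat_pow_distrib nat_pow_pow m_assoc)
      then show ?thesis using c(1) e(1,2) by (intro bexI[of _ "c \<otimes> e [^] (p ^ n)"] bexI[of _ k]) auto
    qed
    moreover have "finite ?D" "?D \<subseteq> carrier G"
      using D(1,2) assms(2,3) by (auto intro!: m_closed nat_pow_closed)
    ultimately show ?case by (intro exI[of _ ?D]) blast
  qed
  then obtain D where D: "finite D" "D \<subseteq> carrier G" "card D \<le> card C ^ n"
    "\<And>g. g \<in> carrier G \<Longrightarrow> \<exists>c\<in>D. \<exists>h\<in>carrier G. g = c \<otimes> h [^] (p ^ n)" by blast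
  let ?N = "(\<lambda>x. x [^] (p ^ n)) ` carrier G"
  have "(\<lambda>x. x [^] (p ^ n)) \<in> hom G G"
    by (rule homI) (simp_all add: nat_pow_distrib)
  then have N: "subgroup ?N G"
    using group_hom.img_is_subgroup[of G G] group_axioms by (simp add: group_hom_def group_hom_axioms_def)
  have sub: "carrier (quot_mult (p ^ n) G) \<subseteq> (\<lambda>c. ?N #> c) ` D"
  proof
    fix Y assume "Y \<in> carrier (quot_mult (p ^ n) G)"
    then obtain g where g: "g \<in> carrier G" "Y = ?N #> g"
      by (auto simp: quot_mult_def FactGroup_def RCOSETS_def)
    obtain c h where c: "c \<in> D" "h \<in> carrier G" "g = c \<otimes> h [^] (p ^ n)" using D(4)[OF g(1)] by blast
    have cG: "c \<in> carrier G" using c D by auto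
    have "g = h [^] (p ^ n) \<otimes> c" using c cG by (simp add: m_comm)
    then have "g \<in> ?N #> c" using c(2) by (auto simp: r_coset_def)
    then have "?N #> c = ?N #> g" by (rule repr_independence[OF _ cG N])
    then show "Y \<in> (\<lambda>c. ?N #> c) ` D" using g c by auto
  qed
  then show ?thesis
    using finite_subset[OF sub finite_imageI[OF D(1)]] le_trans[OF surj_card_le[OF D(1) sub] D(3)] by simp
qed

section \<open>Homomorphisms as matrices of Witt vectors\<close>

lemma carrier_WF: "carrier (WF p Q) = {x :: nat \<Rightarrow> 'k::alg_closed_field. \<forall>n. x n \<in> fixed_field Q}"
  by (simp add: WF_def witt_ring_def fixed_field_def)

lemma carrier_WF_wring: "carrier (WF p Q) = wcomp ` (wring Q :: 'k::alg_closed_field witt set)"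
proof -
  have "x \<in> wcomp ` wring Q" if "x \<in> carrier (WF p Q)" for x :: "nat \<Rightarrow> 'k"
    using that by (intro image_eqI[of _ _ "Witt x"]) (auto simp: carrier_WF wring_def)
  then show ?thesis by (auto simp: carrier_WF wring_def)
qed

text \<open>
  A quotient \<open>S\<close> of \<open>W(\<bbbF>\<^sub>Q)\<close>, \<open>Q = p\<^sup>f\<close>, by \<open>p\<^sup>n\<close> (\<open>n = \<infinity>\<close>: no quotient), given by the quotient map
  \<open>\<rho>\<close> on the type of Witt vectors.
\<close>

locale witt_quotient = witt_field p ty
  for p :: nat and ty :: "'k::alg_closed_field itself" +
  fixes f :: nat and n :: enat and S :: "'s ring"
    and \<pi> :: "'k wvec \<Rightarrow> 's" and s t :: "'s \<Rightarrow> 's" and \<rho> :: "'k witt \<Rightarrow> 's"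
  assumes f_pos: "f \<ge> 1"
    and carrier_S: "carrier S = \<rho> ` wring (p ^ f)"
    and rho_eq_iff: "x \<in> wring (p ^ f) \<Longrightarrow> y \<in> wring (p ^ f) \<Longrightarrow> \<rho> x = \<rho> y \<longleftrightarrow> weq n x y"
    and zero_S: "\<zero>\<^bsub>S\<^esub> = \<rho> 0"
    and add_S: "x \<in> wring (p ^ f) \<Longrightarrow> y \<in> wring (p ^ f) \<Longrightarrow> \<rho> x \<oplus>\<^bsub>S\<^esub> \<rho> y = \<rho> (x + y)"
    and mult_S: "x \<in> wring (p ^ f) \<Longrightarrow> y \<in> wring (p ^ f) \<Longrightarrow> \<rho> x \<otimes>\<^bsub>S\<^esub> \<rho> y = \<rho> (x * y)"
    and pi_eq: "x \<in> wring (p ^ f) \<Longrightarrow> \<pi> (wcomp x) = \<rho> x"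
    and s_eq: "x \<in> wring (p ^ f) \<Longrightarrow> s (\<rho> x) = \<rho> (wphi p x)"
    and t_eq: "x \<in> wring (p ^ f) \<Longrightarrow> t (\<rho> x) = \<rho> (wphi_inv p x)"
begin

abbreviation W :: "'k witt set" where "W \<equiv> wring (p ^ f)"

sublocale phi: comm_ring_map "wphi p :: 'k witt \<Rightarrow> 'k witt" by (rule comm_ring_map_wphi)
sublocale phi_inv: comm_ring_map "wphi_inv p :: 'k witt \<Rightarrow> 'k witt" by (rule comm_ring_map_wphi_inv)

lemmas W_simps = wring_closed wring_wphi wring_wphi_inv wring_sum

definition rep :: "'s \<Rightarrow> 'k witt" where
  "rep y = (SOME x. x \<in> W \<and> \<rho> x = y)"

lemma rep:
  assumes "y \<in> carrier S"
  shows "rep y \<in> W" "\<rho> (rep y) = y"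
proof -
  have "\<exists>x. x \<in> W \<and> \<rho> x = y" using assms by (auto simp: carrier_S)
  from someI_ex[OF this] show "rep y \<in> W" "\<rho> (rep y) = y" by (simp_all add: rep_def)
qed

lemma rho_carrier: "x \<in> W \<Longrightarrow> \<rho> x \<in> carrier S"
  by (simp add: carrier_S)

lemma weq_rep_rho: "x \<in> W \<Longrightarrow> weq n (rep (\<rho> x)) x"
  using rep[OF rho_carrier, of x] rho_eq_iff by blast

definition vec :: "'x set \<Rightarrow> ('x \<Rightarrow> 'k witt) \<Rightarrow> 'x \<Rightarrow> 's" where
  "vec U \<xi> = (\<lambda>i\<in>U. \<rho> (\<xi> i))"

text \<open>Families are defined on the whole index type; \<open>vec\<close> retains only their
  values on the index set, which spares domain conditions in the matrix calculations.\<close>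

definition wvecs :: "('x \<Rightarrow> 'k witt) set" where
  "wvecs = {\<xi>. \<forall>i. \<xi> i \<in> W}"

lemma vec_eq_iff: "\<xi> \<in> wvecs \<Longrightarrow> \<eta> \<in> wvecs \<Longrightarrow> vec U \<xi> = vec U \<eta> \<longleftrightarrow> (\<forall>i\<in>U. weq n (\<xi> i) (\<eta> i))"
proof
  assume \<xi>: "\<xi> \<in> wvecs" and \<eta>: "\<eta> \<in> wvecs"
  have e: "\<rho> (\<xi> i) = \<rho> (\<eta> i) \<longleftrightarrow> weq n (\<xi> i) (\<eta> i)" for i
    using \<xi> \<eta> by (intro rho_eq_iff) (simp_all add: wvecs_def)
  show "vec U \<xi> = vec U \<eta> \<Longrightarrow> \<forall>i\<in>U. weq n (\<xi> i) (\<eta> i)"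
    unfolding vec_def by (metis e restrict_apply')
  show "\<forall>i\<in>U. weq n (\<xi> i) (\<eta> i) \<Longrightarrow> vec U \<xi> = vec U \<eta>"
    unfolding vec_def by (rule restrict_ext) (simp add: e)
qed

lemma PiE_carrier_S: "U \<rightarrow>\<^sub>E carrier S = vec U ` wvecs"
proof -
  have "x \<in> vec U ` wvecs" if x: "x \<in> U \<rightarrow>\<^sub>E carrier S" for x
  proof (rule image_eqI)
    let ?\<xi> = "\<lambda>i. if i \<in> U then rep (x i) else 0"
    show "?\<xi> \<in> wvecs" using x rep(1) by (auto simp: wvecs_def W_simps)
    show "x = vec U ?\<xi>" using x rep(2) by (auto simp: vec_def fun_eq_iff extensional_def PiE_def Pi_iff)
  qed
  then show ?thesis by (auto simp: vec_def wvecs_def rho_carrier)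
qed

lemma vec_cong: "(\<And>i. i \<in> U \<Longrightarrow> \<rho> (\<xi> i) = \<rho> (\<eta> i)) \<Longrightarrow> vec U \<xi> = vec U \<eta>"
  by (auto simp: vec_def)

end

text \<open>The primed c' and d' are the coefficients of F as elements of the ring type, and v, w
  are those of V, that is, the exact quotients formed in W before base change. All are total
  functions into the ring.\<close>

locale fv_pair = witt_quotient p ty f n S \<pi> s t \<rho>
  for p :: nat and ty :: "'k::alg_closed_field itself" and f n
    and S :: "'s ring" and \<pi> s t \<rho> +
  fixes q :: nat
    and I :: "'i set" and act_I :: "rat \<Rightarrow> 'i \<Rightarrow> 'i" and c :: "'i \<Rightarrow> 'k wvec" and c' v :: "'i \<Rightarrow> 'k witt"
    and J :: "'j set" and act_J :: "rat \<Rightarrow> 'j \<Rightarrow> 'j" and d :: "'j \<Rightarrow> 'k wvec" and d' w :: "'j \<Rightarrow> 'k witt"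
  assumes fin_I: "finite I" and fin_J: "finite J"
    and act_I: "\<And>i. i \<in> I \<Longrightarrow> act_I (of_nat p) i \<in> I" "\<And>i. i \<in> I \<Longrightarrow> act_I (inverse (of_nat p)) i \<in> I"
      "\<And>i. i \<in> I \<Longrightarrow> act_I (inverse (of_nat p)) (act_I (of_nat p) i) = i"
      "\<And>i. i \<in> I \<Longrightarrow> act_I (of_nat p) (act_I (inverse (of_nat p)) i) = i"
    and act_J: "\<And>j. j \<in> J \<Longrightarrow> act_J (of_nat p) j \<in> J" "\<And>j. j \<in> J \<Longrightarrow> act_J (inverse (of_nat p)) j \<in> J"
      "\<And>j. j \<in> J \<Longrightarrow> act_J (inverse (of_nat p)) (act_J (of_nat p) j) = j"
      "\<And>j. j \<in> J \<Longrightarrow> act_J (of_nat p) (act_J (inverse (of_nat p)) j) = j"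
    and c_eq: "\<And>i. i \<in> I \<Longrightarrow> c i = wcomp (c' i)" "\<And>i. c' i \<in> wring (p ^ f)"
    and v_eq: "\<And>i. i \<in> I \<Longrightarrow> exact_quot (WF p q) (p_elt p (WF p q)) (inv_into UNIV (wfrob p) (c i)) = wcomp (v i)"
      "\<And>i. v i \<in> wring (p ^ f)"
    and d_eq: "\<And>j. j \<in> J \<Longrightarrow> d j = wcomp (d' j)" "\<And>j. d' j \<in> wring (p ^ f)"
    and w_eq: "\<And>j. j \<in> J \<Longrightarrow> exact_quot (WF p q) (p_elt p (WF p q)) (inv_into UNIV (wfrob p) (d j)) = wcomp (w j)"
      "\<And>j. w j \<in> wring (p ^ f)"
begin

abbreviation M where "M \<equiv> base_change p q S \<pi> s t I act_I c"
abbreviation N where "N \<equiv> base_change p q S \<pi> s t J act_J d"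
abbreviation R where "R \<equiv> WF p (p ^ f) :: 'k wvec ring"
abbreviation gI where "gI \<equiv> act_I (of_nat p)"
abbreviation gI' where "gI' \<equiv> act_I (inverse (of_nat p))"
abbreviation gJ where "gJ \<equiv> act_J (of_nat p)"
abbreviation gJ' where "gJ' \<equiv> act_J (inverse (of_nat p))"

lemma carrier_M: "carrier M = vec I ` wvecs" and carrier_N: "carrier N = vec J ` wvecs"
  by (simp_all add: base_change_def PiE_carrier_S)

lemma add_M: "\<xi> \<in> wvecs \<Longrightarrow> \<eta> \<in> wvecs \<Longrightarrow> vec I \<xi> \<oplus>\<^bsub>M\<^esub> vec I \<eta> = vec I (\<lambda>i. \<xi> i + \<eta> i)"
  and add_N: "\<xi>' \<in> wvecs \<Longrightarrow> \<eta>' \<in> wvecs \<Longrightarrow> vec J \<xi>' \<oplus>\<^bsub>N\<^esub> vec J \<eta>' = vec J (\<lambda>i. \<xi>' i + \<eta>' i)"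
  by (auto simp: base_change_def vec_def wvecs_def add_S fun_eq_iff)

lemma smult_M: "r \<in> W \<Longrightarrow> \<xi> \<in> wvecs \<Longrightarrow> wcomp r \<odot>\<^bsub>M\<^esub> vec I \<xi> = vec I (\<lambda>i. r * \<xi> i)"
  and smult_N: "r \<in> W \<Longrightarrow> \<xi>' \<in> wvecs \<Longrightarrow> wcomp r \<odot>\<^bsub>N\<^esub> vec J \<xi>' = vec J (\<lambda>i. r * \<xi>' i)"
  by (auto simp: base_change_def vec_def wvecs_def mult_S pi_eq fun_eq_iff)

lemma zero_M: "\<zero>\<^bsub>M\<^esub> = vec I (\<lambda>_. 0)"
  by (simp add: base_change_def vec_def zero_S)

lemma frob_M: "\<xi> \<in> wvecs \<Longrightarrow> frob M (vec I \<xi>) = vec I (\<lambda>i. c' (gI' i) * wphi p (\<xi> (gI' i)))"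
  and frob_N: "\<xi>' \<in> wvecs \<Longrightarrow> frob N (vec J \<xi>') = vec J (\<lambda>i. d' (gJ' i) * wphi p (\<xi>' (gJ' i)))"
  by (auto simp: base_change_def vec_def wvecs_def mult_S pi_eq s_eq c_eq d_eq fun_eq_iff Let_def act_I act_J W_simps)

lemma ver_M: "\<xi> \<in> wvecs \<Longrightarrow> ver M (vec I \<xi>) = vec I (\<lambda>i. v i * wphi_inv p (\<xi> (gI i)))"
  and ver_N: "\<xi>' \<in> wvecs \<Longrightarrow> ver N (vec J \<xi>') = vec J (\<lambda>i. w i * wphi_inv p (\<xi>' (gJ i)))"
  by (auto simp: base_change_def vec_def wvecs_def mult_S pi_eq t_eq v_eq w_eq fun_eq_iff act_I act_J W_simps)

text \<open>Coordinates are lifted by \<open>rep\<close> before the matrix is applied. Only classes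
  modulo p^n are returned, so the choice of lifts has no effect.\<close>

definition mat_hom :: "('i \<times> 'j \<Rightarrow> 'k witt) \<Rightarrow> ('j \<Rightarrow> 's) \<Rightarrow> ('i \<Rightarrow> 's)" where
  "mat_hom \<alpha> = (\<lambda>x\<in>carrier N. vec I (\<lambda>i. \<Sum>j\<in>J. \<alpha> (i, j) * rep (x j)))"

lemma mat_hom_vec:
  assumes "\<alpha> \<in> wvecs" "\<xi> \<in> wvecs"
  shows "mat_hom \<alpha> (vec J \<xi>) = vec I (\<lambda>i. \<Sum>j\<in>J. \<alpha> (i, j) * \<xi> j)"
proof -
  have "mat_hom \<alpha> (vec J \<xi>) = vec I (\<lambda>i. \<Sum>j\<in>J. \<alpha> (i, j) * rep (vec J \<xi> j))"
    using assms by (simp add: mat_hom_def carrier_N)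
  also have "\<dots> = vec I (\<lambda>i. \<Sum>j\<in>J. \<alpha> (i, j) * \<xi> j)"
  proof (rule vec_cong)
    fix i
    have "weq n (\<Sum>j\<in>J. \<alpha> (i, j) * rep (vec J \<xi> j)) (\<Sum>j\<in>J. \<alpha> (i, j) * \<xi> j)"
      using assms by (intro weq_sum weq_mult weq_refl) (auto simp: vec_def wvecs_def weq_rep_rho)
    then show "\<rho> (\<Sum>j\<in>J. \<alpha> (i, j) * rep (vec J \<xi> j)) = \<rho> (\<Sum>j\<in>J. \<alpha> (i, j) * \<xi> j)"
      using assms by (subst rho_eq_iff) (auto simp: wvecs_def vec_def intro!: W_simps rep rho_carrier)
  qed
  finally show ?thesis .
qed

lemma wvecs_mat_mult: "\<alpha> \<in> wvecs \<Longrightarrow> \<xi> \<in> wvecs \<Longrightarrow> (\<lambda>i. \<Sum>j\<in>J. \<alpha> (i, j) * \<xi> j) \<in> wvecs"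
  by (auto simp: wvecs_def intro!: W_simps)

definition basis :: "'j \<Rightarrow> 'j \<Rightarrow> 'k witt" where
  "basis j = (\<lambda>j'. if j' = j then 1 else 0)"

lemma basis_wvecs: "basis j \<in> wvecs"
  by (simp add: basis_def wvecs_def W_simps)

lemma mat_hom_basis:
  "\<alpha> \<in> wvecs \<Longrightarrow> j \<in> J \<Longrightarrow> mat_hom \<alpha> (vec J (basis j)) = vec I (\<lambda>i. \<alpha> (i, j))"
  using fin_J by (simp add: mat_hom_vec basis_wvecs) (simp add: basis_def if_distrib cong: if_cong)

lemma mat_hom_extensional: "mat_hom \<alpha> \<in> extensional (carrier N)"
  by (simp add: mat_hom_def)

lemma mat_hom_ext: "h \<in> extensional (carrier N) \<Longrightarrow> \<alpha> \<in> wvecs \<Longrightarrow>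
    (\<And>\<xi>. \<xi> \<in> wvecs \<Longrightarrow> h (vec J \<xi>) = vec I (\<lambda>i. \<Sum>j\<in>J. \<alpha> (i, j) * \<xi> j)) \<Longrightarrow> h = mat_hom \<alpha>"
  by (rule extensionalityI[of _ "carrier N"]) (simp_all add: mat_hom_extensional, auto simp: mat_hom_vec carrier_N)

lemma mat_hom_eq_iff:
  assumes "\<alpha> \<in> wvecs" "\<beta> \<in> wvecs"
  shows "mat_hom \<alpha> = mat_hom \<beta> \<longleftrightarrow> (\<forall>ij\<in>I \<times> J. weq n (\<alpha> ij) (\<beta> ij))"
proof
  assume eq: "mat_hom \<alpha> = mat_hom \<beta>"
  show "\<forall>ij\<in>I \<times> J. weq n (\<alpha> ij) (\<beta> ij)"
  proof
    fix ij assume "ij \<in> I \<times> J"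
    then obtain i j where ij: "ij = (i, j)" "i \<in> I" "j \<in> J" by auto
    have "vec I (\<lambda>i. \<alpha> (i, j)) = vec I (\<lambda>i. \<beta> (i, j))"
      using eq mat_hom_basis[OF assms(1) ij(3)] mat_hom_basis[OF assms(2) ij(3)] by simp
    then show "weq n (\<alpha> ij) (\<beta> ij)"
      using assms ij by (subst (asm) vec_eq_iff) (auto simp: wvecs_def)
  qed
next
  assume eq: "\<forall>ij\<in>I \<times> J. weq n (\<alpha> ij) (\<beta> ij)"
  show "mat_hom \<alpha> = mat_hom \<beta>"
  proof (rule mat_hom_ext)
    fix \<xi> :: "'j \<Rightarrow> 'k witt" assume \<xi>: "\<xi> \<in> wvecs"
    show "mat_hom \<alpha> (vec J \<xi>) = vec I (\<lambda>i. \<Sum>j\<in>J. \<beta> (i, j) * \<xi> j)"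
      unfolding mat_hom_vec[OF assms(1) \<xi>]
      using eq by (subst vec_eq_iff[OF wvecs_mat_mult[OF assms(1) \<xi>] wvecs_mat_mult[OF assms(2) \<xi>]])
        (auto intro!: weq_sum weq_mult)
  qed (use assms in \<open>auto simp: mat_hom_def\<close>)
qed

abbreviation L where "L \<equiv> lin_hom R N M"

lemma lin_homD:
  assumes "h \<in> carrier L" "\<xi> \<in> wvecs"
  shows "h (vec J \<xi>) \<in> vec I ` wvecs"
    "\<eta> \<in> wvecs \<Longrightarrow> h (vec J (\<lambda>j. \<xi> j + \<eta> j)) = h (vec J \<xi>) \<oplus>\<^bsub>M\<^esub> h (vec J \<eta>)"
    "r \<in> W \<Longrightarrow> h (vec J (\<lambda>j. r * \<xi> j)) = wcomp r \<odot>\<^bsub>M\<^esub> h (vec J \<xi>)"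
proof -
  have m: "vec J \<xi> \<in> carrier N" using assms(2) by (simp add: carrier_N)
  then show "h (vec J \<xi>) \<in> vec I ` wvecs"
    using assms(1) by (auto simp: lin_hom_def carrier_M)
  show "h (vec J (\<lambda>j. \<xi> j + \<eta> j)) = h (vec J \<xi>) \<oplus>\<^bsub>M\<^esub> h (vec J \<eta>)" if \<eta>: "\<eta> \<in> wvecs"
  proof -
    have "vec J \<eta> \<in> carrier N" using \<eta> by (simp add: carrier_N)
    then have "h (vec J \<xi> \<oplus>\<^bsub>N\<^esub> vec J \<eta>) = h (vec J \<xi>) \<oplus>\<^bsub>M\<^esub> h (vec J \<eta>)"
      using assms(1) m by (simp add: lin_hom_def)
    then show ?thesis by (simp add: add_N assms(2) \<eta>)
  qed
  show "h (vec J (\<lambda>j. r * \<xi> j)) = wcomp r \<odot>\<^bsub>M\<^esub> h (vec J \<xi>)" if r: "r \<in> W"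
  proof -
    have "wcomp r \<in> carrier R" using r by (simp add: carrier_WF_wring)
    then have "h (wcomp r \<odot>\<^bsub>N\<^esub> vec J \<xi>) = wcomp r \<odot>\<^bsub>M\<^esub> h (vec J \<xi>)"
      using assms(1) m by (simp add: lin_hom_def)
    then show ?thesis by (simp add: smult_N assms(2) r)
  qed
qed

lemma mat_hom_lin: "\<alpha> \<in> wvecs \<Longrightarrow> mat_hom \<alpha> \<in> carrier L"
proof -
  assume \<alpha>: "\<alpha> \<in> wvecs"
  have add: "mat_hom \<alpha> (vec J \<xi> \<oplus>\<^bsub>N\<^esub> vec J \<eta>) = mat_hom \<alpha> (vec J \<xi>) \<oplus>\<^bsub>M\<^esub> mat_hom \<alpha> (vec J \<eta>)"
    if "\<xi> \<in> wvecs" "\<eta> \<in> wvecs" for \<xi> \<eta>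
  proof -
    have "(\<lambda>j. \<xi> j + \<eta> j) \<in> wvecs" using that by (simp add: wvecs_def W_simps)
    then show ?thesis
      using \<alpha> that by (simp add: add_N add_M mat_hom_vec wvecs_mat_mult distrib_left sum.distrib)
  qed
  have smult: "mat_hom \<alpha> (wcomp r \<odot>\<^bsub>N\<^esub> vec J \<xi>) = wcomp r \<odot>\<^bsub>M\<^esub> mat_hom \<alpha> (vec J \<xi>)"
    if "\<xi> \<in> wvecs" "r \<in> W" for \<xi> r
  proof -
    have "(\<lambda>j. r * \<xi> j) \<in> wvecs" using that by (simp add: wvecs_def W_simps)
    then show ?thesis
      using \<alpha> that by (simp add: smult_N smult_M mat_hom_vec wvecs_mat_mult sum_distrib_left mult.left_commute)
  qed
  have "mat_hom \<alpha> \<in> carrier N \<rightarrow>\<^sub>E carrier M"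
  proof (rule PiE_I)
    fix x assume "x \<in> carrier N"
    then obtain \<xi> where \<xi>: "\<xi> \<in> wvecs" "x = vec J \<xi>" by (auto simp: carrier_N)
    show "mat_hom \<alpha> x \<in> carrier M"
      unfolding \<xi>(2) mat_hom_vec[OF \<alpha> \<xi>(1)] carrier_M by (intro imageI wvecs_mat_mult \<alpha> \<xi>)
  qed (simp add: mat_hom_def)
  moreover have "\<forall>x\<in>carrier N. \<forall>y\<in>carrier N. mat_hom \<alpha> (x \<oplus>\<^bsub>N\<^esub> y) = mat_hom \<alpha> x \<oplus>\<^bsub>M\<^esub> mat_hom \<alpha> y"
    unfolding carrier_N using add by blast
  moreover have "\<forall>r\<in>carrier R. \<forall>x\<in>carrier N. mat_hom \<alpha> (r \<odot>\<^bsub>N\<^esub> x) = r \<odot>\<^bsub>M\<^esub> mat_hom \<alpha> x"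
    unfolding carrier_N carrier_WF_wring using smult by blast
  ultimately show ?thesis by (simp add: lin_hom_def)
qed

text \<open>Lifts of the coordinates of the images of the basis vectors are the columns of the
  matrix.\<close>

lemma carrier_L: "carrier L = mat_hom ` wvecs"
proof
  show "mat_hom ` wvecs \<subseteq> carrier L" using mat_hom_lin by blast
  show "carrier L \<subseteq> mat_hom ` wvecs"
  proof
    fix h assume h: "h \<in> carrier L"
    have "\<exists>\<eta>. \<eta> \<in> wvecs \<and> h (vec J (basis j)) = vec I \<eta>" for j
      using lin_homD(1)[OF h basis_wvecs[of j]] by auto
    then obtain \<eta> where \<eta>: "\<And>j. \<eta> j \<in> wvecs" "\<And>j. h (vec J (basis j)) = vec I (\<eta> j)" by metis
    define \<alpha> where "\<alpha> = (\<lambda>(i, j). \<eta> j i)"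
    have \<alpha>: "\<alpha> \<in> wvecs" using \<eta>(1) by (auto simp: wvecs_def \<alpha>_def)
    have h0: "h (vec J (\<lambda>_. 0)) = vec I (\<lambda>_. 0)"
    proof -
      have z: "(\<lambda>_. 0) \<in> wvecs" "(0 :: 'k witt) \<in> W" by (simp_all add: wvecs_def W_simps)
      obtain \<zeta> where \<zeta>: "\<zeta> \<in> wvecs" "h (vec J (\<lambda>_. 0)) = vec I \<zeta>" using lin_homD(1)[OF h z(1)] by auto
      show ?thesis using lin_homD(3)[OF h z] \<zeta> by (simp add: smult_M z)
    qed
    have "h = mat_hom \<alpha>"
    proof (rule mat_hom_ext[OF _ \<alpha>])
      show "h \<in> extensional (carrier N)" using h by (auto simp: lin_hom_def PiE_def)
      fix \<xi> :: "'j \<Rightarrow> 'k witt" assume \<xi>: "\<xi> \<in> wvecs"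
      have part: "h (vec J (\<lambda>j. if j \<in> U then \<xi> j else 0)) = vec I (\<lambda>i. \<Sum>j\<in>U. \<alpha> (i, j) * \<xi> j)"
        if "finite U" for U
        using that
      proof (induction U rule: finite_induct)
        case empty
        then show ?case using h0 by simp
      next
        case (insert k U)
        have e: "(\<lambda>j. if j \<in> insert k U then \<xi> j else 0)
            = (\<lambda>j. (if j \<in> U then \<xi> j else 0) + \<xi> k * basis k j)"
          using insert by (auto simp: basis_def fun_eq_iff)
        have w: "(\<lambda>j. if j \<in> U then \<xi> j else 0) \<in> wvecs" "(\<lambda>j. \<xi> k * basis k j) \<in> wvecs" "\<xi> k \<in> W"
          using \<xi> by (auto simp: wvecs_def basis_def W_simps)
        have w': "(\<lambda>i. \<Sum>j\<in>U. \<alpha> (i, j) * \<xi> j) \<in> wvecs" "(\<lambda>i. \<xi> k * \<eta> k i) \<in> wvecs"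
          using \<alpha> \<xi> \<eta>(1) by (auto simp: wvecs_def intro!: W_simps)
        have "h (vec J (\<lambda>j. if j \<in> insert k U then \<xi> j else 0))
            = vec I (\<lambda>i. \<Sum>j\<in>U. \<alpha> (i, j) * \<xi> j) \<oplus>\<^bsub>M\<^esub> vec I (\<lambda>i. \<xi> k * \<eta> k i)"
          unfolding e lin_homD(2)[OF h w(1,2)] insert.IH lin_homD(3)[OF h basis_wvecs w(3)]
          by (simp add: \<eta> smult_M w(3))
        also have "\<dots> = vec I (\<lambda>i. \<Sum>j\<in>insert k U. \<alpha> (i, j) * \<xi> j)"
          using insert w' by (simp add: add_M \<alpha>_def mult.commute add.commute)
        finally show ?case .
      qed
      have "vec J \<xi> = vec J (\<lambda>j. if j \<in> J then \<xi> j else 0)" by (auto simp: vec_def)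
      then show "h (vec J \<xi>) = vec I (\<lambda>i. \<Sum>j\<in>J. \<alpha> (i, j) * \<xi> j)" using part[OF fin_J] by simp
    qed
    then show "h \<in> mat_hom ` wvecs" using \<alpha> by blast
  qed
qed

lemma add_L: "\<alpha> \<in> wvecs \<Longrightarrow> \<beta> \<in> wvecs \<Longrightarrow> mat_hom \<alpha> \<oplus>\<^bsub>L\<^esub> mat_hom \<beta> = mat_hom (\<lambda>ij. \<alpha> ij + \<beta> ij)"
proof (rule mat_hom_ext)
  fix \<xi> :: "'j \<Rightarrow> 'k witt" assume "\<alpha> \<in> wvecs" "\<beta> \<in> wvecs" "\<xi> \<in> wvecs"
  then show "(mat_hom \<alpha> \<oplus>\<^bsub>L\<^esub> mat_hom \<beta>) (vec J \<xi>) = vec I (\<lambda>i. \<Sum>j\<in>J. (\<alpha> (i, j) + \<beta> (i, j)) * \<xi> j)"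
    by (simp add: lin_hom_def carrier_N mat_hom_vec add_M wvecs_mat_mult distrib_right sum.distrib)
qed (simp_all add: lin_hom_def wvecs_def W_simps)

lemma zero_L: "\<zero>\<^bsub>L\<^esub> = mat_hom (\<lambda>_. 0)"
  by (rule mat_hom_ext) (simp_all add: lin_hom_def wvecs_def W_simps carrier_N zero_M)

lemma wvecs_0: "(\<lambda>_. 0) \<in> wvecs"
  by (simp add: wvecs_def wring_closed(1))

lemma wvecs_add: "\<alpha> \<in> wvecs \<Longrightarrow> \<beta> \<in> wvecs \<Longrightarrow> (\<lambda>x. \<alpha> x + \<beta> x) \<in> wvecs"
  by (simp add: wvecs_def wring_closed(4))

lemma wvecs_minus: "\<alpha> \<in> wvecs \<Longrightarrow> (\<lambda>x. - \<alpha> x) \<in> wvecs"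
  by (simp add: wvecs_def wring_closed(7))

lemma abelian_monoid_L: "abelian_monoid L"
proof (rule abelian_monoidI)
  show "\<zero>\<^bsub>L\<^esub> \<in> carrier L"
    unfolding zero_L carrier_L by (rule imageI[OF wvecs_0])
next
  fix x y assume "x \<in> carrier L" "y \<in> carrier L"
  then obtain \<alpha> \<beta> where ab: "\<alpha> \<in> wvecs" "\<beta> \<in> wvecs" "x = mat_hom \<alpha>" "y = mat_hom \<beta>"
    unfolding carrier_L by blast
  show "x \<oplus>\<^bsub>L\<^esub> y \<in> carrier L"
    unfolding ab(3,4) add_L[OF ab(1,2)] carrier_L by (intro imageI wvecs_add ab)
  show "x \<oplus>\<^bsub>L\<^esub> y = y \<oplus>\<^bsub>L\<^esub> x"
    unfolding ab(3,4) add_L[OF ab(1,2)] add_L[OF ab(2,1)] by (simp only: add.commute)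
  show "\<zero>\<^bsub>L\<^esub> \<oplus>\<^bsub>L\<^esub> x = x"
    unfolding ab(3) zero_L add_L[OF wvecs_0 ab(1)] by simp
  fix z assume "z \<in> carrier L"
  then obtain \<gamma> where c: "\<gamma> \<in> wvecs" "z = mat_hom \<gamma>" unfolding carrier_L by blast
  show "x \<oplus>\<^bsub>L\<^esub> y \<oplus>\<^bsub>L\<^esub> z = x \<oplus>\<^bsub>L\<^esub> (y \<oplus>\<^bsub>L\<^esub> z)"
    unfolding ab(3,4) c(2) add_L[OF ab(1,2)] add_L[OF ab(2) c(1)]
      add_L[OF wvecs_add[OF ab(1,2)] c(1)] add_L[OF ab(1) wvecs_add[OF ab(2) c(1)]]
    by (simp only: add.assoc)
qed

section \<open>Commutation with F and V in terms of matrix entries\<close>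

definition frob_ver_mat :: "('i \<times> 'j \<Rightarrow> 'k witt) \<Rightarrow> bool" where
  "frob_ver_mat \<alpha> \<longleftrightarrow> (\<forall>i\<in>I. \<forall>j\<in>J.
     weq n (d' j * \<alpha> (gI i, gJ j)) (c' i * wphi p (\<alpha> (i, j))) \<and>
     weq n (w j * \<alpha> (i, j)) (v i * wphi_inv p (\<alpha> (gI i, gJ j))))"

text \<open>Testing on the basis vector at j isolates one equation for each (i, j); conversely these
  are summed after reindexing J by j -> pj. Each equation links only (i, j) and (pi, pj), which is
  why orbits decouple.\<close>

lemma mat_hom_frob_iff:
  assumes \<alpha>: "\<alpha> \<in> wvecs"
  shows "(\<forall>x\<in>carrier N. mat_hom \<alpha> (frob N x) = frob M (mat_hom \<alpha> x)) \<longleftrightarrow>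
    (\<forall>i\<in>I. \<forall>j\<in>J. weq n (d' j * \<alpha> (gI i, gJ j)) (c' i * wphi p (\<alpha> (i, j))))" (is "?L \<longleftrightarrow> ?R")
proof -
  have fN: "(\<lambda>j. d' (gJ' j) * wphi p (\<xi> (gJ' j))) \<in> wvecs" if "\<xi> \<in> wvecs" for \<xi>
    using that d_eq by (simp add: wvecs_def W_simps)
  have fM: "(\<lambda>i. c' (gI' i) * wphi p (\<xi> (gI' i))) \<in> wvecs" if "\<xi> \<in> wvecs" for \<xi>
    using that c_eq by (simp add: wvecs_def W_simps)
  have bij: "bij_betw gJ J J"
    by (rule bij_betw_byWitness[of _ gJ']) (use act_J in auto)
  have eq: "mat_hom \<alpha> (frob N (vec J \<xi>)) = frob M (mat_hom \<alpha> (vec J \<xi>)) \<longleftrightarrow>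
      (\<forall>i\<in>I. weq n (\<Sum>j\<in>J. \<alpha> (i, gJ j) * (d' j * wphi p (\<xi> j)))
        (\<Sum>j\<in>J. c' (gI' i) * wphi p (\<alpha> (gI' i, j)) * wphi p (\<xi> j)))" if \<xi>: "\<xi> \<in> wvecs" for \<xi>
  proof -
    have e1: "(\<Sum>j\<in>J. \<alpha> (i, j) * (d' (gJ' j) * wphi p (\<xi> (gJ' j)))) = (\<Sum>j\<in>J. \<alpha> (i, gJ j) * (d' j * wphi p (\<xi> j)))" for i
      by (rule sum.reindex_bij_betw[OF bij, symmetric, THEN trans]) (auto intro!: sum.cong simp: act_J)
    have e2: "c' (gI' i) * wphi p (\<Sum>j\<in>J. \<alpha> (gI' i, j) * \<xi> j)
        = (\<Sum>j\<in>J. c' (gI' i) * wphi p (\<alpha> (gI' i, j)) * wphi p (\<xi> j))" for i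
      by (simp add: phi.map_sum phi.map_mult sum_distrib_left mult.assoc)
    show ?thesis
      unfolding frob_N[OF \<xi>] mat_hom_vec[OF \<alpha> \<xi>] mat_hom_vec[OF \<alpha> fN[OF \<xi>]] frob_M[OF wvecs_mat_mult[OF \<alpha> \<xi>]]
      unfolding vec_eq_iff[OF wvecs_mat_mult[OF \<alpha> fN[OF \<xi>]] fM[OF wvecs_mat_mult[OF \<alpha> \<xi>]]]
      by (simp only: e1 e2)
  qed
  show ?thesis
  proof
    assume L: ?L
    show ?R
    proof (intro ballI)
      fix i j assume ij: "i \<in> I" "j \<in> J"
      have "vec J (basis j) \<in> carrier N" by (simp add: carrier_N basis_wvecs)
      with L have "mat_hom \<alpha> (frob N (vec J (basis j))) = frob M (mat_hom \<alpha> (vec J (basis j)))" by blast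
      then have "weq n (\<Sum>k\<in>J. \<alpha> (gI i, gJ k) * (d' k * wphi p (basis j k)))
          (\<Sum>k\<in>J. c' (gI' (gI i)) * wphi p (\<alpha> (gI' (gI i), k)) * wphi p (basis j k))"
        unfolding eq[OF basis_wvecs] using act_I ij by blast
      then show "weq n (d' j * \<alpha> (gI i, gJ j)) (c' i * wphi p (\<alpha> (i, j)))"
        using fin_J ij by (simp add: basis_def if_distrib phi.map_0 phi.map_1 act_I mult.commute cong: if_cong)
    qed
  next
    assume r: ?R
    show ?L
      unfolding carrier_N
    proof (rule ballI, erule imageE, simp only:)
      fix \<xi> :: "'j \<Rightarrow> 'k witt" assume \<xi>: "\<xi> \<in> wvecs"
      show "mat_hom \<alpha> (frob N (vec J \<xi>)) = frob M (mat_hom \<alpha> (vec J \<xi>))"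
        unfolding eq[OF \<xi>]
      proof (intro ballI weq_sum)
        fix i j assume ij: "i \<in> I" "j \<in> J"
        have "weq n (d' j * \<alpha> (gI (gI' i), gJ j)) (c' (gI' i) * wphi p (\<alpha> (gI' i, j)))"
          using r ij act_I(2) by blast
        then have "weq n (d' j * \<alpha> (i, gJ j) * wphi p (\<xi> j)) (c' (gI' i) * wphi p (\<alpha> (gI' i, j)) * wphi p (\<xi> j))"
          by (intro weq_mult[OF _ weq_refl]) (use ij act_I in simp)
        then show "weq n (\<alpha> (i, gJ j) * (d' j * wphi p (\<xi> j))) (c' (gI' i) * wphi p (\<alpha> (gI' i, j)) * wphi p (\<xi> j))"
          by (simp add: mult_ac)
      qed
    qed
  qed
qed

text \<open>V lowers the index, so the test vector is the basis vector at pj; injectivity of j -> pj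
  on J leaves a single term.\<close>

lemma mat_hom_ver_iff:
  assumes \<alpha>: "\<alpha> \<in> wvecs"
  shows "(\<forall>x\<in>carrier N. mat_hom \<alpha> (ver N x) = ver M (mat_hom \<alpha> x)) \<longleftrightarrow>
    (\<forall>i\<in>I. \<forall>j\<in>J. weq n (w j * \<alpha> (i, j)) (v i * wphi_inv p (\<alpha> (gI i, gJ j))))" (is "?L \<longleftrightarrow> ?R")
proof -
  have fN: "(\<lambda>j. w j * wphi_inv p (\<xi> (gJ j))) \<in> wvecs" if "\<xi> \<in> wvecs" for \<xi>
    using that w_eq by (simp add: wvecs_def W_simps)
  have fM: "(\<lambda>i. v i * wphi_inv p (\<xi> (gI i))) \<in> wvecs" if "\<xi> \<in> wvecs" for \<xi>
    using that v_eq by (simp add: wvecs_def W_simps)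
  have bij: "bij_betw gJ J J"
    by (rule bij_betw_byWitness[of _ gJ']) (use act_J in auto)
  have eq: "mat_hom \<alpha> (ver N (vec J \<xi>)) = ver M (mat_hom \<alpha> (vec J \<xi>)) \<longleftrightarrow>
      (\<forall>i\<in>I. weq n (\<Sum>j\<in>J. \<alpha> (i, j) * (w j * wphi_inv p (\<xi> (gJ j))))
        (\<Sum>j\<in>J. v i * wphi_inv p (\<alpha> (gI i, gJ j)) * wphi_inv p (\<xi> (gJ j))))" if \<xi>: "\<xi> \<in> wvecs" for \<xi>
  proof -
    have e: "v i * wphi_inv p (\<Sum>j\<in>J. \<alpha> (gI i, j) * \<xi> j)
        = (\<Sum>j\<in>J. v i * wphi_inv p (\<alpha> (gI i, gJ j)) * wphi_inv p (\<xi> (gJ j)))" for i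
    proof -
      have "(\<Sum>j\<in>J. \<alpha> (gI i, j) * \<xi> j) = (\<Sum>j\<in>J. \<alpha> (gI i, gJ j) * \<xi> (gJ j))"
        by (rule sum.reindex_bij_betw[OF bij, symmetric])
      then show ?thesis
        by (simp add: phi_inv.map_sum phi_inv.map_mult sum_distrib_left mult.assoc)
    qed
    show ?thesis
      unfolding ver_N[OF \<xi>] mat_hom_vec[OF \<alpha> \<xi>] mat_hom_vec[OF \<alpha> fN[OF \<xi>]] ver_M[OF wvecs_mat_mult[OF \<alpha> \<xi>]]
      unfolding vec_eq_iff[OF wvecs_mat_mult[OF \<alpha> fN[OF \<xi>]] fM[OF wvecs_mat_mult[OF \<alpha> \<xi>]]]
      by (simp only: e)
  qed
  show ?thesis
  proof
    assume L: ?L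
    show ?R
    proof (intro ballI)
      fix i j assume ij: "i \<in> I" "j \<in> J"
      have g: "gJ k = gJ j \<longleftrightarrow> k = j" if "k \<in> J" for k
        using that ij act_J(3) by metis
      have "vec J (basis (gJ j)) \<in> carrier N" by (simp add: carrier_N basis_wvecs)
      with L have "mat_hom \<alpha> (ver N (vec J (basis (gJ j)))) = ver M (mat_hom \<alpha> (vec J (basis (gJ j))))" by blast
      then have "weq n (\<Sum>k\<in>J. \<alpha> (i, k) * (w k * wphi_inv p (basis (gJ j) (gJ k))))
          (\<Sum>k\<in>J. v i * wphi_inv p (\<alpha> (gI i, gJ k)) * wphi_inv p (basis (gJ j) (gJ k)))"
        unfolding eq[OF basis_wvecs] using ij by blast
      also have "(\<Sum>k\<in>J. \<alpha> (i, k) * (w k * wphi_inv p (basis (gJ j) (gJ k)))) = (\<Sum>k\<in>J. if k = j then \<alpha> (i, k) * w k else 0)"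
        by (intro sum.cong refl) (simp add: basis_def g phi_inv.map_0 phi_inv.map_1)
      also have "(\<Sum>k\<in>J. v i * wphi_inv p (\<alpha> (gI i, gJ k)) * wphi_inv p (basis (gJ j) (gJ k)))
          = (\<Sum>k\<in>J. if k = j then v i * wphi_inv p (\<alpha> (gI i, gJ k)) else 0)"
        by (intro sum.cong refl) (simp add: basis_def g phi_inv.map_0 phi_inv.map_1)
      finally show "weq n (w j * \<alpha> (i, j)) (v i * wphi_inv p (\<alpha> (gI i, gJ j)))"
        using fin_J ij by (simp add: mult.commute)
    qed
  next
    assume r: ?R
    show ?L
      unfolding carrier_N
    proof (rule ballI, erule imageE, simp only:)
      fix \<xi> :: "'j \<Rightarrow> 'k witt" assume \<xi>: "\<xi> \<in> wvecs"
      show "mat_hom \<alpha> (ver N (vec J \<xi>)) = ver M (mat_hom \<alpha> (vec J \<xi>))"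
        unfolding eq[OF \<xi>]
      proof (intro ballI weq_sum)
        fix i j assume ij: "i \<in> I" "j \<in> J"
        have "weq n (w j * \<alpha> (i, j)) (v i * wphi_inv p (\<alpha> (gI i, gJ j)))"
          using r ij by blast
        then have "weq n (w j * \<alpha> (i, j) * wphi_inv p (\<xi> (gJ j))) (v i * wphi_inv p (\<alpha> (gI i, gJ j)) * wphi_inv p (\<xi> (gJ j)))"
          by (rule weq_mult[OF _ weq_refl])
        then show "weq n (\<alpha> (i, j) * (w j * wphi_inv p (\<xi> (gJ j)))) (v i * wphi_inv p (\<alpha> (gI i, gJ j)) * wphi_inv p (\<xi> (gJ j)))"
          by (simp add: mult_ac)
      qed
    qed
  qed
qed

abbreviation HG where "HG \<equiv> fv_hom R N M"

lemma mat_hom_HG_iff: "\<alpha> \<in> wvecs \<Longrightarrow> mat_hom \<alpha> \<in> carrier HG \<longleftrightarrow> frob_ver_mat \<alpha>"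
  using mat_hom_frob_iff[of \<alpha>] mat_hom_ver_iff[of \<alpha>] mat_hom_lin[of \<alpha>]
  by (simp add: fv_hom_def frob_ver_mat_def ball_conj_distrib)

lemma carrier_HG: "carrier HG = mat_hom ` {\<alpha> \<in> wvecs. frob_ver_mat \<alpha>}"
proof -
  have "carrier HG \<subseteq> carrier L" by (auto simp: fv_hom_def)
  then show ?thesis using mat_hom_HG_iff unfolding carrier_L by blast
qed

lemma mult_HG: "\<alpha> \<in> wvecs \<Longrightarrow> \<beta> \<in> wvecs \<Longrightarrow> mat_hom \<alpha> \<otimes>\<^bsub>HG\<^esub> mat_hom \<beta> = mat_hom (\<lambda>ij. \<alpha> ij + \<beta> ij)"
  using add_L by (simp add: fv_hom_def)

lemma one_HG: "\<one>\<^bsub>HG\<^esub> = mat_hom (\<lambda>_. 0)"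
  using zero_L by (simp add: fv_hom_def)

end

section \<open>The group of homomorphisms and its splitting by support\<close>

context fv_pair
begin

lemma frob_ver_mat_add:
  assumes "frob_ver_mat \<alpha>" "frob_ver_mat \<beta>"
  shows "frob_ver_mat (\<lambda>ij. \<alpha> ij + \<beta> ij)"
  unfolding frob_ver_mat_def
proof (intro ballI conjI)
  fix i j assume ij: "i \<in> I" "j \<in> J"
  show "weq n (d' j * (\<alpha> (gI i, gJ j) + \<beta> (gI i, gJ j))) (c' i * wphi p (\<alpha> (i, j) + \<beta> (i, j)))"
    using assms ij unfolding phi.map_add distrib_left by (intro weq_add) (auto simp: frob_ver_mat_def)
  show "weq n (w j * (\<alpha> (i, j) + \<beta> (i, j))) (v i * wphi_inv p (\<alpha> (gI i, gJ j) + \<beta> (gI i, gJ j)))"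
    using assms ij unfolding phi_inv.map_add distrib_left by (intro weq_add) (auto simp: frob_ver_mat_def)
qed

lemma frob_ver_mat_minus:
  assumes "frob_ver_mat \<alpha>"
  shows "frob_ver_mat (\<lambda>ij. - \<alpha> ij)"
  unfolding frob_ver_mat_def
proof (intro ballI conjI)
  fix i j assume ij: "i \<in> I" "j \<in> J"
  show "weq n (d' j * - \<alpha> (gI i, gJ j)) (c' i * wphi p (- \<alpha> (i, j)))"
    using assms ij unfolding phi.map_minus mult_minus_right by (intro weq_minus) (auto simp: frob_ver_mat_def)
  show "weq n (w j * - \<alpha> (i, j)) (v i * wphi_inv p (- \<alpha> (gI i, gJ j)))"
    using assms ij unfolding phi_inv.map_minus mult_minus_right by (intro weq_minus) (auto simp: frob_ver_mat_def)
qed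

lemma frob_ver_mat_0: "frob_ver_mat (\<lambda>_. 0)"
  by (simp add: frob_ver_mat_def phi.map_0 phi_inv.map_0)

lemma comm_group_HG: "comm_group HG"
proof (rule comm_groupI)
  show "\<one>\<^bsub>HG\<^esub> \<in> carrier HG"
    unfolding one_HG mat_hom_HG_iff[OF wvecs_0] by (rule frob_ver_mat_0)
next
  fix x y assume "x \<in> carrier HG" "y \<in> carrier HG"
  then obtain \<alpha> \<beta> where ab: "\<alpha> \<in> wvecs" "\<beta> \<in> wvecs" "frob_ver_mat \<alpha>" "frob_ver_mat \<beta>"
    and xy: "x = mat_hom \<alpha>" "y = mat_hom \<beta>"
    unfolding carrier_HG by blast
  show "x \<otimes>\<^bsub>HG\<^esub> y \<in> carrier HG"
    unfolding xy mult_HG[OF ab(1,2)] mat_hom_HG_iff[OF wvecs_add[OF ab(1,2)]]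
    by (rule frob_ver_mat_add[OF ab(3,4)])
  show "x \<otimes>\<^bsub>HG\<^esub> y = y \<otimes>\<^bsub>HG\<^esub> x"
    unfolding xy mult_HG[OF ab(1,2)] mult_HG[OF ab(2,1)] by (simp only: add.commute)
  show "\<one>\<^bsub>HG\<^esub> \<otimes>\<^bsub>HG\<^esub> x = x"
    unfolding xy one_HG mult_HG[OF wvecs_0 ab(1)] by simp
  show "\<exists>y\<in>carrier HG. y \<otimes>\<^bsub>HG\<^esub> x = \<one>\<^bsub>HG\<^esub>"
  proof
    show "mat_hom (\<lambda>ij. - \<alpha> ij) \<in> carrier HG"
      unfolding mat_hom_HG_iff[OF wvecs_minus[OF ab(1)]] by (rule frob_ver_mat_minus[OF ab(3)])
    show "mat_hom (\<lambda>ij. - \<alpha> ij) \<otimes>\<^bsub>HG\<^esub> x = \<one>\<^bsub>HG\<^esub>"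
      unfolding xy mult_HG[OF wvecs_minus[OF ab(1)] ab(1)] one_HG by simp
  qed
  fix z assume "z \<in> carrier HG"
  then obtain \<gamma> where c: "\<gamma> \<in> wvecs" "z = mat_hom \<gamma>" unfolding carrier_HG by blast
  show "x \<otimes>\<^bsub>HG\<^esub> y \<otimes>\<^bsub>HG\<^esub> z = x \<otimes>\<^bsub>HG\<^esub> (y \<otimes>\<^bsub>HG\<^esub> z)"
    unfolding xy c(2) mult_HG[OF ab(1,2)] mult_HG[OF ab(2) c(1)]
      mult_HG[OF wvecs_add[OF ab(1,2)] c(1)] mult_HG[OF ab(1) wvecs_add[OF ab(2) c(1)]]
    by (simp only: add.assoc)
qed

sublocale HG: comm_group HG by (rule comm_group_HG)

lemma wvecs_scale: "r \<in> W \<Longrightarrow> \<alpha> \<in> wvecs \<Longrightarrow> (\<lambda>x. r * \<alpha> x) \<in> wvecs"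
  by (simp add: wvecs_def wring_closed(6))

lemma pow_HG:
  assumes "\<alpha> \<in> wvecs"
  shows "mat_hom \<alpha> [^]\<^bsub>HG\<^esub> (l :: nat) = mat_hom (\<lambda>ij. of_nat l * \<alpha> ij)"
proof (induction l)
  case 0
  then show ?case using one_HG by simp
next
  case (Suc l)
  have "mat_hom \<alpha> [^]\<^bsub>HG\<^esub> Suc l = mat_hom (\<lambda>ij. of_nat l * \<alpha> ij) \<otimes>\<^bsub>HG\<^esub> mat_hom \<alpha>"
    by (simp only: HG.nat_pow_Suc Suc)
  also have "\<dots> = mat_hom (\<lambda>ij. of_nat (Suc l) * \<alpha> ij)"
    unfolding mult_HG[OF wvecs_scale[OF wring_closed(3) assms] assms] by (simp add: algebra_simps)
  finally show ?case .
qed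

definition supp_mats :: "('i \<times> 'j) set \<Rightarrow> ('i \<times> 'j \<Rightarrow> 'k witt) set" where
  "supp_mats O' = {\<alpha> \<in> wvecs. frob_ver_mat \<alpha> \<and> (\<forall>ij\<in>I \<times> J. ij \<notin> O' \<longrightarrow> \<alpha> ij = 0)}"

lemma smult_elem_hom:
  assumes "ij \<in> I \<times> J" "r \<in> W"
  shows "wcomp r \<odot>\<^bsub>L\<^esub> elem_hom N M ij = mat_hom (\<lambda>ij'. if ij' = ij then r else 0)"
proof -
  obtain i j where ij: "ij = (i, j)" "i \<in> I" "j \<in> J" using assms by auto
  show ?thesis
  proof (rule mat_hom_ext)
    show "(\<lambda>ij'. if ij' = ij then r else 0) \<in> wvecs" using assms(2) wring_closed(1) by (simp add: wvecs_def)
    show "wcomp r \<odot>\<^bsub>L\<^esub> elem_hom N M ij \<in> extensional (carrier N)" by (simp add: lin_hom_def)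
    fix \<xi> :: "'j \<Rightarrow> 'k witt" assume \<xi>: "\<xi> \<in> wvecs"
    have z: "(\<zero>\<^bsub>M\<^esub>)(i := vec J \<xi> j) = vec I (\<lambda>i'. if i' = i then \<xi> j else 0)"
      using ij unfolding zero_M by (auto simp: vec_def fun_eq_iff)
    have w: "(\<lambda>i'. if i' = i then \<xi> j else 0) \<in> wvecs" using \<xi> wring_closed(1) by (simp add: wvecs_def)
    have "(wcomp r \<odot>\<^bsub>L\<^esub> elem_hom N M ij) (vec J \<xi>) = wcomp r \<odot>\<^bsub>M\<^esub> (\<zero>\<^bsub>M\<^esub>)(i := vec J \<xi> j)"
      using \<xi> by (simp add: lin_hom_def elem_hom_def ij(1) carrier_N)
    also have "\<dots> = vec I (\<lambda>i'. r * (if i' = i then \<xi> j else 0))"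
      unfolding z by (rule smult_M[OF assms(2) w])
    also have "\<dots> = vec I (\<lambda>i'. \<Sum>j'\<in>J. (if (i', j') = ij then r else 0) * \<xi> j')"
    proof (rule vec_cong, rule arg_cong[where f=\<rho>])
      fix i'
      have "(\<Sum>j'\<in>J. (if (i', j') = ij then r else 0) * \<xi> j') = (\<Sum>j'\<in>J. if j' = j then (if i' = i then r * \<xi> j else 0) else 0)"
        by (intro sum.cong refl) (auto simp: ij)
      then show "r * (if i' = i then \<xi> j else 0) = (\<Sum>j'\<in>J. (if (i', j') = ij then r else 0) * \<xi> j')"
        using ij fin_J by simp
    qed
    finally show "(wcomp r \<odot>\<^bsub>L\<^esub> elem_hom N M ij) (vec J \<xi>) = vec I (\<lambda>i'. \<Sum>j'\<in>J. (if (i', j') = ij then r else 0) * \<xi> j')" .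
  qed
qed

lemma finsum_elem_hom:
  assumes \<gamma>: "\<gamma> \<in> I \<times> J \<rightarrow> W" and "finite D" "D \<subseteq> I \<times> J"
  shows "(\<Oplus>\<^bsub>L\<^esub>ij\<in>D. wcomp (\<gamma> ij) \<odot>\<^bsub>L\<^esub> elem_hom N M ij) = mat_hom (\<lambda>ij. if ij \<in> D then \<gamma> ij else 0)"
proof -
  interpret abelian_monoid L by (rule abelian_monoid_L)
  have w: "(\<lambda>ij'. if ij' = ij then \<gamma> ij else 0) \<in> wvecs" if "ij \<in> I \<times> J" for ij
    using \<gamma> that wring_closed(1) by (auto simp: wvecs_def)
  have elt: "wcomp (\<gamma> ij) \<odot>\<^bsub>L\<^esub> elem_hom N M ij = mat_hom (\<lambda>ij'. if ij' = ij then \<gamma> ij else 0)" if "ij \<in> I \<times> J" for ij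
    using that \<gamma> by (intro smult_elem_hom) auto
  have closed: "wcomp (\<gamma> ij) \<odot>\<^bsub>L\<^esub> elem_hom N M ij \<in> carrier L" if "ij \<in> I \<times> J" for ij
    unfolding elt[OF that] by (rule mat_hom_lin[OF w[OF that]])
  show ?thesis
    using assms(2,3)
  proof (induction D rule: finite_induct)
    case empty
    then show ?case by (simp add: finsum_empty zero_L)
  next
    case (insert k D)
    have wD: "(\<lambda>ij. if ij \<in> D then \<gamma> ij else 0) \<in> wvecs"
      using \<gamma> insert wring_closed(1) by (auto simp: wvecs_def)
    have k: "k \<in> I \<times> J" using insert by blast
    have "(\<Oplus>\<^bsub>L\<^esub>ij\<in>insert k D. wcomp (\<gamma> ij) \<odot>\<^bsub>L\<^esub> elem_hom N M ij)
        = wcomp (\<gamma> k) \<odot>\<^bsub>L\<^esub> elem_hom N M k \<oplus>\<^bsub>L\<^esub> (\<Oplus>\<^bsub>L\<^esub>ij\<in>D. wcomp (\<gamma> ij) \<odot>\<^bsub>L\<^esub> elem_hom N M ij)"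
      by (rule finsum_insert) (use insert closed in auto)
    also have "\<dots> = mat_hom (\<lambda>ij'. (if ij' = k then \<gamma> k else 0) + (if ij' \<in> D then \<gamma> ij' else 0))"
      unfolding elt[OF k] using insert add_L[OF w[OF k] wD] by simp
    also have "(\<lambda>ij'. (if ij' = k then \<gamma> k else 0) + (if ij' \<in> D then \<gamma> ij' else 0)) = (\<lambda>ij. if ij \<in> insert k D then \<gamma> ij else 0)"
      using insert by (auto simp: fun_eq_iff)
    finally show ?case .
  qed
qed

text \<open>A combination of elementary homomorphisms is the map of its coefficient matrix. Entries
  outside the index set do not affect the map and are set to zero.\<close>

lemma fv_hom_supp_eq: "fv_hom_supp R J N I M O' = mat_hom ` supp_mats O'"
proof
  have zR: "\<zero>\<^bsub>R\<^esub> = wcomp 0" by (simp add: WF_def witt_ring_def zero_witt_def)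
  show "fv_hom_supp R J N I M O' \<subseteq> mat_hom ` supp_mats O'"
  proof
    fix h assume "h \<in> fv_hom_supp R J N I M O'"
    then obtain \<alpha> where \<alpha>: "h \<in> carrier HG" "\<alpha> \<in> I \<times> J \<rightarrow> carrier R"
      "\<And>ij. ij \<in> I \<times> J \<Longrightarrow> ij \<notin> O' \<Longrightarrow> \<alpha> ij = \<zero>\<^bsub>R\<^esub>"
      "h = (\<Oplus>\<^bsub>L\<^esub>ij\<in>I \<times> J. \<alpha> ij \<odot>\<^bsub>L\<^esub> elem_hom N M ij)"
      unfolding fv_hom_supp_def by blast
    define \<gamma> where "\<gamma> ij = Witt (\<alpha> ij)" for ij
    have \<gamma>: "\<gamma> \<in> I \<times> J \<rightarrow> W"
      using \<alpha>(2) by (auto simp: \<gamma>_def carrier_WF wring_def Pi_iff)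
    have h: "h = mat_hom (\<lambda>ij. if ij \<in> I \<times> J then \<gamma> ij else 0)"
      using finsum_elem_hom[OF \<gamma>, of "I \<times> J"] fin_I fin_J by (simp add: \<alpha>(4) \<gamma>_def)
    have w: "(\<lambda>ij. if ij \<in> I \<times> J then \<gamma> ij else 0) \<in> wvecs"
      using \<gamma> wring_closed(1) by (auto simp: wvecs_def)
    have "frob_ver_mat (\<lambda>ij. if ij \<in> I \<times> J then \<gamma> ij else 0)"
      using \<alpha>(1) unfolding h mat_hom_HG_iff[OF w] .
    moreover have "\<gamma> ij = 0" if "ij \<in> I \<times> J" "ij \<notin> O'" for ij
      using \<alpha>(3)[OF that] by (simp add: \<gamma>_def zR wcomp_inverse)
    ultimately show "h \<in> mat_hom ` supp_mats O'"
      using w h by (intro image_eqI[of _ _ "\<lambda>ij. if ij \<in> I \<times> J then \<gamma> ij else 0"]) (auto simp: supp_mats_def)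
  qed
  show "mat_hom ` supp_mats O' \<subseteq> fv_hom_supp R J N I M O'"
  proof (rule image_subsetI)
    fix \<alpha> assume \<alpha>: "\<alpha> \<in> supp_mats O'"
    then have w: "\<alpha> \<in> wvecs" by (simp add: supp_mats_def)
    then have "\<alpha> \<in> I \<times> J \<rightarrow> W" by (auto simp: wvecs_def)
    from finsum_elem_hom[OF this, of "I \<times> J"] fin_I fin_J
    have "(\<Oplus>\<^bsub>L\<^esub>ij\<in>I \<times> J. wcomp (\<alpha> ij) \<odot>\<^bsub>L\<^esub> elem_hom N M ij) = mat_hom (\<lambda>ij. if ij \<in> I \<times> J then \<alpha> ij else 0)"
      by simp
    also have "\<dots> = mat_hom \<alpha>"
      using w wring_closed(1) by (subst mat_hom_eq_iff) (auto simp: wvecs_def)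
    finally have "mat_hom \<alpha> = (\<Oplus>\<^bsub>L\<^esub>ij\<in>I \<times> J. wcomp (\<alpha> ij) \<odot>\<^bsub>L\<^esub> elem_hom N M ij)" ..
    moreover have "mat_hom \<alpha> \<in> carrier HG" using \<alpha> w by (simp add: supp_mats_def mat_hom_HG_iff)
    moreover have "(\<lambda>ij. wcomp (\<alpha> ij)) \<in> I \<times> J \<rightarrow> carrier R" using w by (auto simp: carrier_WF_wring wvecs_def)
    moreover have "\<forall>ij\<in>I \<times> J. ij \<notin> O' \<longrightarrow> wcomp (\<alpha> ij) = \<zero>\<^bsub>R\<^esub>" using \<alpha> by (simp add: supp_mats_def zR)
    ultimately show "mat_hom \<alpha> \<in> fv_hom_supp R J N I M O'"
      unfolding fv_hom_supp_def mem_Collect_eq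
      by - (rule conjI, assumption, rule bexI[of _ "\<lambda>ij. wcomp (\<alpha> ij)"], rule conjI, assumption+)
  qed
qed

lemma subgroup_supp: "subgroup (mat_hom ` supp_mats O') HG"
proof (rule HG.subgroupI)
  show "mat_hom ` supp_mats O' \<subseteq> carrier HG"
    by (auto simp: supp_mats_def mat_hom_HG_iff)
  show "mat_hom ` supp_mats O' \<noteq> {}"
    using wvecs_0 frob_ver_mat_0 by (auto simp: supp_mats_def)
  fix x assume "x \<in> mat_hom ` supp_mats O'"
  then obtain \<alpha> where \<alpha>: "\<alpha> \<in> supp_mats O'" "x = mat_hom \<alpha>" by blast
  then have \<alpha>w: "\<alpha> \<in> wvecs" "frob_ver_mat \<alpha>" by (simp_all add: supp_mats_def)
  have inv: "inv\<^bsub>HG\<^esub> x = mat_hom (\<lambda>ij. - \<alpha> ij)"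
  proof (rule HG.inv_equality)
    show "mat_hom (\<lambda>ij. - \<alpha> ij) \<otimes>\<^bsub>HG\<^esub> x = \<one>\<^bsub>HG\<^esub>"
      unfolding \<alpha>(2) mult_HG[OF wvecs_minus[OF \<alpha>w(1)] \<alpha>w(1)] one_HG by simp
    show "x \<in> carrier HG" "mat_hom (\<lambda>ij. - \<alpha> ij) \<in> carrier HG"
      using \<alpha>w \<alpha>(2) by (simp_all add: mat_hom_HG_iff wvecs_minus frob_ver_mat_minus)
  qed
  show "inv\<^bsub>HG\<^esub> x \<in> mat_hom ` supp_mats O'"
    unfolding inv using \<alpha> by (intro imageI) (simp add: supp_mats_def wvecs_minus frob_ver_mat_minus)
  fix y assume "y \<in> mat_hom ` supp_mats O'"
  then obtain \<beta> where \<beta>: "\<beta> \<in> supp_mats O'" "y = mat_hom \<beta>" by blast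
  have "x \<otimes>\<^bsub>HG\<^esub> y = mat_hom (\<lambda>ij. \<alpha> ij + \<beta> ij)"
    unfolding \<alpha>(2) \<beta>(2) by (rule mult_HG) (use \<alpha> \<beta> in \<open>simp_all add: supp_mats_def\<close>)
  then show "x \<otimes>\<^bsub>HG\<^esub> y \<in> mat_hom ` supp_mats O'"
    using \<alpha> \<beta> by (intro image_eqI[of _ _ "\<lambda>ij. \<alpha> ij + \<beta> ij"]) (simp_all add: supp_mats_def wvecs_add frob_ver_mat_add)
qed

definition invariant :: "('i \<times> 'j) set \<Rightarrow> bool" where
  "invariant O' \<longleftrightarrow> (\<forall>i\<in>I. \<forall>j\<in>J. (gI i, gJ j) \<in> O' \<longleftrightarrow> (i, j) \<in> O')"

definition cut :: "('i \<times> 'j) set \<Rightarrow> ('i \<times> 'j \<Rightarrow> 'k witt) \<Rightarrow> 'i \<times> 'j \<Rightarrow> 'k witt" where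
  "cut O' \<alpha> = (\<lambda>ij. if ij \<in> O' then \<alpha> ij else 0)"

lemma cut_wvecs: "\<alpha> \<in> wvecs \<Longrightarrow> cut O' \<alpha> \<in> wvecs"
  using wring_closed(1) by (simp add: cut_def wvecs_def)

lemma frob_ver_mat_cut: "frob_ver_mat \<alpha> \<Longrightarrow> invariant O' \<Longrightarrow> frob_ver_mat (cut O' \<alpha>)"
  by (auto simp: frob_ver_mat_def invariant_def cut_def phi.map_0 phi_inv.map_0)

definition proj :: "('i \<times> 'j) set \<Rightarrow> (('j \<Rightarrow> 's) \<Rightarrow> 'i \<Rightarrow> 's) \<Rightarrow> ('j \<Rightarrow> 's) \<Rightarrow> 'i \<Rightarrow> 's" where
  "proj O' h = mat_hom (cut O' (SOME \<alpha>. \<alpha> \<in> wvecs \<and> h = mat_hom \<alpha>))"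

text \<open>Two matrices of one homomorphism have congruent entries, and cutting preserves
  congruence, so the matrix chosen in \<open>proj\<close> is immaterial.\<close>

lemma proj_mat_hom:
  assumes "\<alpha> \<in> wvecs"
  shows "proj O' (mat_hom \<alpha>) = mat_hom (cut O' \<alpha>)"
proof -
  define \<beta> where "\<beta> = (SOME \<beta>. \<beta> \<in> wvecs \<and> mat_hom \<alpha> = mat_hom \<beta>)"
  have "\<beta> \<in> wvecs \<and> mat_hom \<alpha> = mat_hom \<beta>"
    unfolding \<beta>_def by (rule someI[of _ \<alpha>]) (simp add: assms)
  then have \<beta>: "\<beta> \<in> wvecs" "\<forall>ij\<in>I \<times> J. weq n (\<alpha> ij) (\<beta> ij)"
    using mat_hom_eq_iff[OF assms] by blast+
  have "mat_hom (cut O' \<beta>) = mat_hom (cut O' \<alpha>)"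
    unfolding mat_hom_eq_iff[OF cut_wvecs[OF \<beta>(1)] cut_wvecs[OF assms]]
    using \<beta>(2) by (auto simp: cut_def weq_sym)
  then show ?thesis by (simp add: proj_def \<beta>_def)
qed

text \<open>Each equation links two points of the same invariant set, so cutting a matrix to such a
  set preserves all equations. For a partition the cuts are orthogonal projections with sum the
  identity.\<close>

lemma internal_direct_sum_supp:
  assumes B: "finite B" "\<And>O'. O' \<in> B \<Longrightarrow> invariant O'" "\<Union>B = I \<times> J"
    and disj: "\<And>O1 O2. O1 \<in> B \<Longrightarrow> O2 \<in> B \<Longrightarrow> O1 \<noteq> O2 \<Longrightarrow> O1 \<inter> O2 = {}"
  shows "internal_direct_sum HG B (fv_hom_supp R J N I M)"
proof (rule internal_direct_sumI[where pr = proj, OF comm_group_HG B(1)])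
  fix O1 assume O1: "O1 \<in> B"
  show "subgroup (fv_hom_supp R J N I M O1) HG"
    unfolding fv_hom_supp_eq by (rule subgroup_supp)
  show "proj O1 \<in> hom HG HG"
  proof (rule homI)
    fix x assume "x \<in> carrier HG"
    then obtain \<alpha> where \<alpha>: "\<alpha> \<in> wvecs" "frob_ver_mat \<alpha>" "x = mat_hom \<alpha>" unfolding carrier_HG by blast
    show "proj O1 x \<in> carrier HG"
      unfolding \<alpha>(3) proj_mat_hom[OF \<alpha>(1)] mat_hom_HG_iff[OF cut_wvecs[OF \<alpha>(1)]]
      by (rule frob_ver_mat_cut[OF \<alpha>(2) B(2)[OF O1]])
    fix y assume "y \<in> carrier HG"
    then obtain \<beta> where \<beta>: "\<beta> \<in> wvecs" "y = mat_hom \<beta>" unfolding carrier_HG by blast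
    show "proj O1 (x \<otimes>\<^bsub>HG\<^esub> y) = proj O1 x \<otimes>\<^bsub>HG\<^esub> proj O1 y"
      unfolding \<alpha>(3) \<beta>(2) mult_HG[OF \<alpha>(1) \<beta>(1)] proj_mat_hom[OF \<alpha>(1)] proj_mat_hom[OF \<beta>(1)]
        proj_mat_hom[OF wvecs_add[OF \<alpha>(1) \<beta>(1)]] mult_HG[OF cut_wvecs[OF \<alpha>(1)] cut_wvecs[OF \<beta>(1)]]
      by (rule arg_cong[where f=mat_hom]) (auto simp: cut_def)
  qed
  show "proj O1 g \<in> fv_hom_supp R J N I M O1" if g: "g \<in> carrier HG" for g
  proof -
    obtain \<alpha> where \<alpha>: "\<alpha> \<in> wvecs" "frob_ver_mat \<alpha>" "g = mat_hom \<alpha>" using g unfolding carrier_HG by blast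
    show ?thesis
      unfolding fv_hom_supp_eq \<alpha>(3) proj_mat_hom[OF \<alpha>(1)]
      using frob_ver_mat_cut[OF \<alpha>(2) B(2)[OF O1]] cut_wvecs[OF \<alpha>(1)]
      by (intro imageI) (auto simp: supp_mats_def cut_def)
  qed
  have cut_supp: "mat_hom (cut O1 \<alpha>) = mat_hom (if O1 = O2 then \<alpha> else (\<lambda>_. 0))"
    if "\<alpha> \<in> supp_mats O2" "O2 \<in> B" for \<alpha> O2
  proof -
    have \<alpha>: "\<alpha> \<in> wvecs" "\<And>ij. ij \<in> I \<times> J \<Longrightarrow> ij \<notin> O2 \<Longrightarrow> \<alpha> ij = 0" using that by (auto simp: supp_mats_def)
    have w: "(if O1 = O2 then \<alpha> else (\<lambda>_. 0)) \<in> wvecs" using \<alpha>(1) by (simp add: wvecs_0)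
    show ?thesis
      unfolding mat_hom_eq_iff[OF cut_wvecs[OF \<alpha>(1)] w]
    proof
      fix ij assume ij: "ij \<in> I \<times> J"
      show "weq n (cut O1 \<alpha> ij) ((if O1 = O2 then \<alpha> else (\<lambda>_. 0)) ij)"
      proof (cases "O1 = O2")
        case True
        then show ?thesis using \<alpha>(2)[OF ij] by (simp add: cut_def)
      next
        case False
        then have "ij \<in> O1 \<Longrightarrow> ij \<notin> O2" using disj[OF O1 that(2)] by blast
        then show ?thesis using \<alpha>(2)[OF ij] False by (simp add: cut_def)
      qed
    qed
  qed
  show "proj O1 g = g" if g: "g \<in> fv_hom_supp R J N I M O1" for g
  proof -
    obtain \<alpha> where \<alpha>: "\<alpha> \<in> supp_mats O1" "g = mat_hom \<alpha>" using g unfolding fv_hom_supp_eq by blast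
    then have "\<alpha> \<in> wvecs" by (simp add: supp_mats_def)
    then show ?thesis using cut_supp[OF \<alpha>(1) O1] by (simp add: \<alpha>(2) proj_mat_hom)
  qed
  show "proj O1 g = \<one>\<^bsub>HG\<^esub>" if "O2 \<in> B" "O1 \<noteq> O2" and g: "g \<in> fv_hom_supp R J N I M O2" for O2 g
  proof -
    obtain \<alpha> where \<alpha>: "\<alpha> \<in> supp_mats O2" "g = mat_hom \<alpha>" using g unfolding fv_hom_supp_eq by blast
    then have "\<alpha> \<in> wvecs" by (simp add: supp_mats_def)
    then show ?thesis using cut_supp[OF \<alpha>(1) that(1)] that(2) by (simp add: \<alpha>(2) proj_mat_hom one_HG)
  qed
next
  fix g assume "g \<in> carrier HG"
  then obtain \<alpha> where \<alpha>: "\<alpha> \<in> wvecs" "frob_ver_mat \<alpha>" "g = mat_hom \<alpha>" unfolding carrier_HG by blast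
  have "finprod HG (\<lambda>O'. proj O' g) C = mat_hom (cut (\<Union>C) \<alpha>)" if "finite C" "C \<subseteq> B" for C
    using that
  proof (induction C rule: finite_induct)
    case empty
    then show ?case by (simp add: one_HG cut_def)
  next
    case (insert O1 C)
    have cl: "proj O' g \<in> carrier HG" if "O' \<in> B" for O'
      unfolding \<alpha>(3) proj_mat_hom[OF \<alpha>(1)] mat_hom_HG_iff[OF cut_wvecs[OF \<alpha>(1)]]
      by (rule frob_ver_mat_cut[OF \<alpha>(2) B(2)[OF that]])
    have "finprod HG (\<lambda>O'. proj O' g) (insert O1 C) = proj O1 g \<otimes>\<^bsub>HG\<^esub> finprod HG (\<lambda>O'. proj O' g) C"
      using insert cl by (intro HG.finprod_insert) auto
    also have "\<dots> = mat_hom (\<lambda>ij. cut O1 \<alpha> ij + cut (\<Union>C) \<alpha> ij)"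
      using insert mult_HG[OF cut_wvecs[OF \<alpha>(1)] cut_wvecs[OF \<alpha>(1)]] by (simp add: \<alpha>(3) proj_mat_hom[OF \<alpha>(1)])
    also have "(\<lambda>ij. cut O1 \<alpha> ij + cut (\<Union>C) \<alpha> ij) = cut (\<Union>(insert O1 C)) \<alpha>"
    proof
      fix ij
      have "ij \<notin> \<Union>C" if "ij \<in> O1"
        using disj[of O1] insert that by blast
      then show "cut O1 \<alpha> ij + cut (\<Union>C) \<alpha> ij = cut (\<Union>(insert O1 C)) \<alpha> ij"
        by (auto simp: cut_def)
    qed
    finally show ?case .
  qed
  from this[OF B(1)] have "finprod HG (\<lambda>O'. proj O' g) B = mat_hom (cut (I \<times> J) \<alpha>)"
    using B(3) by simp
  also have "\<dots> = g"
    unfolding \<alpha>(3) mat_hom_eq_iff[OF cut_wvecs[OF \<alpha>(1)] \<alpha>(1)] by (simp add: cut_def)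
  finally show "finprod HG (\<lambda>O'. proj O' g) B = g" .
qed

end

text \<open>x runs through one orbit with exact period m, and \<open>x_rel\<close> merges the
  conditions from F and V at each point into one equation of a cyclic system.\<close>

locale fv_orbit = fv_pair p ty f n S \<pi> s t \<rho> q I act_I c c' v J act_J d d' w +
  cyclic_system p ty f m "wphi p" "wphi_inv p" u a b
  for p :: nat and ty :: "'k::alg_closed_field itself" and f n
    and S :: "'s ring" and \<pi> s t \<rho> q
    and I :: "'i set" and act_I c c' v and J :: "'j set" and act_J d d' w and m u a b +
  fixes x :: "int \<Rightarrow> 'i \<times> 'j"
  assumes x_mem: "x k \<in> I \<times> J"
    and x_Suc: "x (k + 1) = (act_I (of_nat p) (fst (x k)), act_J (of_nat p) (snd (x k)))"
    and x_period: "x (k + int m) = x k"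
    and x_inj: "inj_on x {0..<int m}"
    and x_rel: "weq n (d' (snd (x k)) * z) (c' (fst (x k)) * wphi p y) \<and>
        weq n (w (snd (x k)) * y) (v (fst (x k)) * wphi_inv p z) \<longleftrightarrow>
      weq n (of_nat p ^ b k * (u k * z)) (of_nat p ^ a k * wphi p y)"
begin

definition orb :: "('i \<times> 'j) set" where "orb = range x"

definition idx :: "'i \<times> 'j \<Rightarrow> int" where "idx = the_inv_into {0..<int m} x"

lemma x_shift: "x (k + int m * l) = x k"
  by (rule int_periodic_shift[of x m, OF x_period])

lemma x_mod: "x (k mod int m) = x k"
  using x_shift[of "k mod int m" "k div int m"] by simp

lemma orb_eq: "orb = x ` {0..<int m}"
proof -
  have "x k \<in> x ` {0..<int m}" for k
    using x_mod[of k] m_pos by (intro image_eqI[of _ _ "k mod int m"]) auto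
  then show ?thesis by (auto simp: orb_def)
qed

lemma card_orb: "card orb = m"
  by (simp add: orb_eq card_image[OF x_inj])

lemma idx_x: "idx (x k) = k mod int m"
proof -
  have "idx (x (k mod int m)) = k mod int m"
    unfolding idx_def by (rule the_inv_into_f_f[OF x_inj]) (use m_pos in simp)
  then show ?thesis by (simp add: x_mod)
qed

definition orb_mat :: "(int \<Rightarrow> 'k witt) \<Rightarrow> 'i \<times> 'j \<Rightarrow> 'k witt" where
  "orb_mat \<alpha> = (\<lambda>ij. if ij \<in> orb then \<alpha> (idx ij) else 0)"

lemma orb_mat_x:
  assumes "\<And>k. \<alpha> (k + int m) = \<alpha> k"
  shows "orb_mat \<alpha> (x k) = \<alpha> k"
proof -
  have "\<alpha> (k mod int m + int m * (k div int m)) = \<alpha> (k mod int m)"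
    by (rule int_periodic_shift[of \<alpha> m, OF assms])
  then show ?thesis by (simp add: orb_mat_def orb_def idx_x)
qed

text \<open>For the backward direction, multiplication by p is injective on I and on J, so the
  predecessor of a point of the orbit is the preceding point of the walk.\<close>

lemma orb_step: "i \<in> I \<Longrightarrow> j \<in> J \<Longrightarrow> (gI i, gJ j) \<in> orb \<longleftrightarrow> (i, j) \<in> orb"
proof
  assume ij: "i \<in> I" "j \<in> J"
  show "(i, j) \<in> orb \<Longrightarrow> (gI i, gJ j) \<in> orb"
  proof -
    assume "(i, j) \<in> orb"
    then obtain k where k: "(i, j) = x k" by (auto simp: orb_def)
    have "(gI i, gJ j) = x (k + 1)" by (simp add: x_Suc flip: k)
    then show "(gI i, gJ j) \<in> orb" by (simp add: orb_def)
  qed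
  assume "(gI i, gJ j) \<in> orb"
  then obtain k where "(gI i, gJ j) = x k" by (auto simp: orb_def)
  then have "(gI i, gJ j) = (gI (fst (x (k - 1))), gJ (snd (x (k - 1))))" using x_Suc[of "k - 1"] by simp
  moreover obtain i' j' where ij': "x (k - 1) = (i', j')" by (cases "x (k - 1)")
  moreover have "i' \<in> I" "j' \<in> J" using x_mem[of "k - 1"] ij' by auto
  ultimately have e: "gI i = gI i'" "gJ j = gJ j'" and ij'_mem: "i' \<in> I" "j' \<in> J" by auto
  have "i = i'" using arg_cong[OF e(1), of gI'] unfolding act_I(3)[OF ij(1)] act_I(3)[OF ij'_mem(1)] .
  moreover have "j = j'" using arg_cong[OF e(2), of gJ'] unfolding act_J(3)[OF ij(2)] act_J(3)[OF ij'_mem(2)] .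
  ultimately have "(i, j) = x (k - 1)" using ij' by simp
  then show "(i, j) \<in> orb" unfolding orb_def by simp
qed

lemma frob_ver_mat_orb_iff:
  assumes "\<And>ij. ij \<in> I \<times> J \<Longrightarrow> ij \<notin> orb \<Longrightarrow> \<alpha> ij = 0"
  shows "frob_ver_mat \<alpha> \<longleftrightarrow> rel n (\<lambda>k. \<alpha> (x k))"
proof
  assume fv: "frob_ver_mat \<alpha>"
  show "rel n (\<lambda>k. \<alpha> (x k))"
    unfolding rel_def
  proof
    fix k
    obtain i j where ij: "x k = (i, j)" by (cases "x k")
    then have "i \<in> I" "j \<in> J" using x_mem[of k] by auto
    then show "weq n (pp ^ b k * (u k * \<alpha> (x (k + 1)))) (pp ^ a k * wphi p (\<alpha> (x k)))"
      unfolding x_rel[symmetric] using fv by (simp add: frob_ver_mat_def x_Suc ij)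
  qed
next
  assume r: "rel n (\<lambda>k. \<alpha> (x k))"
  show "frob_ver_mat \<alpha>"
    unfolding frob_ver_mat_def
  proof (intro ballI)
    fix i j assume ij: "i \<in> I" "j \<in> J"
    show "weq n (d' j * \<alpha> (gI i, gJ j)) (c' i * wphi p (\<alpha> (i, j))) \<and>
        weq n (w j * \<alpha> (i, j)) (v i * wphi_inv p (\<alpha> (gI i, gJ j)))"
    proof (cases "(i, j) \<in> orb")
      case True
      then obtain k where k: "(i, j) = x k" by (auto simp: orb_def)
      have "weq n (pp ^ b k * (u k * \<alpha> (x (k + 1)))) (pp ^ a k * wphi p (\<alpha> (x k)))"
        using r by (simp add: rel_def)
      then show ?thesis
        unfolding x_rel[symmetric] by (simp add: x_Suc flip: k)
    next
      case False
      then have "\<alpha> (i, j) = 0" "\<alpha> (gI i, gJ j) = 0"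
        using ij orb_step[OF ij] act_I(1) act_J(1) assms by auto
      then show ?thesis by (simp add: phi.map_0 phi_inv.map_0)
    qed
  qed
qed

text \<open>The normal form of the entries gives injectivity. In the other direction a matrix is
  read along the orbit and its entries are truncated, which changes neither the map nor the
  equations modulo p^n.\<close>

lemma bij_betw_sols: "bij_betw (\<lambda>\<alpha>. mat_hom (orb_mat \<alpha>)) (sols n) (fv_hom_supp R J N I M orb)"
  unfolding fv_hom_supp_eq bij_betw_def
proof
  have orb_sub: "orb \<subseteq> I \<times> J" using x_mem unfolding orb_def by blast
  have w: "orb_mat \<alpha> \<in> wvecs" if "\<alpha> \<in> sols n" for \<alpha>
    using solsD(1)[OF that] wring_closed(1) by (simp add: wvecs_def orb_mat_def)
  show "inj_on (\<lambda>\<alpha>. mat_hom (orb_mat \<alpha>)) (sols n)"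
  proof (rule inj_onI)
    fix \<alpha> \<beta> assume ab: "\<alpha> \<in> sols n" "\<beta> \<in> sols n" "mat_hom (orb_mat \<alpha>) = mat_hom (orb_mat \<beta>)"
    show "\<alpha> = \<beta>"
    proof
      fix k
      have "weq n (orb_mat \<alpha> (x k)) (orb_mat \<beta> (x k))"
        using ab(3) unfolding mat_hom_eq_iff[OF w[OF ab(1)] w[OF ab(2)]] by (rule bspec[OF _ x_mem])
      then have "wtrunc n (\<alpha> k) = wtrunc n (\<beta> k)"
        using solsD(3)[OF ab(1)] solsD(3)[OF ab(2)] by (simp add: orb_mat_x wtrunc_eq_iff)
      then show "\<alpha> k = \<beta> k" using solsD(2)[OF ab(1)] solsD(2)[OF ab(2)] by simp
    qed
  qed
  have "mat_hom (orb_mat \<alpha>) \<in> mat_hom ` supp_mats orb" if \<alpha>: "\<alpha> \<in> sols n" for \<alpha>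
  proof -
    have "rel n (\<lambda>k. orb_mat \<alpha> (x k))"
      using solsD(4)[OF \<alpha>] by (simp add: orb_mat_x[of \<alpha>, OF solsD(3)[OF \<alpha>]])
    then have "frob_ver_mat (orb_mat \<alpha>)"
      by (subst frob_ver_mat_orb_iff) (simp_all add: orb_mat_def)
    then show ?thesis using w[OF \<alpha>] by (intro imageI) (simp add: supp_mats_def orb_mat_def)
  qed
  moreover have "mat_hom \<beta> \<in> (\<lambda>\<alpha>. mat_hom (orb_mat \<alpha>)) ` sols n" if \<beta>: "\<beta> \<in> supp_mats orb" for \<beta>
  proof -
    have b: "\<beta> \<in> wvecs" "frob_ver_mat \<beta>" "\<And>ij. ij \<in> I \<times> J \<Longrightarrow> ij \<notin> orb \<Longrightarrow> \<beta> ij = 0"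
      using \<beta> by (auto simp: supp_mats_def)
    define \<alpha> where "\<alpha> k = wtrunc n (\<beta> (x k))" for k
    have "rel n (\<lambda>k. \<beta> (x k))" using b frob_ver_mat_orb_iff by blast
    then have "rel n \<alpha>"
      unfolding rel_def
    proof (intro allI)
      fix k
      assume "\<forall>k. weq n (pp ^ b k * (u k * \<beta> (x (k + 1)))) (pp ^ a k * wphi p (\<beta> (x k)))"
      then have *: "weq n (pp ^ b k * (u k * \<beta> (x (k + 1)))) (pp ^ a k * wphi p (\<beta> (x k)))" by blast
      have "weq n (pp ^ b k * (u k * \<alpha> (k + 1))) (pp ^ b k * (u k * \<beta> (x (k + 1))))"
        by (rule weq_mult[OF weq_refl weq_mult[OF weq_refl]]) (simp add: \<alpha>_def)
      also note *
      also have "weq n (pp ^ a k * wphi p (\<beta> (x k))) (pp ^ a k * wphi p (\<alpha> k))"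
        by (rule weq_mult[OF weq_refl]) (simp add: \<alpha>_def weq_sym)
      finally show "weq n (pp ^ b k * (u k * \<alpha> (k + 1))) (pp ^ a k * wphi p (\<alpha> k))" .
    qed
    moreover have "\<alpha> k \<in> W" for k
    proof -
      have "\<beta> (x k) \<in> W" using b(1) unfolding wvecs_def by blast
      then show ?thesis by (simp add: \<alpha>_def wring_wtrunc)
    qed
    ultimately have \<alpha>: "\<alpha> \<in> sols n"
      by (simp add: sols_def) (simp add: \<alpha>_def x_period wtrunc_eq_iff)
    have "mat_hom (orb_mat \<alpha>) = mat_hom \<beta>"
      unfolding mat_hom_eq_iff[OF w[OF \<alpha>] b(1)]
    proof
      fix ij assume ij: "ij \<in> I \<times> J"
      show "weq n (orb_mat \<alpha> ij) (\<beta> ij)"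
      proof (cases "ij \<in> orb")
        case True
        then obtain k where "ij = x k" by (auto simp: orb_def)
        then show ?thesis using orb_mat_x[of \<alpha> k, OF solsD(3)[OF \<alpha>]] by (simp add: \<alpha>_def)
      qed (use ij b(3) in \<open>simp add: orb_mat_def\<close>)
    qed
    then show ?thesis using \<alpha> by (metis imageI)
  qed
  ultimately show "(\<lambda>\<alpha>. mat_hom (orb_mat \<alpha>)) ` sols n = mat_hom ` supp_mats orb"
    by blast
qed

lemma card_supp_bounds:
  assumes "n = enat l" "l \<ge> m"
  shows "(p ^ f) ^ min A B \<le> card (fv_hom_supp R J N I M orb)"
    "card (fv_hom_supp R J N I M orb) \<le> p ^ (l * m) * (p ^ f) ^ min A B"
  using card_sols_bounds[OF refl assms(2)] bij_betw_same_card[OF bij_betw_sols] assms(1) by simp_all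

text \<open>The at most p^m representatives of exact solutions modulo p become the digits for the
  expansion to base p in the group.\<close>

lemma card_quot_mult_supp:
  assumes "n = \<infinity>"
  shows "finite (carrier (quot_mult (p ^ l) (restrict_group HG (fv_hom_supp R J N I M orb)))) \<and>
    card (carrier (quot_mult (p ^ l) (restrict_group HG (fv_hom_supp R J N I M orb)))) \<le> p ^ (l * m)"
proof -
  let ?K = "fv_hom_supp R J N I M orb"
  let ?H = "\<lambda>\<alpha>. mat_hom (orb_mat \<alpha>)"
  have K: "subgroup ?K HG" unfolding fv_hom_supp_eq by (rule subgroup_supp)
  have img: "?H ` sols \<infinity> = ?K" using bij_betw_sols assms by (simp add: bij_betw_def)
  have cg: "comm_group (restrict_group HG ?K)"
    unfolding restrict_group_def
    by (rule group.group_comm_groupI[OF HG.subgroup_imp_group[OF K]])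
      (use subgroup.mem_carrier[OF K] HG.m_comm in auto)
  have w: "orb_mat \<alpha> \<in> wvecs" if "\<alpha> \<in> sols \<infinity>" for \<alpha>
    using solsD(1)[OF that] wring_closed(1) by (simp add: wvecs_def orb_mat_def)
  obtain C where C: "C \<subseteq> sols \<infinity>" "finite C" "card C \<le> p ^ m"
    "\<And>\<alpha>. \<alpha> \<in> sols \<infinity> \<Longrightarrow> \<exists>\<beta>\<in>C. \<exists>\<gamma>\<in>sols \<infinity>. \<forall>k. \<alpha> k = \<beta> k + pp * \<gamma> k"
    using exact_sols_mod_p[OF refl] by blast
  have cover: "\<exists>e\<in>?H ` C. \<exists>h\<in>carrier (restrict_group HG ?K). g = e \<otimes>\<^bsub>restrict_group HG ?K\<^esub> h [^]\<^bsub>restrict_group HG ?K\<^esub> p"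
    if g: "g \<in> carrier (restrict_group HG ?K)" for g
  proof -
    obtain \<alpha> where \<alpha>: "\<alpha> \<in> sols \<infinity>" "g = ?H \<alpha>" using g img by (auto simp: restrict_group_def)
    obtain \<beta> \<gamma> where bg: "\<beta> \<in> C" "\<gamma> \<in> sols \<infinity>" "\<And>k. \<alpha> k = \<beta> k + pp * \<gamma> k" using C(4)[OF \<alpha>(1)] by blast
    have b: "\<beta> \<in> sols \<infinity>" using bg C by blast
    have pow: "x [^]\<^bsub>restrict_group HG ?K\<^esub> (l::nat) = x [^]\<^bsub>HG\<^esub> l" for x l
      by (simp add: restrict_group_def nat_pow_def)
    have "?H \<beta> \<otimes>\<^bsub>HG\<^esub> ?H \<gamma> [^]\<^bsub>HG\<^esub> p = mat_hom (\<lambda>ij. orb_mat \<beta> ij + pp * orb_mat \<gamma> ij)"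
      unfolding pow_HG[OF w[OF bg(2)]] by (rule mult_HG[OF w[OF b] wvecs_scale[OF wring_closed(3) w[OF bg(2)]]])
    also have "(\<lambda>ij. orb_mat \<beta> ij + pp * orb_mat \<gamma> ij) = orb_mat \<alpha>"
      by (auto simp: orb_mat_def bg(3))
    finally have "g = ?H \<beta> \<otimes>\<^bsub>HG\<^esub> ?H \<gamma> [^]\<^bsub>HG\<^esub> p" using \<alpha> by simp
    moreover have "?H \<gamma> \<in> carrier (restrict_group HG ?K)" using bg(2) img by (auto simp: restrict_group_def)
    moreover have "monoid.mult (restrict_group HG ?K) = monoid.mult HG" by (simp add: restrict_group_def)
    ultimately show ?thesis using bg(1) by (metis imageI pow)
  qed
  have "?H ` C \<subseteq> carrier (restrict_group HG ?K)" using C(1) img by (auto simp: restrict_group_def)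
  from card_quot_mult_power_le[OF cg finite_imageI[OF C(2)] this cover]
  have "finite (carrier (quot_mult (p ^ l) (restrict_group HG ?K))) \<and>
    card (carrier (quot_mult (p ^ l) (restrict_group HG ?K))) \<le> card (?H ` C) ^ l" .
  moreover have "card (?H ` C) ^ l \<le> (p ^ m) ^ l"
    using card_image_le[OF C(2), of ?H] C(3) by (intro power_mono) auto
  moreover have "(p ^ m) ^ l = p ^ (l * m)" by (simp add: mult.commute flip: power_mult)
  ultimately show ?thesis by simp
qed

end

section \<open>The rings \<open>W(\<bbbF>\<^sub>Q)\<close> and their truncations\<close>

context witt_field
begin

lemma WF_ops:
  fixes x y :: "'k witt"
  shows "\<zero>\<^bsub>WF p Q\<^esub> = wcomp (0 :: 'k witt)" "\<one>\<^bsub>WF p Q\<^esub> = wcomp (1 :: 'k witt)"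
    "wcomp x \<oplus>\<^bsub>WF p Q\<^esub> wcomp y = wcomp (x + y)" "wcomp x \<otimes>\<^bsub>WF p Q\<^esub> wcomp y = wcomp (x * y)"
  by (simp_all add: WF_def witt_ring_def zero_witt_def one_witt_def plus_witt_def times_witt_def)

lemma p_elt_WF: "p_elt p (WF p Q) = wcomp pp"
proof -
  have "[k] \<cdot>\<^bsub>WF p Q\<^esub> \<one>\<^bsub>WF p Q\<^esub> = wcomp (of_nat k :: 'k witt)" for k :: nat
  proof (induction k)
    case 0
    show ?case by (simp add: add_pow_def nat_pow_def WF_ops)
  next
    case (Suc k)
    have "[Suc k] \<cdot>\<^bsub>WF p Q\<^esub> \<one>\<^bsub>WF p Q\<^esub> = [k] \<cdot>\<^bsub>WF p Q\<^esub> \<one>\<^bsub>WF p Q\<^esub> \<oplus>\<^bsub>WF p Q\<^esub> \<one>\<^bsub>WF p Q\<^esub>"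
      by (simp add: add_pow_def nat_pow_def)
    also have "\<dots> = wcomp (of_nat (Suc k) :: 'k witt)"
      unfolding Suc unfolding WF_ops(2,3) by (simp add: add.commute)
    finally show ?case .
  qed
  then show ?thesis by (simp add: p_elt_def)
qed

lemma p_elt_power_WF: "p_elt p (WF p Q) [^]\<^bsub>WF p Q\<^esub> (n :: nat) = wcomp (pp ^ n)"
  by (induction n) (simp_all add: p_elt_WF WF_ops mult.commute)

lemma divides_WF_iff:
  fixes x :: "'k witt"
  assumes "x \<in> wring (p ^ f)"
  shows "(p_elt p (WF p (p ^ f)) [^]\<^bsub>WF p (p ^ f)\<^esub> (n :: nat)) divides\<^bsub>WF p (p ^ f)\<^esub> wcomp x \<longleftrightarrow> weq (enat n) x 0"
proof
  assume "(p_elt p (WF p (p ^ f)) [^]\<^bsub>WF p (p ^ f)\<^esub> n) divides\<^bsub>WF p (p ^ f)\<^esub> wcomp x"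
  then obtain y where "wcomp x = wcomp (pp ^ n * y)"
    by (auto simp: factor_def p_elt_power_WF carrier_WF_wring WF_ops)
  then show "weq (enat n) x 0" by (simp add: weq_enat_iff_dvd wcomp_inject)
next
  assume "weq (enat n) x 0"
  from wring_p_multE[OF assms this] obtain y where "y \<in> wring (p ^ f)" "x = pp ^ n * y" .
  then show "(p_elt p (WF p (p ^ f)) [^]\<^bsub>WF p (p ^ f)\<^esub> n) divides\<^bsub>WF p (p ^ f)\<^esub> wcomp x"
    by (auto simp: factor_def p_elt_power_WF carrier_WF_wring WF_ops)
qed

text \<open>A finite valuation is attained, and by maximality the cofactor has nonzero residue. It
  is thus a unit, with inverse in the same finite Witt ring.\<close>

lemma ord_p_unit_decomposition:
  assumes c: "c \<in> carrier (WF p (p ^ f))" and ord: "ord_p p (WF p (p ^ f)) c = enat e"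
  shows "\<exists>x y. x \<in> wring (p ^ f) \<and> y \<in> wring (p ^ f) \<and> x * y = (1 :: 'k witt) \<and> c = wcomp (pp ^ e * x)"
proof -
  obtain z where z: "z \<in> wring (p ^ f)" "c = wcomp z" using c by (auto simp: carrier_WF_wring)
  let ?S = "{enat n | n. weq (enat n) z 0}"
  have S: "Sup ?S = enat e"
    using ord unfolding ord_p_def z(2) divides_WF_iff[OF z(1)] .
  \<comment> \<open>The supremum of a nonempty set of extended naturals with a finite bound is its
    maximum.\<close>
  have "enat e \<in> ?S"
  proof -
    have "weq (enat 0) z 0" by (simp add: weq_def zero_enat_def[symmetric])
    then have ne: "?S \<noteq> {}" by blast
    have "finite ?S"
      by (rule finite_enat_bounded[of _ e]) (use S Sup_upper[of _ ?S] in auto)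
    then have "Max ?S \<in> ?S" using ne by (rule Max_in)
    moreover have "Sup ?S = Max ?S"
      unfolding Sup_enat_def by (simp only: ne \<open>finite ?S\<close> if_False if_True)
    ultimately show ?thesis using S by simp
  qed
  then have "weq (enat e) z 0" by blast
  from wring_p_multE[OF z(1) this] obtain x where x: "x \<in> wring (p ^ f)" "z = pp ^ e * x" .
  have "wcomp x 0 \<noteq> 0"
  proof
    assume "wcomp x 0 = 0"
    then have "weq (enat (Suc e)) z 0"
      unfolding x(2) by (auto simp: weq_def wcomp_p_power_mult less_Suc_eq power_0_left)
    then have "enat (Suc e) \<le> Sup ?S" by (intro Sup_upper) blast
    then show False using S by simp
  qed
  then obtain y where "x * y = 1" using witt_unit_iff by blast
  then show ?thesis using x z wring_inverse[OF x(1)] by blast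
qed

lemma inv_wfrob: "inv_into UNIV (wfrob p) (wcomp x) = wcomp (wphi_inv p (x :: 'k witt))"
proof (rule inv_into_f_eq)
  show "inj (wfrob p :: 'k wvec \<Rightarrow> 'k wvec)"
  proof (rule injI)
    fix a b :: "'k wvec" assume "wfrob p a = wfrob p b"
    then have "wphi p (Witt a) = wphi p (Witt b)" by (simp add: wphi_def)
    then show "a = b" by (metis wphi_inv_wphi wcomp_Witt)
  qed
  have "wcomp (wphi p (wphi_inv p x)) = wfrob p (wcomp (wphi_inv p x))"
    by (simp only: wphi_def wcomp_Witt)
  then show "wfrob p (wcomp (wphi_inv p x)) = wcomp x" by simp
qed simp

text \<open>With y inverse to x, the quotient of p by the inverse Frobenius of p^e x is p^(1-e)
  times the inverse Frobenius of y; uniqueness comes from cancelling p^e and the unit.\<close>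

lemma exact_quot_WF:
  assumes x: "x \<in> wring (p ^ f)" "y \<in> wring (p ^ f)" "x * y = (1 :: 'k witt)" and e: "e \<le> 1"
  shows "exact_quot (WF p (p ^ f)) (p_elt p (WF p (p ^ f))) (inv_into UNIV (wfrob p) (wcomp (pp ^ e * x)))
    = wcomp (pp ^ (1 - e) * wphi_inv p y)"
  unfolding exact_quot_def
proof (rule the_equality)
  interpret i: comm_ring_map "wphi_inv p :: 'k witt \<Rightarrow> 'k witt" by (rule comm_ring_map_wphi_inv)
  have ix: "wphi_inv p (pp ^ e * x) = pp ^ e * wphi_inv p x"
    by (simp add: i.map_mult i.map_power i.map_of_nat)
  have xy: "wphi_inv p x * wphi_inv p y = 1" using x(3) by (metis i.map_1 i.map_mult)
  have pe: "pp ^ (1 - e) * pp ^ e = pp" using e by (simp flip: power_add)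
  have "pp ^ (1 - e) * wphi_inv p y * (pp ^ e * wphi_inv p x) = (pp ^ (1 - e) * pp ^ e) * (wphi_inv p x * wphi_inv p y)"
    by (simp only: mult_ac)
  also have "\<dots> = pp" by (simp only: pe xy mult_1_right)
  finally have "wcomp (pp ^ (1 - e) * wphi_inv p y) \<otimes>\<^bsub>WF p (p ^ f)\<^esub> inv_into UNIV (wfrob p) (wcomp (pp ^ e * x)) = p_elt p (WF p (p ^ f))"
    unfolding inv_wfrob WF_ops(4) p_elt_WF ix by (rule arg_cong)
  moreover have "pp ^ (1 - e) * wphi_inv p y \<in> wring (p ^ f)"
    by (intro wring_closed(6,8,3)) (simp add: wring_wphi_inv x)
  ultimately show "wcomp (pp ^ (1 - e) * wphi_inv p y) \<in> carrier (WF p (p ^ f)) \<and>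
      wcomp (pp ^ (1 - e) * wphi_inv p y) \<otimes>\<^bsub>WF p (p ^ f)\<^esub> inv_into UNIV (wfrob p) (wcomp (pp ^ e * x)) = p_elt p (WF p (p ^ f))"
    by (simp add: carrier_WF_wring)
  fix w assume w: "w \<in> carrier (WF p (p ^ f)) \<and> w \<otimes>\<^bsub>WF p (p ^ f)\<^esub> inv_into UNIV (wfrob p) (wcomp (pp ^ e * x)) = p_elt p (WF p (p ^ f))"
  then obtain z where z: "w = wcomp z" by (auto simp: carrier_WF_wring)
  have "z * (pp ^ e * wphi_inv p x) = pp"
    using w unfolding z inv_wfrob WF_ops(4) p_elt_WF ix by (simp add: wcomp_inject)
  moreover have "pp ^ e * (z * (wphi_inv p x * wphi_inv p y)) = (z * (pp ^ e * wphi_inv p x)) * wphi_inv p y"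
    by (simp only: mult_ac)
  moreover have "pp ^ e * (pp ^ (1 - e) * wphi_inv p y) = (pp ^ (1 - e) * pp ^ e) * wphi_inv p y"
    by (simp only: mult_ac)
  ultimately have "pp ^ e * (z * (wphi_inv p x * wphi_inv p y)) = pp ^ e * (pp ^ (1 - e) * wphi_inv p y)"
    by (simp only: pe)
  then have "z = pp ^ (1 - e) * wphi_inv p y"
    by (simp only: p_power_mult_cancel xy mult_1_right)
  then show "w = wcomp (pp ^ (1 - e) * wphi_inv p y)" by (simp add: z)
qed

lemma witt_quotient_full:
  assumes "f \<ge> 1"
  shows "witt_quotient p f \<infinity> (WF p (p ^ f)) id (wfrob p) (inv_into UNIV (wfrob p)) (wcomp :: 'k witt \<Rightarrow> _)"
proof unfold_locales
  fix x :: "'k witt"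
  show "wfrob p (wcomp x) = wcomp (wphi p x)" by (simp add: wphi_def)
  show "inv_into UNIV (wfrob p) (wcomp x) = wcomp (wphi_inv p x)" by (rule inv_wfrob)
qed (use assms in \<open>simp_all add: carrier_WF_wring WF_ops wcomp_inject\<close>)

lemma pn_ideal_WF:
  "pn_ideal p n (WF p (p ^ f)) = (\<lambda>z. wcomp (z * pp ^ n)) ` (wring (p ^ f) :: 'k witt set)"
proof -
  have "pn_ideal p n (WF p (p ^ f)) = {z \<otimes>\<^bsub>WF p (p ^ f)\<^esub> wcomp (pp ^ n) | z. z \<in> wcomp ` (wring (p ^ f) :: 'k witt set)}"
    by (simp add: pn_ideal_def cgenideal_def p_elt_power_WF carrier_WF_wring)
  then show ?thesis
    by (simp only: Setcompr_eq_image image_image WF_ops)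
qed

lemma r_coset_pn_ideal_image:
  "pn_ideal p n (WF p (p ^ f)) +>\<^bsub>WF p (p ^ f)\<^esub> wcomp x
    = (\<lambda>z. wcomp (z * pp ^ n + x)) ` (wring (p ^ f) :: 'k witt set)"
  unfolding pn_ideal_WF a_r_coset_def' by (simp only: UNION_singleton_eq_range image_image WF_ops)

text \<open>Congruence is divisibility of the difference by p^n in the large ring; the cofactor lies
  in the small ring, so the difference is in the ideal.\<close>

lemma r_coset_pn_ideal:
  assumes "x \<in> wring (p ^ f)"
  shows "pn_ideal p n (WF p (p ^ f)) +>\<^bsub>WF p (p ^ f)\<^esub> wcomp x
    = wcomp ` {y \<in> wring (p ^ f). weq (enat n) y (x :: 'k witt)}"
proof -
  let ?W = "wring (p ^ f) :: 'k witt set"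
  have "pn_ideal p n (WF p (p ^ f)) +>\<^bsub>WF p (p ^ f)\<^esub> wcomp x = (\<lambda>z. wcomp (z * pp ^ n + x)) ` ?W"
    by (rule r_coset_pn_ideal_image)
  also have "\<dots> = wcomp ` (\<lambda>z. z * pp ^ n + x) ` ?W" by (simp add: image_image)
  also have "(\<lambda>z. z * pp ^ n + x) ` ?W = {y \<in> ?W. weq (enat n) y x}"
  proof (intro equalityI subsetI)
    fix y assume "y \<in> (\<lambda>z. z * pp ^ n + x) ` ?W"
    then show "y \<in> {y \<in> ?W. weq (enat n) y x}"
      using assms by (auto simp: weq_enat_iff_dvd intro!: wring_closed)
  next
    fix y assume y: "y \<in> {y \<in> ?W. weq (enat n) y x}"
    then have "y - x \<in> ?W" "weq (enat n) (y - x) 0" using assms weq_diff_iff[of "enat n" y x] by (auto intro: wring_closed)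
    from wring_p_multE[OF this] obtain z where "z \<in> ?W" "y - x = pp ^ n * z" .
    then show "y \<in> (\<lambda>z. z * pp ^ n + x) ` ?W"
      by (intro image_eqI[of _ _ z]) (simp_all add: algebra_simps)
  qed
  finally show ?thesis .
qed

lemma witt_quotient_trunc:
  assumes "f \<ge> 1"
  shows "witt_quotient p f (enat n) (WF p (p ^ f) Quot pn_ideal p n (WF p (p ^ f)))
    (\<lambda>a. pn_ideal p n (WF p (p ^ f)) +>\<^bsub>WF p (p ^ f)\<^esub> a) ((`) (wfrob p)) ((`) (inv_into UNIV (wfrob p)))
    (\<lambda>x :: 'k witt. pn_ideal p n (WF p (p ^ f)) +>\<^bsub>WF p (p ^ f)\<^esub> wcomp x)"
proof -
  let ?W = "wring (p ^ f) :: 'k witt set" and ?R = "WF p (p ^ f) :: 'k wvec ring"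
  let ?P = "pn_ideal p n ?R"
  let ?cl = "\<lambda>x :: 'k witt. wcomp ` {y \<in> ?W. weq (enat n) y x}"
  have cl_eq: "?cl x = ?cl y \<longleftrightarrow> weq (enat n) x y" if "x \<in> ?W" "y \<in> ?W" for x y
  proof
    assume "?cl x = ?cl y"
    then have "wcomp x \<in> ?cl y" using that by blast
    then show "weq (enat n) x y" by (auto simp: wcomp_inject)
  qed (auto simp: weq_def)
  have P0: "?P = ?cl 0"
  proof -
    have "?P = ?P +>\<^bsub>?R\<^esub> wcomp 0"
      by (simp only: r_coset_pn_ideal_image) (simp only: pn_ideal_WF add_0_right)
    then show ?thesis using r_coset_pn_ideal[of "0 :: 'k witt" f n] wring_closed(1) by simp
  qed
  show ?thesis
  proof unfold_locales
    show "1 \<le> f" by fact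
    show "carrier (?R Quot ?P) = (\<lambda>x :: 'k witt. ?P +>\<^bsub>?R\<^esub> wcomp x) ` ?W"
      by (auto simp: FactRing_def A_RCOSETS_def' carrier_WF_wring)
    show "\<zero>\<^bsub>?R Quot ?P\<^esub> = ?P +>\<^bsub>?R\<^esub> wcomp (0 :: 'k witt)"
      unfolding r_coset_pn_ideal[OF wring_closed(1)] P0[symmetric] by (simp add: FactRing_def)
    fix x :: "'k witt" assume x: "x \<in> ?W"
    show "(`) (wfrob p) (?P +>\<^bsub>?R\<^esub> wcomp x) = ?P +>\<^bsub>?R\<^esub> wcomp (wphi p x)"
      unfolding r_coset_pn_ideal[OF x] r_coset_pn_ideal[OF iffD2[OF wring_wphi x]]
    proof (intro equalityI subsetI)
      fix z assume "z \<in> wfrob p ` ?cl x"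
      then obtain y where "y \<in> ?W" "weq (enat n) y x" "z = wcomp (wphi p y)" by (auto simp: wphi_def)
      then show "z \<in> ?cl (wphi p x)" by (simp add: wring_wphi)
    next
      fix z assume "z \<in> ?cl (wphi p x)"
      then obtain y where y: "y \<in> ?W" "weq (enat n) y (wphi p x)" "z = wcomp y" by auto
      have "weq (enat n) (wphi_inv p y) x" using y(2) weq_wphi_inv[of "enat n" y "wphi p x"] by simp
      moreover have "z = wfrob p (wcomp (wphi_inv p y))"
        using y(3) wphi_wphi_inv[of y] by (metis wphi_def wcomp_Witt)
      ultimately show "z \<in> wfrob p ` ?cl x" using y(1) wring_wphi_inv by blast
    qed
    show "(`) (inv_into UNIV (wfrob p)) (?P +>\<^bsub>?R\<^esub> wcomp x) = ?P +>\<^bsub>?R\<^esub> wcomp (wphi_inv p x)"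
      unfolding r_coset_pn_ideal[OF x] r_coset_pn_ideal[OF iffD2[OF wring_wphi_inv x]] image_image inv_wfrob
    proof (intro equalityI subsetI)
      fix z assume "z \<in> ?cl (wphi_inv p x)"
      then obtain y where y: "y \<in> ?W" "weq (enat n) y (wphi_inv p x)" "z = wcomp y" by auto
      have "weq (enat n) (wphi p y) x" using y(2) weq_wphi[of "enat n" y "wphi_inv p x"] by simp
      then show "z \<in> (\<lambda>y. wcomp (wphi_inv p y)) ` {y \<in> ?W. weq (enat n) y x}"
        using y wring_wphi by (intro image_eqI[of _ _ "wphi p y"]) auto
    qed (auto simp: wring_wphi_inv)
    fix y :: "'k witt" assume y: "y \<in> ?W"
    show "?P +>\<^bsub>?R\<^esub> wcomp x = ?P +>\<^bsub>?R\<^esub> wcomp y \<longleftrightarrow> weq (enat n) x y"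
      unfolding r_coset_pn_ideal[OF x] r_coset_pn_ideal[OF y] by (rule cl_eq[OF x y])
    have xy: "x + y \<in> ?W" "x * y \<in> ?W" using x y by (simp_all add: wring_closed)
    show "(?P +>\<^bsub>?R\<^esub> wcomp x) \<oplus>\<^bsub>?R Quot ?P\<^esub> (?P +>\<^bsub>?R\<^esub> wcomp y) = ?P +>\<^bsub>?R\<^esub> wcomp (x + y)"
    proof -
      have "(?P +>\<^bsub>?R\<^esub> wcomp x) \<oplus>\<^bsub>?R Quot ?P\<^esub> (?P +>\<^bsub>?R\<^esub> wcomp y)
          = {wcomp x' \<oplus>\<^bsub>?R\<^esub> wcomp y' | x' y'. x' \<in> ?W \<and> weq (enat n) x' x \<and> y' \<in> ?W \<and> weq (enat n) y' y}"
        unfolding r_coset_pn_ideal[OF x] r_coset_pn_ideal[OF y] by (auto simp: FactRing_def set_add_defs)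
      also have "\<dots> = ?cl (x + y)"
      proof (intro equalityI subsetI)
        fix z assume "z \<in> ?cl (x + y)"
        then obtain z' where z': "z' \<in> ?W" "weq (enat n) z' (x + y)" "z = wcomp z'" by auto
        have "weq (enat n) (z' - x) (x + y - x)" by (rule weq_diff[OF z'(2) weq_refl])
        then have "z' - x \<in> ?W \<and> weq (enat n) (z' - x) y" using z' x by (simp add: wring_closed)
        moreover have "z = wcomp x \<oplus>\<^bsub>?R\<^esub> wcomp (z' - x)" using z' by (simp add: WF_ops)
        ultimately show "z \<in> {wcomp x' \<oplus>\<^bsub>?R\<^esub> wcomp y' | x' y'. x' \<in> ?W \<and> weq (enat n) x' x \<and> y' \<in> ?W \<and> weq (enat n) y' y}"
          using x by blast
      qed (auto simp: WF_ops intro!: wring_closed weq_add)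
      finally show ?thesis unfolding r_coset_pn_ideal[OF xy(1)] .
    qed
    show "(?P +>\<^bsub>?R\<^esub> wcomp x) \<otimes>\<^bsub>?R Quot ?P\<^esub> (?P +>\<^bsub>?R\<^esub> wcomp y) = ?P +>\<^bsub>?R\<^esub> wcomp (x * y)"
    proof -
      \<comment> \<open>The product in the quotient ring is a union of cosets over all pairs of
        representatives; they all coincide because congruence is multiplicative.\<close>
      have "?P +>\<^bsub>?R\<^esub> (wcomp x' \<otimes>\<^bsub>?R\<^esub> wcomp y') = ?P +>\<^bsub>?R\<^esub> wcomp (x * y)"
        if "x' \<in> ?W" "weq (enat n) x' x" "y' \<in> ?W" "weq (enat n) y' y" for x' y'
      proof -
        have xy': "x' * y' \<in> ?W" using that by (simp add: wring_closed)
        show ?thesis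
          unfolding WF_ops r_coset_pn_ideal[OF xy'] r_coset_pn_ideal[OF xy(2)] cl_eq[OF xy' xy(2)]
          by (rule weq_mult[OF that(2,4)])
      qed
      moreover have "wcomp x \<in> ?cl x" "wcomp y \<in> ?cl y" using x y by auto
      ultimately have "(\<Union>a\<in>?cl x. \<Union>b\<in>?cl y. ?P +>\<^bsub>?R\<^esub> (a \<otimes>\<^bsub>?R\<^esub> b)) = ?P +>\<^bsub>?R\<^esub> wcomp (x * y)"
        by blast
      then show ?thesis
        by (simp add: FactRing_def rcoset_mult_def r_coset_pn_ideal[OF x] r_coset_pn_ideal[OF y])
    qed
  qed simp_all
qed

end

section \<open>Orbits of the group generated by \<open>p\<close>\<close>

lemma group_rat_mult_group: "Group.group rat_mult_group"
  by (rule groupI) (auto simp: rat_mult_group_def intro!: bexI[of _ "inverse _"])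

text \<open>Exhibiting the elements as integer powers of p turns an action of the group into a walk
  indexed by the integers.\<close>

lemma carrier_p_group:
  assumes "p > 0"
  shows "carrier (p_group p) = range (\<lambda>k::int. (of_nat p :: rat) powi k)"
proof -
  interpret Group.group rat_mult_group by (rule group_rat_mult_group)
  let ?p = "of_nat p :: rat"
  have p: "?p \<in> carrier rat_mult_group" using assms by (simp add: rat_mult_group_def)
  have m_inv: "inv\<^bsub>rat_mult_group\<^esub> x = inverse x" if "x \<in> carrier rat_mult_group" for x
    by (rule inv_equality) (use that in \<open>auto simp: rat_mult_group_def\<close>)
  have "carrier (p_group p) = generate rat_mult_group {?p}"
    using p by (simp add: p_group_def carrier_subgroup_generated)
  also have "\<dots> = range (\<lambda>k::int. ?p powi k)"
  proof (intro equalityI subsetI)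
    fix x assume "x \<in> generate rat_mult_group {?p}"
    then show "x \<in> range (\<lambda>k::int. ?p powi k)"
    proof (induction rule: generate.induct)
      case one
      show ?case by (rule range_eqI[of _ _ 0]) (simp add: rat_mult_group_def)
    next
      case (incl h)
      then show ?case by (intro range_eqI[of _ _ 1]) simp
    next
      case (inv h)
      then show ?case using p by (intro range_eqI[of _ _ "-1"]) (simp add: m_inv power_int_minus)
    next
      case (eng g h)
      then obtain k l :: int where "g = ?p powi k" "h = ?p powi l" by auto
      then show ?case using assms by (intro range_eqI[of _ _ "k + l"]) (simp add: rat_mult_group_def power_int_add)
    qed
  next
    fix x assume "x \<in> range (\<lambda>k::int. ?p powi k)"
    then obtain k :: int where x: "x = ?p powi k" by auto
    have gp: "?p \<in> generate rat_mult_group {?p}" by (rule generate.incl) simp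
    have gi: "inverse ?p \<in> generate rat_mult_group {?p}"
      using generate.inv[of ?p "{?p}" rat_mult_group] m_inv[OF p] by simp
    have mem: "y ^ l \<in> generate rat_mult_group {?p}" if y: "y \<in> generate rat_mult_group {?p}" for y and l :: nat
    proof (induction l)
      case 0
      show ?case using generate.one[of rat_mult_group "{?p}"] by (simp add: rat_mult_group_def)
    next
      case (Suc l)
      show ?case using generate.eng[OF y Suc] by (simp add: rat_mult_group_def)
    qed
    show "x \<in> generate rat_mult_group {?p}"
      unfolding x power_int_def using mem[OF gp] mem[OF gi] by simp
  qed
  finally show ?thesis .
qed

lemma p_group_ops: "x \<otimes>\<^bsub>p_group p\<^esub> y = x * y" "\<one>\<^bsub>p_group p\<^esub> = 1"
  by (simp_all add: p_group_def subgroup_generated_def rat_mult_group_def)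

locale p_action =
  fixes p :: nat and E :: "'e set" and act :: "rat \<Rightarrow> 'e \<Rightarrow> 'e"
  assumes p_pos: "p > 0" and act: "group_action (p_group p) E act" and fin_E: "finite E"
begin

sublocale group_action "p_group p" E act by (rule act)

definition pw :: "int \<Rightarrow> 'e \<Rightarrow> 'e" where "pw k = act (of_nat p powi k)"

lemma pw_add: "x \<in> E \<Longrightarrow> pw (k + l) x = pw k (pw l x)"
  using composition_rule[of x "of_nat p powi k" "of_nat p powi l"] p_pos
  by (simp add: pw_def carrier_p_group p_group_ops power_int_add)

lemma pw_mem: "x \<in> E \<Longrightarrow> pw k x \<in> E"
  unfolding pw_def using element_image[of "of_nat p powi k" x] p_pos by (simp add: carrier_p_group)

lemma pw_0: "x \<in> E \<Longrightarrow> pw 0 x = x"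
  using fun_cong[OF id_eq_one, of x] by (simp add: pw_def p_group_ops)

lemma pw_1: "pw 1 = act (of_nat p)" "pw (- 1) = act (inverse (of_nat p))"
  by (simp_all add: pw_def power_int_minus)

lemma act_props:
  assumes "x \<in> E"
  shows "act (of_nat p) x \<in> E" "act (inverse (of_nat p)) x \<in> E"
    "act (inverse (of_nat p)) (act (of_nat p) x) = x" "act (of_nat p) (act (inverse (of_nat p)) x) = x"
proof -
  show "act (of_nat p) x \<in> E" "act (inverse (of_nat p)) x \<in> E"
    using pw_mem[OF assms, of 1] pw_mem[OF assms, of "- 1"] by (simp_all add: pw_1)
  show "act (inverse (of_nat p)) (act (of_nat p) x) = x" "act (of_nat p) (act (inverse (of_nat p)) x) = x"
    using pw_add[OF assms, of "- 1" 1] pw_add[OF assms, of 1 "- 1"] pw_0[OF assms] by (simp_all add: pw_1)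
qed

end

section \<open>Orbits in \<open>I \<times> J\<close>\<close>

text \<open>The data with units split off: \<epsilon> and \<eta> are the valuations of c and d, and
  cv, dv are the inverses of the units cu, du. The units are required on the whole index types, so
  no membership conditions accompany them.\<close>

locale fv_data = witt_field p ty for p :: nat and ty :: "'k::alg_closed_field itself" +
  fixes r :: nat
    and I :: "'i set" and act_I :: "rat \<Rightarrow> 'i \<Rightarrow> 'i" and c :: "'i \<Rightarrow> 'k wvec" and \<epsilon> :: "'i \<Rightarrow> nat" and cu cv :: "'i \<Rightarrow> 'k witt"
    and J :: "'j set" and act_J :: "rat \<Rightarrow> 'j \<Rightarrow> 'j" and d :: "'j \<Rightarrow> 'k wvec" and \<eta> :: "'j \<Rightarrow> nat" and du dv :: "'j \<Rightarrow> 'k witt"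
  assumes r_pos: "r \<ge> 1"
    and fin_I: "finite I" and fin_J: "finite J"
    and act_I: "group_action (p_group p) I act_I" and act_J: "group_action (p_group p) J act_J"
    and cu: "cu i \<in> wring (p ^ r)" "cv i \<in> wring (p ^ r)" "cu i * cv i = 1"
    and c_eq: "i \<in> I \<Longrightarrow> c i = wcomp (of_nat p ^ \<epsilon> i * cu i)" and eps: "\<epsilon> i \<in> {0, 1}"
    and du: "du j \<in> wring (p ^ r)" "dv j \<in> wring (p ^ r)" "du j * dv j = 1"
    and d_eq: "j \<in> J \<Longrightarrow> d j = wcomp (of_nat p ^ \<eta> j * du j)" and eta: "\<eta> j \<in> {0, 1}"
begin

sublocale AI: p_action p I act_I by (rule p_action.intro[OF p_gt_0 act_I fin_I])
sublocale AJ: p_action p J act_J by (rule p_action.intro[OF p_gt_0 act_J fin_J])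

definition walk :: "'i \<times> 'j \<Rightarrow> int \<Rightarrow> 'i \<times> 'j" where
  "walk z k = (AI.pw k (fst z), AJ.pw k (snd z))"

lemma walk_add: "z \<in> I \<times> J \<Longrightarrow> walk z (k + l) = walk (walk z l) k"
  by (auto simp: walk_def AI.pw_add AJ.pw_add)

lemma walk_mem: "z \<in> I \<times> J \<Longrightarrow> walk z k \<in> I \<times> J"
  by (auto simp: walk_def AI.pw_mem AJ.pw_mem)

lemma walk_0: "z \<in> I \<times> J \<Longrightarrow> walk z 0 = z"
  by (auto simp: walk_def AI.pw_0 AJ.pw_0)

lemma diag_orbits_eq: "diag_orbits p I act_I J act_J = (\<lambda>z. range (walk z)) ` (I \<times> J)"
proof -
  have "orbit (p_group p) (diag_act act_I act_J) z = range (walk z)" for z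
    unfolding orbit_def Setcompr_eq_image Collect_mem_eq carrier_p_group[OF p_gt_0] image_image
    by (simp add: diag_act_def walk_def[abs_def] AI.pw_def AJ.pw_def split_beta)
  then show ?thesis by (auto simp: diag_orbits_def orbits_def)
qed

lemma range_walk_shift:
  assumes "z \<in> I \<times> J"
  shows "range (walk (walk z k)) = range (walk z)"
proof (intro equalityI subsetI)
  fix y assume "y \<in> range (walk (walk z k))"
  then obtain l where "y = walk (walk z k) l" by auto
  then have "y = walk z (l + k)" using walk_add[OF assms] by simp
  then show "y \<in> range (walk z)" by simp
next
  fix y assume "y \<in> range (walk z)"
  then obtain l where "y = walk z l" by auto
  then have "y = walk z ((l - k) + k)" by simp
  then have "y = walk (walk z k) (l - k)" by (simp only: walk_add[OF assms])
  then show "y \<in> range (walk (walk z k))" by simp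
qed

lemma diag_orbits_partition:
  "finite (diag_orbits p I act_I J act_J)" "\<Union>(diag_orbits p I act_I J act_J) = I \<times> J"
  "O1 \<in> diag_orbits p I act_I J act_J \<Longrightarrow> O2 \<in> diag_orbits p I act_I J act_J \<Longrightarrow> O1 \<noteq> O2 \<Longrightarrow> O1 \<inter> O2 = {}"
proof -
  show "finite (diag_orbits p I act_I J act_J)"
    unfolding diag_orbits_eq using fin_I fin_J by simp
  show "\<Union>(diag_orbits p I act_I J act_J) = I \<times> J"
    unfolding diag_orbits_eq
  proof (intro equalityI subsetI)
    fix x assume "x \<in> \<Union>((\<lambda>z. range (walk z)) ` (I \<times> J))"
    then obtain z k where "z \<in> I \<times> J" "x = walk z k" by blast
    then show "x \<in> I \<times> J" using walk_mem by simp
  next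
    fix x assume x: "x \<in> I \<times> J"
    have "x \<in> range (walk x)" using walk_0[OF x] rangeI[of "walk x" 0] by simp
    then show "x \<in> \<Union>((\<lambda>z. range (walk z)) ` (I \<times> J))" using x by (rule UN_I[rotated])
  qed
  assume "O1 \<in> diag_orbits p I act_I J act_J" "O2 \<in> diag_orbits p I act_I J act_J" "O1 \<noteq> O2"
  then obtain z1 z2 where z: "z1 \<in> I \<times> J" "z2 \<in> I \<times> J" "O1 = range (walk z1)" "O2 = range (walk z2)"
    unfolding diag_orbits_eq by blast
  show "O1 \<inter> O2 = {}"
  proof (rule ccontr)
    assume "O1 \<inter> O2 \<noteq> {}"
    then obtain x where "x \<in> range (walk z1)" "x \<in> range (walk z2)" unfolding z(3,4) by blast
    then obtain k l where "walk z1 k = walk z2 l" by (elim imageE) simp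
    then have "O1 = O2" using range_walk_shift[OF z(1), of k] range_walk_shift[OF z(2), of l] z(3,4) by simp
    then show False using \<open>O1 \<noteq> O2\<close> by simp
  qed
qed

text \<open>By finiteness two times give the same point, and since the walk can be undone, the
  starting point recurs. The least return time is a period without repetitions.\<close>

lemma walk_periodic:
  assumes z: "z \<in> I \<times> J"
  obtains m :: nat where "m \<ge> 1" "\<And>k. walk z (k + int m) = walk z k" "inj_on (walk z) {0..<int m}"
proof -
  have ret: "\<exists>m::nat. m \<ge> 1 \<and> walk z (int m) = z"
  proof -
    have "finite (range (\<lambda>k::nat. walk z (int k)))"
      by (rule finite_subset[OF image_subsetI[OF walk_mem[OF z]] finite_SigmaI[OF fin_I fin_J]])
    then have "\<not> inj (\<lambda>k::nat. walk z (int k))" using finite_imageD infinite_UNIV_nat by blast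
    then obtain k' l' :: nat where kl': "k' \<noteq> l'" "walk z (int k') = walk z (int l')"
      by (auto simp: inj_def)
    obtain k l :: nat where kl: "k < l" "walk z (int k) = walk z (int l)"
    proof (cases "k' < l'")
      case True
      then show ?thesis using that kl' by blast
    next
      case False
      then show ?thesis using that[of l' k'] kl' by simp
    qed
    have "walk z (- int k + int k) = walk z (- int k + int l)"
      unfolding walk_add[OF z] kl(2) ..
    then have "walk z (int (l - k)) = z" using kl(1) walk_0[OF z] by (simp add: of_nat_diff)
    then show ?thesis using kl(1) by (intro exI[of _ "l - k"]) simp
  qed
  define m where "m = (LEAST m. m \<ge> 1 \<and> walk z (int m) = z)"
  have m: "m \<ge> 1 \<and> walk z (int m) = z" unfolding m_def by (rule LeastI_ex[OF ret])
  have least: "m \<le> l" if "l \<ge> 1" "walk z (int l) = z" for l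
    unfolding m_def by (rule Least_le) (use that in simp)
  show ?thesis
  proof (rule that)
    show "m \<ge> 1" using m by simp
    show "walk z (k + int m) = walk z k" for k using walk_add[OF z, of k "int m"] m by simp
    have no: False if kl: "0 \<le> k" "k < l" "l < int m" "walk z k = walk z l" for k l
    proof -
      have "walk z (- k + k) = walk z (- k + l)" unfolding walk_add[OF z] kl(4) ..
      then have "walk z (int (nat (l - k))) = z" using kl(2) walk_0[OF z] by simp
      then have "m \<le> nat (l - k)" using kl by (intro least) auto
      then show False using kl by linarith
    qed
    show "inj_on (walk z) {0..<int m}"
    proof (rule inj_onI, rule ccontr)
      fix k l assume "k \<in> {0..<int m}" "l \<in> {0..<int m}" "walk z k = walk z l" "k \<noteq> l"
      then show False using no[of k l] no[of l k] by (cases "k < l") auto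
    qed
  qed
qed

lemma unit_wcomp_0: "x * y = 1 \<Longrightarrow> wcomp (x :: 'k witt) 0 \<noteq> 0"
  using witt_unit_iff by blast

definition "plus_edge z = (if \<epsilon> (fst z) = 1 \<and> \<eta> (snd z) = 0 then 1 else 0 :: nat)"
definition "minus_edge z = (if \<epsilon> (fst z) = 0 \<and> \<eta> (snd z) = 1 then 1 else 0 :: nat)"

lemma fv_pair:
  assumes "witt_quotient p (r * \<nu>) n S \<pi> s t (\<rho> :: 'k witt \<Rightarrow> 's)"
  shows "fv_pair p (r * \<nu>) n S \<pi> s t \<rho> (p ^ r)
    I act_I c (\<lambda>i. of_nat p ^ \<epsilon> i * cu i) (\<lambda>i. of_nat p ^ (1 - \<epsilon> i) * wphi_inv p (cv i))
    J act_J d (\<lambda>j. of_nat p ^ \<eta> j * du j) (\<lambda>j. of_nat p ^ (1 - \<eta> j) * wphi_inv p (dv j))"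
proof -
  interpret witt_quotient p ty "r * \<nu>" n S \<pi> s t \<rho> by (rule assms)
  have sub: "x \<in> wring (p ^ r) \<Longrightarrow> x \<in> wring (p ^ (r * \<nu>))" for x :: "'k witt"
    using wring_mono[of r "r * \<nu>"] by auto
  have eps': "\<epsilon> i \<le> 1" for i using eps[of i] by auto
  have eta': "\<eta> j \<le> 1" for j using eta[of j] by auto
  show ?thesis
  proof unfold_locales
    show "exact_quot (WF p (p ^ r)) (p_elt p (WF p (p ^ r))) (inv_into UNIV (wfrob p) (c i))
        = wcomp (of_nat p ^ (1 - \<epsilon> i) * wphi_inv p (cv i))" if "i \<in> I" for i
      unfolding c_eq[OF that] by (rule exact_quot_WF[OF cu eps'])
    show "exact_quot (WF p (p ^ r)) (p_elt p (WF p (p ^ r))) (inv_into UNIV (wfrob p) (d j))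
        = wcomp (of_nat p ^ (1 - \<eta> j) * wphi_inv p (dv j))" if "j \<in> J" for j
      unfolding d_eq[OF that] by (rule exact_quot_WF[OF du eta'])
  qed (simp_all add: fin_I fin_J AI.act_props AJ.act_props c_eq d_eq wring_p_power_mult_iff wring_wphi_inv sub cu du)
qed

text \<open>Put A = du' cv' z and B = \<sigma>(y). After clearing units F says p^h A = p^e B, and V,
  after applying \<sigma>, says p^(1-e) A = p^(1-h) B, up to congruence. If e and h differ, the two
  coincide; if they are equal, one is A = B and the other its multiple by p. So F and V together
  give the stronger equation, which matters in the truncated case.\<close>

lemma x_rel:
  fixes z y :: "'k witt"
  assumes e: "e \<in> {0, 1::nat}" and h: "h \<in> {0, 1::nat}" and cu: "cu' * cv' = 1" and du: "du' * dv' = 1"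
  shows "weq n (of_nat p ^ h * du' * z) (of_nat p ^ e * cu' * wphi p y) \<and>
      weq n (of_nat p ^ (1 - h) * wphi_inv p dv' * y) (of_nat p ^ (1 - e) * wphi_inv p cv' * wphi_inv p z) \<longleftrightarrow>
    weq n (of_nat p ^ (if e = 0 \<and> h = 1 then 1 else 0) * (du' * cv' * z)) (of_nat p ^ (if e = 1 \<and> h = 0 then 1 else 0) * wphi p y)"
proof -
  interpret i: comm_ring_map "wphi p :: 'k witt \<Rightarrow> 'k witt" by (rule comm_ring_map_wphi)
  have cancel: "weq n (x' * a) (x' * b) \<longleftrightarrow> weq n a b" if "x' * y' = 1" for x' y' a b :: "'k witt"
  proof
    assume "weq n (x' * a) (x' * b)"
    moreover have "y' * (x' * d) = (x' * y') * d" for d by (simp only: mult_ac)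
    ultimately show "weq n a b"
      using weq_mult[OF weq_refl[of n y'], of "x' * a" "x' * b"] that by simp
  qed (rule weq_mult[OF weq_refl])
  have cu': "cv' * cu' = 1" and du': "dv' * du' = 1" using cu du by (simp_all add: mult.commute)
  let ?A = "du' * cv' * z" and ?B = "wphi p y"
  have "weq n (of_nat p ^ h * du' * z) (of_nat p ^ e * cu' * ?B) \<longleftrightarrow>
      weq n (cv' * (of_nat p ^ h * du' * z)) (cv' * (of_nat p ^ e * cu' * ?B))"
    by (rule cancel[OF cu', symmetric])
  also have "cv' * (of_nat p ^ h * du' * z) = pp ^ h * ?A" by (simp only: mult_ac)
  also have "cv' * (of_nat p ^ e * cu' * ?B) = pp ^ e * ((cu' * cv') * ?B)" by (simp only: mult_ac)
  finally have F: "weq n (of_nat p ^ h * du' * z) (of_nat p ^ e * cu' * ?B) \<longleftrightarrow> weq n (pp ^ h * ?A) (pp ^ e * ?B)"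
    by (simp add: cu)
  have "weq n (of_nat p ^ (1 - h) * wphi_inv p dv' * y) (of_nat p ^ (1 - e) * wphi_inv p cv' * wphi_inv p z) \<longleftrightarrow>
      weq n (wphi p (of_nat p ^ (1 - h) * wphi_inv p dv' * y)) (wphi p (of_nat p ^ (1 - e) * wphi_inv p cv' * wphi_inv p z))"
    by (rule weq_wphi[symmetric])
  also have "\<dots> \<longleftrightarrow> weq n (pp ^ (1 - h) * dv' * ?B) (pp ^ (1 - e) * cv' * z)"
    by (simp only: i.map_mult i.map_power i.map_of_nat wphi_wphi_inv)
  also have "\<dots> \<longleftrightarrow> weq n (du' * (pp ^ (1 - h) * dv' * ?B)) (du' * (pp ^ (1 - e) * cv' * z))"
    by (rule cancel[OF du, symmetric])
  also have "du' * (pp ^ (1 - h) * dv' * ?B) = pp ^ (1 - h) * ((du' * dv') * ?B)" by (simp only: mult_ac)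
  also have "du' * (pp ^ (1 - e) * cv' * z) = pp ^ (1 - e) * ?A" by (simp only: mult_ac)
  finally have V': "weq n (of_nat p ^ (1 - h) * wphi_inv p dv' * y) (of_nat p ^ (1 - e) * wphi_inv p cv' * wphi_inv p z) \<longleftrightarrow>
      weq n (pp ^ (1 - h) * ((du' * dv') * ?B)) (pp ^ (1 - e) * ?A)" .
  have V: "weq n (of_nat p ^ (1 - h) * wphi_inv p dv' * y) (of_nat p ^ (1 - e) * wphi_inv p cv' * wphi_inv p z) \<longleftrightarrow>
      weq n (pp ^ (1 - e) * ?A) (pp ^ (1 - h) * ?B)"
    unfolding V' du mult_1 using weq_sym by blast
  have mult: "weq n ?A ?B \<Longrightarrow> weq n (pp * ?A) (pp * ?B)" by (rule weq_mult[OF weq_refl])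
  show ?thesis
    unfolding F V using e h mult by auto
qed

lemma fv_orbit:
  assumes wq: "witt_quotient p (r * \<nu>) n S \<pi> s t (\<rho> :: 'k witt \<Rightarrow> 's)" and \<nu>: "\<nu> \<ge> 1"
    and z: "z \<in> I \<times> J" and m: "m \<ge> 1" "\<And>k. walk z (k + int m) = walk z k" "inj_on (walk z) {0..<int m}"
  shows "fv_orbit p (r * \<nu>) n S \<pi> s t \<rho> (p ^ r)
    I act_I c (\<lambda>i. of_nat p ^ \<epsilon> i * cu i) (\<lambda>i. of_nat p ^ (1 - \<epsilon> i) * wphi_inv p (cv i))
    J act_J d (\<lambda>j. of_nat p ^ \<eta> j * du j) (\<lambda>j. of_nat p ^ (1 - \<eta> j) * wphi_inv p (dv j))
    m (\<lambda>k. du (snd (walk z k)) * cv (fst (walk z k))) (\<lambda>k. plus_edge (walk z k)) (\<lambda>k. minus_edge (walk z k)) (walk z)"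
proof -
  interpret fv_pair p ty "r * \<nu>" n S \<pi> s t \<rho> "p ^ r"
    I act_I c "\<lambda>i. of_nat p ^ \<epsilon> i * cu i" "\<lambda>i. of_nat p ^ (1 - \<epsilon> i) * wphi_inv p (cv i)"
    J act_J d "\<lambda>j. of_nat p ^ \<eta> j * du j" "\<lambda>j. of_nat p ^ (1 - \<eta> j) * wphi_inv p (dv j)"
    by (rule fv_pair[OF wq])
  have sub: "x \<in> wring (p ^ r) \<Longrightarrow> x \<in> wring (p ^ (r * \<nu>))" for x :: "'k witt"
    using wring_mono[of r "r * \<nu>"] by auto
  have cyc: "cyclic_system p (r * \<nu>) m (wphi p) (wphi_inv p) (\<lambda>k. du (snd (walk z k)) * cv (fst (walk z k)))
      (\<lambda>k. plus_edge (walk z k)) (\<lambda>k. minus_edge (walk z k))"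
  proof unfold_locales
    fix k
    show "wcomp (du (snd (walk z k)) * cv (fst (walk z k))) 0 \<noteq> 0"
      using unit_wcomp_0[OF du(3)] unit_wcomp_0[OF trans[OF mult.commute cu(3)]] by (simp add: wcomp_mult_0)
    show "du (snd (walk z k)) * cv (fst (walk z k)) \<in> wring (p ^ (r * \<nu>))"
      by (intro wring_closed(6) sub du cu)
    show "(plus_edge (walk z k), minus_edge (walk z k)) \<in> {(0, 0), (1, 0), (0, 1)}"
      by (auto simp: plus_edge_def minus_edge_def)
  qed (use m f_pos in \<open>simp_all add: wring_wphi\<close>)
  then interpret cyclic_system p ty "r * \<nu>" m "wphi p" "wphi_inv p" "\<lambda>k. du (snd (walk z k)) * cv (fst (walk z k))"
      "\<lambda>k. plus_edge (walk z k)" "\<lambda>k. minus_edge (walk z k)" .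
  show ?thesis
  proof unfold_locales
    fix k
    show "walk z k \<in> I \<times> J" by (rule walk_mem[OF z])
    show "walk z (k + int m) = walk z k" by (rule m(2))
    show "inj_on (walk z) {0..<int m}" by (rule m(3))
    have "walk z (k + 1) = walk (walk z k) 1" using walk_add[OF z, of 1 k] by (simp add: add.commute)
    then show "walk z (k + 1) = (act_I (of_nat p) (fst (walk z k)), act_J (of_nat p) (snd (walk z k)))"
      by (simp add: walk_def AI.pw_1 AJ.pw_1)
    fix x y :: "'k witt"
    show "weq n (of_nat p ^ \<eta> (snd (walk z k)) * du (snd (walk z k)) * x)
         (of_nat p ^ \<epsilon> (fst (walk z k)) * cu (fst (walk z k)) * wphi p y) \<and>
        weq n (of_nat p ^ (1 - \<eta> (snd (walk z k))) * wphi_inv p (dv (snd (walk z k))) * y)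
         (of_nat p ^ (1 - \<epsilon> (fst (walk z k))) * wphi_inv p (cv (fst (walk z k))) * wphi_inv p x) \<longleftrightarrow>
      weq n (of_nat p ^ minus_edge (walk z k) * (du (snd (walk z k)) * cv (fst (walk z k)) * x)) (of_nat p ^ plus_edge (walk z k) * wphi p y)"
      unfolding plus_edge_def minus_edge_def by (rule x_rel[OF eps eta cu(3) du(3)])
  qed
qed

text \<open>One period of the walk meets each point of the orbit exactly once, so counting indices
  is counting points.\<close>

lemma sum_walk_indicator:
  assumes m: "m \<ge> 1" "\<And>k. walk z (k + int m) = walk z k" "inj_on (walk z) {0..<int m}"
  shows "(\<Sum>i<m. if walk z (int i) \<in> Y then 1 else 0 :: nat) = card (Y \<inter> range (walk z))"
proof -
  have inj: "inj_on (\<lambda>i. walk z (int i)) {..<m}"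
  proof (rule inj_onI)
    fix i j assume "i \<in> {..<m}" "j \<in> {..<m}" "walk z (int i) = walk z (int j)"
    then have "int i = int j" by (intro inj_onD[OF m(3)]) auto
    then show "i = j" by simp
  qed
  have "range (walk z) \<subseteq> (\<lambda>i. walk z (int i)) ` {..<m}"
  proof (rule image_subsetI)
    fix k
    have "walk z (k mod int m + int m * (k div int m)) = walk z (k mod int m)"
      by (rule int_periodic_shift[of "walk z" m, OF m(2)])
    then show "walk z k \<in> (\<lambda>i. walk z (int i)) ` {..<m}"
      using m(1) by (intro image_eqI[of _ _ "nat (k mod int m)"]) (auto simp: nat_less_iff)
  qed
  then have rng: "range (walk z) = (\<lambda>i. walk z (int i)) ` {..<m}" by auto
  have "(\<Sum>i<m. if walk z (int i) \<in> Y then 1 else 0 :: nat) = card {i \<in> {..<m}. walk z (int i) \<in> Y}"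
    by (simp add: sum.If_cases Int_def)
  also have "\<dots> = card ((\<lambda>i. walk z (int i)) ` {i \<in> {..<m}. walk z (int i) \<in> Y})"
    by (rule card_image[symmetric], rule inj_on_subset[OF inj]) auto
  also have "(\<lambda>i. walk z (int i)) ` {i \<in> {..<m}. walk z (int i) \<in> Y} = Y \<inter> range (walk z)"
    unfolding rng by auto
  finally show ?thesis .
qed

lemma direct_sum:
  assumes wq: "witt_quotient p (r * \<nu>) n S \<pi> s t (\<rho> :: 'k witt \<Rightarrow> 's)"
  shows "internal_direct_sum
    (fv_hom (WF p (p ^ (r * \<nu>))) (base_change p (p ^ r) S \<pi> s t J act_J d) (base_change p (p ^ r) S \<pi> s t I act_I c))
    (diag_orbits p I act_I J act_J)
    (fv_hom_supp (WF p (p ^ (r * \<nu>))) J (base_change p (p ^ r) S \<pi> s t J act_J d) I (base_change p (p ^ r) S \<pi> s t I act_I c))"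
proof -
  interpret fv_pair p ty "r * \<nu>" n S \<pi> s t \<rho> "p ^ r"
    I act_I c "\<lambda>i. of_nat p ^ \<epsilon> i * cu i" "\<lambda>i. of_nat p ^ (1 - \<epsilon> i) * wphi_inv p (cv i)"
    J act_J d "\<lambda>j. of_nat p ^ \<eta> j * du j" "\<lambda>j. of_nat p ^ (1 - \<eta> j) * wphi_inv p (dv j)"
    by (rule fv_pair[OF wq])
  show ?thesis
  proof (rule internal_direct_sum_supp[OF diag_orbits_partition(1) _ diag_orbits_partition(2,3)])
    fix O1 assume "O1 \<in> diag_orbits p I act_I J act_J"
    then obtain z where z: "z \<in> I \<times> J" "O1 = range (walk z)" unfolding diag_orbits_eq by blast
    show "invariant O1"
      unfolding invariant_def z(2)
    proof (intro ballI)
      fix i j assume ij: "i \<in> I" "j \<in> J"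
      have g: "(act_I (of_nat p) i, act_J (of_nat p) j) = walk (i, j) 1" by (simp add: walk_def AI.pw_1 AJ.pw_1)
      have e: "x \<in> range (walk z) \<longleftrightarrow> range (walk x) = range (walk z)" if "x \<in> I \<times> J" for x
      proof
        assume "x \<in> range (walk z)"
        then obtain k where "x = walk z k" by auto
        then show "range (walk x) = range (walk z)" using range_walk_shift[OF z(1)] by simp
      next
        assume e: "range (walk x) = range (walk z)"
        have "walk x 0 \<in> range (walk x)" by simp
        then show "x \<in> range (walk z)" unfolding e walk_0[OF that] .
      qed
      have ij': "(i, j) \<in> I \<times> J" using ij by simp
      show "(act_I (of_nat p) i, act_J (of_nat p) j) \<in> range (walk z) \<longleftrightarrow> (i, j) \<in> range (walk z)"
        unfolding g e[OF walk_mem[OF ij']] e[OF ij'] range_walk_shift[OF ij'] ..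
    qed
  qed auto
qed

end

lemma ex_unit_decomposition:
  fixes c :: "'i \<Rightarrow> 'k::alg_closed_field wvec"
  assumes "Factorial_Ring.prime p" "CHAR('k) = p"
    and "\<And>i. i \<in> I \<Longrightarrow> c i \<in> carrier (WF p (p ^ r))"
    and "\<And>i. i \<in> I \<Longrightarrow> ord_p p (WF p (p ^ r)) (c i) = enat (\<epsilon> i)"
  shows "\<exists>u v. \<forall>i. u i \<in> wring (p ^ r) \<and> v i \<in> wring (p ^ r) \<and> u i * v i = 1 \<and>
    (i \<in> I \<longrightarrow> c i = wcomp (of_nat p ^ \<epsilon> i * u i))"
proof -
  interpret witt_field p "TYPE('k)" by standard fact+
  have "\<exists>u v. u \<in> wring (p ^ r) \<and> v \<in> wring (p ^ r) \<and> u * v = 1 \<and> (i \<in> I \<longrightarrow> c i = wcomp (of_nat p ^ \<epsilon> i * u))" for i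
  proof (cases "i \<in> I")
    case True
    then show ?thesis using ord_p_unit_decomposition[OF assms(3,4)] by blast
  next
    case False
    \<comment> \<open>Outside I the default unit is 1.\<close>
    then show ?thesis using wring_closed(2) by (intro exI[of _ 1]) auto
  qed
  then show ?thesis by metis
qed

text \<open>A factor K independent of \<nu> contributes ln K / (\<nu> ln q) to the ratio, which
  tends to 0.\<close>

lemma log_ratio_limit:
  fixes N :: "nat \<Rightarrow> nat" and q d :: nat and K :: real
  assumes "q \<ge> 2" "K \<ge> 1" and lo: "\<And>\<nu>. \<nu> \<ge> 1 \<Longrightarrow> real ((q ^ \<nu>) ^ d) \<le> real (N \<nu>)"
    and hi: "\<And>\<nu>. \<nu> \<ge> 1 \<Longrightarrow> real (N \<nu>) \<le> K * real ((q ^ \<nu>) ^ d)"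
  shows "(\<lambda>\<nu>. ln (real (N \<nu>)) / ln (real (q ^ \<nu>))) \<longlonglongrightarrow> real d"
proof (rule tendsto_sandwich)
  have lq: "ln (real q) > 0" using assms(1) by simp
  have pos: "real ((q ^ \<nu>) ^ d) > 0" for \<nu> using assms(1) by simp
  have lnQ: "ln (real (q ^ \<nu>)) = real \<nu> * ln (real q)" for \<nu> using assms(1) by (simp add: ln_realpow)
  have lnQd: "ln (real ((q ^ \<nu>) ^ d)) = real d * ln (real (q ^ \<nu>))" for \<nu> using assms(1) by (simp add: ln_realpow)
  have lnQ_pos: "ln (real (q ^ \<nu>)) > 0" if "\<nu> \<ge> 1" for \<nu> using lq that by (simp only: lnQ) simp
  show "\<forall>\<^sub>F \<nu> in sequentially. real d \<le> ln (real (N \<nu>)) / ln (real (q ^ \<nu>))"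
  proof (rule eventually_sequentiallyI)
    fix \<nu> :: nat assume \<nu>: "1 \<le> \<nu>"
    have "ln (real ((q ^ \<nu>) ^ d)) \<le> ln (real (N \<nu>))"
      using lo[OF \<nu>] pos[of \<nu>] by (meson ln_le_cancel_iff less_le_trans)
    then show "real d \<le> ln (real (N \<nu>)) / ln (real (q ^ \<nu>))"
      unfolding lnQd using lnQ_pos[OF \<nu>] by (simp only: pos_le_divide_eq)
  qed
  show "\<forall>\<^sub>F \<nu> in sequentially. ln (real (N \<nu>)) / ln (real (q ^ \<nu>)) \<le> real d + (ln K / ln (real q)) / real \<nu>"
  proof (rule eventually_sequentiallyI)
    fix \<nu> :: nat assume \<nu>: "1 \<le> \<nu>"
    have "ln (real (N \<nu>)) \<le> ln (K * real ((q ^ \<nu>) ^ d))"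
      using hi[OF \<nu>] lo[OF \<nu>] pos[of \<nu>] by (meson ln_le_cancel_iff less_le_trans)
    also have "\<dots> = ln K + real d * ln (real (q ^ \<nu>))"
      unfolding lnQd[symmetric] using assms(2) pos[of \<nu>] by (intro ln_mult_pos) auto
    finally have "ln (real (N \<nu>)) / ln (real (q ^ \<nu>)) \<le> (ln K + real d * ln (real (q ^ \<nu>))) / ln (real (q ^ \<nu>))"
      using lnQ_pos[OF \<nu>] by (intro divide_right_mono) auto
    also have "\<dots> = real d + ln K / ln (real (q ^ \<nu>))"
      using lnQ_pos[OF \<nu>] by (simp add: add_divide_distrib)
    also have "ln K / ln (real (q ^ \<nu>)) = (ln K / ln (real q)) / real \<nu>"
      unfolding lnQ by simp
    finally show "ln (real (N \<nu>)) / ln (real (q ^ \<nu>)) \<le> real d + (ln K / ln (real q)) / real \<nu>" .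
  qed
  show "(\<lambda>\<nu>. real d + (ln K / ln (real q)) / real \<nu>) \<longlonglongrightarrow> real d"
    using tendsto_add[OF tendsto_const[of "real d"] lim_const_over_n[of "ln K / ln (real q)"]] by simp
qed simp

theorem theorem8p3:
  fixes p q r :: nat
    and I I0 I1 :: "'i set" and a :: "rat \<Rightarrow> 'i \<Rightarrow> 'i" and c :: "'i \<Rightarrow> 'k::alg_closed_field wvec"
    and J J0 J1 :: "'j set" and b :: "rat \<Rightarrow> 'j \<Rightarrow> 'j" and d :: "'j \<Rightarrow> 'k wvec"
  assumes "Factorial_Ring.prime p" and "CHAR('k) = p" and "r \<ge> 1" and "q = p ^ r"
    and "finite I" and "group_action (p_group p) I a" and "I = I0 \<union> I1" and "I0 \<inter> I1 = {}"
    and "\<And>i. i \<in> I \<Longrightarrow> c i \<in> carrier (WF p q)"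
    and "\<And>i. i \<in> I0 \<Longrightarrow> ord_p p (WF p q) (c i) = 0"
    and "\<And>i. i \<in> I1 \<Longrightarrow> ord_p p (WF p q) (c i) = 1"
    and "finite J" and "group_action (p_group p) J b" and "J = J0 \<union> J1" and "J0 \<inter> J1 = {}"
    and "\<And>j. j \<in> J \<Longrightarrow> d j \<in> carrier (WF p q)"
    and "\<And>j. j \<in> J0 \<Longrightarrow> ord_p p (WF p q) (d j) = 0"
    and "\<And>j. j \<in> J1 \<Longrightarrow> ord_p p (WF p q) (d j) = 1"
  shows
    "(\<forall>\<nu>\<ge>1.
        internal_direct_sum (H_full p q \<nu> I a c J b d)
          (diag_orbits p I a J b) (H_full_orb p q \<nu> I a c J b d) \<and>
        (\<forall>n. internal_direct_sum (H_trunc p q n \<nu> I a c J b d)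
          (diag_orbits p I a J b) (H_trunc_orb p q n \<nu> I a c J b d)))
     \<and>
     (\<forall>o'\<in>diag_orbits p I a J b. \<forall>n.
        let Q = (\<lambda>\<nu>. quot_mult (p ^ n)
                  (restrict_group (H_full p q \<nu> I a c J b d) (H_full_orb p q \<nu> I a c J b d o')))
        in (\<forall>\<nu>\<ge>1. finite (carrier (Q \<nu>)) \<and> card (carrier (Q \<nu>)) \<le> p ^ (n * card o')) \<and>
           (\<exists>B. \<forall>\<nu>\<ge>1. card (carrier (Q \<nu>)) \<le> B))
     \<and>
     (\<forall>o'\<in>diag_orbits p I a J b. \<forall>\<^sub>F n in sequentially.
        (\<lambda>\<nu>. ln (real (card (H_trunc_orb p q n \<nu> I a c J b d o'))) / ln (real (q ^ \<nu>)))
          \<longlonglongrightarrow> real (orbit_dim I0 I1 J0 J1 o'))"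
proof -
  define \<epsilon> where "\<epsilon> i = (if i \<in> I1 then 1 else 0 :: nat)" for i
  define \<eta> where "\<eta> j = (if j \<in> J1 then 1 else 0 :: nat)" for j
  have ordc: "ord_p p (WF p (p ^ r)) (c i) = enat (\<epsilon> i)" if "i \<in> I" for i
    using that assms(4,7,10,11) by (auto simp: \<epsilon>_def zero_enat_def one_enat_def)
  have ordd: "ord_p p (WF p (p ^ r)) (d j) = enat (\<eta> j)" if "j \<in> J" for j
    using that assms(4,14,17,18) by (auto simp: \<eta>_def zero_enat_def one_enat_def)
  have cc: "c i \<in> carrier (WF p (p ^ r))" if "i \<in> I" for i using assms(9)[OF that] unfolding assms(4) .
  have dd: "d j \<in> carrier (WF p (p ^ r))" if "j \<in> J" for j using assms(16)[OF that] unfolding assms(4) .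
  have exC: "\<exists>u v :: 'i \<Rightarrow> 'k witt. \<forall>i. u i \<in> wring (p ^ r) \<and> v i \<in> wring (p ^ r) \<and> u i * v i = 1 \<and>
      (i \<in> I \<longrightarrow> c i = wcomp (of_nat p ^ \<epsilon> i * u i))"
    by (rule ex_unit_decomposition[OF assms(1,2)]) (simp_all only: cc ordc)
  have exD: "\<exists>u v :: 'j \<Rightarrow> 'k witt. \<forall>j. u j \<in> wring (p ^ r) \<and> v j \<in> wring (p ^ r) \<and> u j * v j = 1 \<and>
      (j \<in> J \<longrightarrow> d j = wcomp (of_nat p ^ \<eta> j * u j))"
    by (rule ex_unit_decomposition[OF assms(1,2)]) (simp_all only: dd ordd)
  obtain cu cv where C: "\<forall>i. cu i \<in> wring (p ^ r) \<and> cv i \<in> wring (p ^ r) \<and> cu i * cv i = 1 \<and>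
      (i \<in> I \<longrightarrow> c i = wcomp (of_nat p ^ \<epsilon> i * cu i))"
    using exC by (elim exE)
  obtain du dv where D: "\<forall>j. du j \<in> wring (p ^ r) \<and> dv j \<in> wring (p ^ r) \<and> du j * dv j = 1 \<and>
      (j \<in> J \<longrightarrow> d j = wcomp (of_nat p ^ \<eta> j * du j))"
    using exD by (elim exE)
  interpret fv_data p "TYPE('k)" r I a c \<epsilon> cu cv J b d \<eta> du dv
  proof (intro fv_data.intro fv_data_axioms.intro witt_field.intro assms)
  qed (use C D in \<open>simp_all add: \<epsilon>_def \<eta>_def\<close>)
  have Q: "q ^ \<nu> = p ^ (r * \<nu>)" for \<nu> by (simp add: assms(4) power_mult)
  have full: "witt_quotient p (r * \<nu>) \<infinity> (WF p (p ^ (r * \<nu>))) id (wfrob p) (inv_into UNIV (wfrob p)) (wcomp :: 'k witt \<Rightarrow> _)"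
    if "\<nu> \<ge> 1" for \<nu>
    by (rule witt_quotient_full) (use that assms(3) in simp)
  have trunc: "witt_quotient p (r * \<nu>) (enat n) (WF p (p ^ (r * \<nu>)) Quot pn_ideal p n (WF p (p ^ (r * \<nu>))))
    (\<lambda>a. pn_ideal p n (WF p (p ^ (r * \<nu>))) +>\<^bsub>WF p (p ^ (r * \<nu>))\<^esub> a) ((`) (wfrob p)) ((`) (inv_into UNIV (wfrob p)))
    (\<lambda>x :: 'k witt. pn_ideal p n (WF p (p ^ (r * \<nu>))) +>\<^bsub>WF p (p ^ (r * \<nu>))\<^esub> wcomp x)"
    if "\<nu> \<ge> 1" for \<nu> n
    by (rule witt_quotient_trunc) (use that assms(3) in simp)
  have part1: "internal_direct_sum (H_full p q \<nu> I a c J b d) (diag_orbits p I a J b) (H_full_orb p q \<nu> I a c J b d)"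
    "internal_direct_sum (H_trunc p q n \<nu> I a c J b d) (diag_orbits p I a J b) (H_trunc_orb p q n \<nu> I a c J b d)"
    if "\<nu> \<ge> 1" for \<nu> n
    using direct_sum[OF full[OF that]] direct_sum[OF trunc[OF that, of n]]
    unfolding H_full_def H_full_orb_def H_trunc_def H_trunc_orb_def M_full_def M_trunc_def Let_def Q assms(4)[symmetric]
    by simp_all
  have orbits: "(\<forall>\<nu>\<ge>1. \<forall>n. finite (carrier (quot_mult (p ^ n) (restrict_group (H_full p q \<nu> I a c J b d) (H_full_orb p q \<nu> I a c J b d o')))) \<and>
        card (carrier (quot_mult (p ^ n) (restrict_group (H_full p q \<nu> I a c J b d) (H_full_orb p q \<nu> I a c J b d o')))) \<le> p ^ (n * card o')) \<and>
      (\<forall>\<nu>\<ge>1. \<forall>n\<ge>card o'. (q ^ \<nu>) ^ orbit_dim I0 I1 J0 J1 o' \<le> card (H_trunc_orb p q n \<nu> I a c J b d o') \<and>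
        card (H_trunc_orb p q n \<nu> I a c J b d o') \<le> p ^ (n * card o') * (q ^ \<nu>) ^ orbit_dim I0 I1 J0 J1 o')"
    if o': "o' \<in> diag_orbits p I a J b" for o'
  proof -
    obtain z where z: "z \<in> I \<times> J" "o' = range (walk z)" using o' unfolding diag_orbits_eq by blast
    obtain m :: nat where m: "m \<ge> 1" "\<And>k. walk z (k + int m) = walk z k" "inj_on (walk z) {0..<int m}"
      using walk_periodic[OF z(1)] by blast
    have sub: "walk z k \<in> I \<times> J" for k by (rule walk_mem[OF z(1)])
    have plus_edge: "plus_edge (walk z k) = (if walk z k \<in> I1 \<times> J0 then 1 else 0)" for k
      using sub[of k] assms(14,15) by (cases "walk z k") (auto simp: plus_edge_def \<epsilon>_def \<eta>_def)
    have minus_edge: "minus_edge (walk z k) = (if walk z k \<in> I0 \<times> J1 then 1 else 0)" for k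
      using sub[of k] assms(7,8) by (cases "walk z k") (auto simp: minus_edge_def \<epsilon>_def \<eta>_def)
    note orb = fv_orbit[OF _ _ z(1) m]
    \<comment> \<open>The first sum counts I1 x J0 and the second I0 x J1, the opposite order to
      \<open>orbit_dim\<close>.\<close>
    have AB: "min (\<Sum>i<m. plus_edge (walk z (int i))) (\<Sum>i<m. minus_edge (walk z (int i))) = orbit_dim I0 I1 J0 J1 o'"
      unfolding plus_edge minus_edge sum_walk_indicator[OF m] orbit_dim_def z(2) by (rule min.commute)
    have quot: "finite (carrier (quot_mult (p ^ n) (restrict_group (H_full p q \<nu> I a c J b d) (H_full_orb p q \<nu> I a c J b d o')))) \<and>
        card (carrier (quot_mult (p ^ n) (restrict_group (H_full p q \<nu> I a c J b d) (H_full_orb p q \<nu> I a c J b d o')))) \<le> p ^ (n * card o')"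
      if \<nu>: "\<nu> \<ge> 1" for \<nu> n
    proof -
      interpret fv_orbit p "TYPE('k)" "r * \<nu>" \<infinity> "WF p (p ^ (r * \<nu>))" id "wfrob p" "inv_into UNIV (wfrob p)" wcomp "p ^ r"
        I a c "\<lambda>i. of_nat p ^ \<epsilon> i * cu i" "\<lambda>i. of_nat p ^ (1 - \<epsilon> i) * wphi_inv p (cv i)"
        J b d "\<lambda>j. of_nat p ^ \<eta> j * du j" "\<lambda>j. of_nat p ^ (1 - \<eta> j) * wphi_inv p (dv j)"
        m "\<lambda>k. du (snd (walk z k)) * cv (fst (walk z k))" "\<lambda>k. plus_edge (walk z k)" "\<lambda>k. minus_edge (walk z k)" "walk z"
        by (rule orb[OF full[OF \<nu>] \<nu>])
      show ?thesis
        using card_quot_mult_supp[OF refl, of n] card_orb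
        unfolding H_full_def H_full_orb_def M_full_def Q assms(4)[symmetric] orb_def z(2) by simp
    qed
    have trc: "(q ^ \<nu>) ^ orbit_dim I0 I1 J0 J1 o' \<le> card (H_trunc_orb p q n \<nu> I a c J b d o') \<and>
        card (H_trunc_orb p q n \<nu> I a c J b d o') \<le> p ^ (n * card o') * (q ^ \<nu>) ^ orbit_dim I0 I1 J0 J1 o'"
      if \<nu>: "\<nu> \<ge> 1" and n: "n \<ge> card o'" for \<nu> n
    proof -
      interpret fv_orbit p "TYPE('k)" "r * \<nu>" "enat n" "WF p (p ^ (r * \<nu>)) Quot pn_ideal p n (WF p (p ^ (r * \<nu>)))"
        "\<lambda>a. pn_ideal p n (WF p (p ^ (r * \<nu>))) +>\<^bsub>WF p (p ^ (r * \<nu>))\<^esub> a" "(`) (wfrob p)" "(`) (inv_into UNIV (wfrob p))"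
        "\<lambda>x :: 'k witt. pn_ideal p n (WF p (p ^ (r * \<nu>))) +>\<^bsub>WF p (p ^ (r * \<nu>))\<^esub> wcomp x" "p ^ r"
        I a c "\<lambda>i. of_nat p ^ \<epsilon> i * cu i" "\<lambda>i. of_nat p ^ (1 - \<epsilon> i) * wphi_inv p (cv i)"
        J b d "\<lambda>j. of_nat p ^ \<eta> j * du j" "\<lambda>j. of_nat p ^ (1 - \<eta> j) * wphi_inv p (dv j)"
        m "\<lambda>k. du (snd (walk z k)) * cv (fst (walk z k))" "\<lambda>k. plus_edge (walk z k)" "\<lambda>k. minus_edge (walk z k)" "walk z"
        by (rule orb[OF trunc[OF \<nu>] \<nu>])
      have co: "card o' = m" using card_orb by (simp add: orb_def z(2))
      have "min A B = orbit_dim I0 I1 J0 J1 o'" unfolding A_def B_def by (rule AB)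
      then show ?thesis
        using card_supp_bounds[OF refl n[unfolded co]] co
        unfolding H_trunc_orb_def M_trunc_def Let_def Q assms(4)[symmetric] orb_def z(2) by simp
    qed
    show ?thesis using quot trc by blast
  qed
  have q2: "q \<ge> 2" using self_le_power[of p r] p_ge_2 assms(3,4) by simp
  show ?thesis
  proof (intro conjI)
    show "\<forall>\<nu>\<ge>1.
        internal_direct_sum (H_full p q \<nu> I a c J b d)
          (diag_orbits p I a J b) (H_full_orb p q \<nu> I a c J b d) \<and>
        (\<forall>n. internal_direct_sum (H_trunc p q n \<nu> I a c J b d)
          (diag_orbits p I a J b) (H_trunc_orb p q n \<nu> I a c J b d))"
      using part1 by blast
    show "\<forall>o'\<in>diag_orbits p I a J b. \<forall>n.
        let Q = (\<lambda>\<nu>. quot_mult (p ^ n)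
                  (restrict_group (H_full p q \<nu> I a c J b d) (H_full_orb p q \<nu> I a c J b d o')))
        in (\<forall>\<nu>\<ge>1. finite (carrier (Q \<nu>)) \<and> card (carrier (Q \<nu>)) \<le> p ^ (n * card o')) \<and>
           (\<exists>B. \<forall>\<nu>\<ge>1. card (carrier (Q \<nu>)) \<le> B)"
      unfolding Let_def using orbits by blast
    show "\<forall>o'\<in>diag_orbits p I a J b. \<forall>\<^sub>F n in sequentially.
        (\<lambda>\<nu>. ln (real (card (H_trunc_orb p q n \<nu> I a c J b d o'))) / ln (real (q ^ \<nu>)))
          \<longlonglongrightarrow> real (orbit_dim I0 I1 J0 J1 o')"
    proof
      fix o' assume o': "o' \<in> diag_orbits p I a J b"
      show "\<forall>\<^sub>F n in sequentially.
        (\<lambda>\<nu>. ln (real (card (H_trunc_orb p q n \<nu> I a c J b d o'))) / ln (real (q ^ \<nu>)))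
          \<longlonglongrightarrow> real (orbit_dim I0 I1 J0 J1 o')"
      \<comment> \<open>The orbit length serves as threshold for n, and the constant p^(n |o'|)
        depends on n but not on \<nu>.\<close>
      proof (rule eventually_sequentiallyI[of "card o'"], rule log_ratio_limit[OF q2, of "real (p ^ (n * card o'))" for n])
        fix n \<nu> :: nat assume n: "card o' \<le> n" and \<nu>: "1 \<le> \<nu>"
        show "real ((q ^ \<nu>) ^ orbit_dim I0 I1 J0 J1 o') \<le> real (card (H_trunc_orb p q n \<nu> I a c J b d o'))"
          using orbits[OF o'] n \<nu> by (simp only: of_nat_le_iff)
        show "real (card (H_trunc_orb p q n \<nu> I a c J b d o')) \<le> real (p ^ (n * card o')) * real ((q ^ \<nu>) ^ orbit_dim I0 I1 J0 J1 o')"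
          using orbits[OF o'] n \<nu> by (simp only: of_nat_le_iff flip: of_nat_mult)
      qed (use p_gt_0 in \<open>simp add: Suc_le_eq\<close>)
    qed
  qed
qed

end
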